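(* Let $n,m\in\mathbb N$ and $K\in\mathcal K^n$. Then for every $\bar\theta=(\theta_1,\dots,\theta_m)\in\mathbb S^{nm-1}\subset\mathbb R^{nm}$, \[ \frac{d}{dr}\, g_{K,m}(r\bar\theta)\Big|_{r=0^+} = -\int_{\partial K}\max_{1\le i\le m}\langle \theta_i, n_K(y)\rangle_-\, d\mathcal H^{n-1}(y). \]
   Context: A convex body in $\mathbb R^d$ is a compact convex set with nonempty interior; $\mathcal K^n$ is the class of convex bodies in $\mathbb R^n$. We identify $\mathbb R^{nm}=(\mathbb R^n)^m$ and write $\bar x=(x_1,\dots,x_m)$ with $x_i\in\mathbb R^n$. For $t\in\mathbb R$, $t_-=\max\{-t,0\}$. For $y\in\partial K$, $n_K(y)$ denotes the outer unit normal of $K$ at $y$ (defined for $\mathcal H^{n-1}$-a.e. $y\in\partial K$), and $\mathcal H^{n-1}$ is $(n-1)$-dimensional Hausdorff measure. The $m$-covariogram of $K$ is $g_{K,m}:\mathbb R^{nm}\to[0,\infty)$, $g_{K,m}(\bar x)=\mathrm{Vol}_n\big(K\cap\bigcap_{i=1}^m(x_i+K)\big)$. *)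

theory Defs
  imports "HOL-Analysis.Analysis"
begin

definition convex_body :: "('a::euclidean_space) set \<Rightarrow> bool" where
  "convex_body K \<longleftrightarrow> compact K \<and> convex K \<and> interior K \<noteq> {}"

definition covariogram :: "(real^'n) set \<Rightarrow> real^'n^'m \<Rightarrow> real" where
  "covariogram K x = measure lebesgue (K \<inter> (\<Inter>i. (\<lambda>y. x $ i + y) ` K))"

text \<open>Outer unit normal of K at y (the unique unit vector u with u.(z-y) <= 0 for all z in K;
  unspecified where it is not unique, which happens only on an H^{n-1}-null subset of the boundary).\<close>
definition outer_normal :: "('a::euclidean_space) set \<Rightarrow> 'a \<Rightarrow> 'a" where
  "outer_normal K y = (THE u. norm u = 1 \<and> (\<forall>z\<in>K. inner u (z - y) \<le> 0))"

text \<open>s-dimensional Hausdorff measure (s natural), normalized so that H^n = Lebesgue measure on R^n.\<close>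
definition hausdorff_gauge :: "nat \<Rightarrow> 'a::metric_space set \<Rightarrow> real" where
  "hausdorff_gauge s C = (if C = {} then 0
      else unit_ball_vol (real s) / 2 ^ s * diameter C ^ s)"

definition hausdorff_pre :: "nat \<Rightarrow> real \<Rightarrow> 'a::metric_space set \<Rightarrow> ennreal" where
  "hausdorff_pre s \<delta> A =
     (INF C \<in> {C :: nat \<Rightarrow> 'a set. A \<subseteq> (\<Union>j. C j) \<and> (\<forall>j. bounded (C j) \<and> diameter (C j) \<le> \<delta>)}.
        (\<Sum>j. ennreal (hausdorff_gauge s (C j))))"

definition hausdorff_outer :: "nat \<Rightarrow> 'a::metric_space set \<Rightarrow> ennreal" where
  "hausdorff_outer s A = (SUP \<delta>\<in>{0<..}. hausdorff_pre s \<delta> A)"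

definition hausdorff_measure :: "nat \<Rightarrow> 'a::metric_space measure" where
  "hausdorff_measure s = measure_of UNIV (sets borel) (hausdorff_outer s)"

definition negpart :: "real \<Rightarrow> real" where
  "negpart t = max (- t) 0"

end

theory Submission
  imports Defs
begin

text \<open>
  Translate \<open>K\<close> so that \<open>0\<close> is an interior point, let \<open>p\<close> be its gauge function and write
  \<open>K\<^sub>r\<close> for the intersection of \<open>K\<close> with the bodies \<open>r\<theta>\<^sub>i + K\<close>, with gauge \<open>p\<^sub>r\<close>. In dimension \<open>n\<close> the integral
  of \<open>max 0 (1 - p\<^sub>r)\<close> is \<open>vol K\<^sub>r / (n + 1)\<close>, and \<open>(p\<^sub>r - p) / r\<close> tends to \<open>p M\<close> almost everywhere, where \<open>M\<close> is the
  maximum of the negative parts of \<open>\<theta>\<^sub>i \<bullet> \<nabla>p\<close>. By dominated convergence the derivative of the volume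
  is \<open>- (n + 1)\<close> times the integral of \<open>p M\<close> over \<open>K\<close>.

  It remains to see that the image of \<open>(n + 1) p |\<nabla>p| dx\<close> on \<open>K\<close> under the radial projection \<open>x / p x\<close> is
  the Hausdorff measure on the boundary. The map \<open>x / p x + p x ^ (n + 1) u\<close> has Jacobian
  \<open>(n + 1) p (\<nabla>p \<bullet> u)\<close>, which expresses the volume of the sheet \<open>E + {0<..1} u\<close> through that image measure. On
  a nearly flat piece \<open>E\<close> of the boundary with normal close to \<open>u\<close> this volume agrees up to a factor
  near \<open>1\<close> with the Hausdorff measure of \<open>E\<close>: from above by slicing a ball cover of the sheet obtained
  from Vitali's theorem, from below by the isodiametric inequality. The non-smooth boundary points span
  a null cone, and a slicing argument shows that they are null for the Hausdorff measure too.
\<close>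

section \<open>Hausdorff measure\<close>

text \<open>The comparison with Hausdorff measure must produce sharp constants on both sides. Its
  covers consist of arbitrary small sets weighted by their diameter, so a bound from below has to
  control every shape at once (isodiametric inequality), whereas a bound from above needs one
  economical cover. The tents avoid any description of the boundary of the intersection body: the
  domain of integration is fixed and the difference quotients are bounded. The weight
  \<open>(n + 1) p\<close> has the following origin. At \<open>x = t b\<close> with
  \<open>p b = 1\<close> the volume element is \<open>t^(n-1) (b . nu) dt dH(b)\<close>, where
  \<open>nu\<close> is the normal and \<open>b . nu\<close> is the reciprocal of the length of the
  gradient. A density \<open>(n + 1) p\<close> times that length therefore gives every ray the mass
  \<open>(n + 1) int_0^1 t^n dt = 1\<close>. The derivative of the tent integral leaves the same
  weight, because the level \<open>s\<close> of the gauge of the intersection body involves shifts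
  by \<open>s r\<close> times the directions. The sheets turn this coarea heuristic into a
  proof.\<close>

lemma diameter_le_dist:
  fixes S :: "'a::metric_space set"
  assumes "0 \<le> d" "\<And>x y. x \<in> S \<Longrightarrow> y \<in> S \<Longrightarrow> dist x y \<le> d"
  shows "diameter S \<le> d"
proof (cases "S = {}")
  case False
  then show ?thesis
    unfolding diameter_def using assms(2) by (auto intro!: cSUP_least)
qed (simp add: assms)

lemma hausdorff_gauge_empty [simp]: "hausdorff_gauge s {} = 0"
  by (simp add: hausdorff_gauge_def)

lemma hausdorff_gauge_nonneg: "bounded C \<Longrightarrow> 0 \<le> hausdorff_gauge s C"
  by (simp add: hausdorff_gauge_def diameter_ge_0)

lemma hausdorff_gauge_le:
  fixes C :: "'a::metric_space set"
  assumes "0 \<le> \<rho>" "\<And>x y. x \<in> C \<Longrightarrow> y \<in> C \<Longrightarrow> dist x y \<le> 2 * \<rho>" "bounded C"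
  shows "hausdorff_gauge s C \<le> unit_ball_vol (real s) * \<rho> ^ s"
proof (cases "C = {}")
  case False
  have "diameter C ^ s \<le> (2 * \<rho>) ^ s"
    using assms by (intro power_mono diameter_le_dist diameter_ge_0) auto
  then have "unit_ball_vol (real s) / 2 ^ s * diameter C ^ s
      \<le> unit_ball_vol (real s) / 2 ^ s * (2 * \<rho>) ^ s"
    by (intro mult_left_mono) auto
  also have "\<dots> = unit_ball_vol (real s) * \<rho> ^ s"
    by (simp add: power_mult_distrib)
  finally show ?thesis using False by (simp add: hausdorff_gauge_def)
qed (use assms in simp)

definition delta_cover :: "real \<Rightarrow> 'a::metric_space set \<Rightarrow> (nat \<Rightarrow> 'a set) \<Rightarrow> bool" where
  "delta_cover \<delta> A C \<longleftrightarrow> A \<subseteq> (\<Union>j. C j) \<and> (\<forall>j. bounded (C j) \<and> diameter (C j) \<le> \<delta>)"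

lemma hausdorff_pre_altdef:
  "hausdorff_pre s \<delta> A = (INF C \<in> Collect (delta_cover \<delta> A). (\<Sum>j. ennreal (hausdorff_gauge s (C j))))"
  by (simp add: hausdorff_pre_def delta_cover_def[abs_def])

lemma hausdorff_pre_le:
  "delta_cover \<delta> A C \<Longrightarrow> hausdorff_pre s \<delta> A \<le> (\<Sum>j. ennreal (hausdorff_gauge s (C j)))"
  unfolding hausdorff_pre_altdef by (rule INF_lower) simp

lemma hausdorff_pre_greatest:
  "(\<And>C. delta_cover \<delta> A C \<Longrightarrow> z \<le> (\<Sum>j. ennreal (hausdorff_gauge s (C j)))) \<Longrightarrow> z \<le> hausdorff_pre s \<delta> A"
  unfolding hausdorff_pre_altdef by (rule INF_greatest) simp

lemma hausdorff_pre_close: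
  "hausdorff_pre s \<delta> A < e \<Longrightarrow> \<exists>C. delta_cover \<delta> A C \<and> (\<Sum>j. ennreal (hausdorff_gauge s (C j))) < e"
  unfolding hausdorff_pre_altdef INF_less_iff by auto

lemma hausdorff_pre_mono: "A \<subseteq> B \<Longrightarrow> hausdorff_pre s \<delta> A \<le> hausdorff_pre s \<delta> B"
  by (rule hausdorff_pre_greatest, rule hausdorff_pre_le) (auto simp: delta_cover_def)

lemma hausdorff_pre_antimono: "\<delta> \<le> \<delta>' \<Longrightarrow> hausdorff_pre s \<delta>' A \<le> hausdorff_pre s \<delta> A"
  by (rule hausdorff_pre_greatest, rule hausdorff_pre_le) (auto simp: delta_cover_def intro: order_trans)

lemma hausdorff_pre_empty: "0 < \<delta> \<Longrightarrow> hausdorff_pre s \<delta> {} = 0"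
  using hausdorff_pre_le[of \<delta> "{}" "\<lambda>_. {}" s] by (simp add: delta_cover_def)

text \<open>Each \<open>A n\<close> gets a cover with excess \<open>e / 2^(n+1)\<close>, and the
  doubly indexed family is enumerated by \<open>prod_decode\<close>; this works already at fixed
  \<open>\<delta>\<close>.\<close>

lemma hausdorff_pre_UN_le: "hausdorff_pre s \<delta> (\<Union>i. A i) \<le> (\<Sum>i::nat. hausdorff_pre s \<delta> (A i))"
proof (rule ennreal_le_epsilon)
  fix e :: real assume "0 < e" "(\<Sum>n. hausdorff_pre s \<delta> (A n)) < top"
  then have *: "\<And>n. hausdorff_pre s \<delta> (A n) < hausdorff_pre s \<delta> (A n) + e * (1/2)^Suc n"
    by (auto simp add: less_top dest!: ennreal_suminf_lessD)
  obtain B where B: "\<And>n. delta_cover \<delta> (A n) (B n)"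
    and Ble: "\<And>n. (\<Sum>i. ennreal (hausdorff_gauge s (B n i))) \<le> hausdorff_pre s \<delta> (A n) + e * (1/2)^(Suc n)"
    using hausdorff_pre_close[OF *] by (metis less_imp_le)
  define C where "C = case_prod B o prod_decode"
  have sbB: "\<And>n. A n \<subseteq> (\<Union>i. B n i)"
    using B by (simp add: delta_cover_def)
  have "(\<Union>i. A i) \<subseteq> (\<Union>i. C i)"
    using sbB by (auto simp add: C_def subset_eq) (metis prod.case prod_encode_inverse)
  with B have "delta_cover \<delta> (\<Union>i. A i) C"
    by (auto simp: delta_cover_def C_def split: prod.split)
  then have "hausdorff_pre s \<delta> (\<Union>i. A i) \<le> (\<Sum>i. ennreal (hausdorff_gauge s (C i)))"
    by (rule hausdorff_pre_le)
  also have "\<dots> = (\<Sum>n. \<Sum>i. ennreal (hausdorff_gauge s (B n i)))"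
    unfolding C_def comp_def
    using suminf_ennreal_2dimen[of "\<lambda>n. \<Sum>i. ennreal (hausdorff_gauge s (B n i))"
        "\<lambda>(n,i). ennreal (hausdorff_gauge s (B n i))"]
    by (simp add: comp_def case_prod_beta)
  also have "\<dots> \<le> (\<Sum>n. hausdorff_pre s \<delta> (A n) + e * (1/2) ^ Suc n)"
    by (intro suminf_le suminf_nonneg allI Ble) auto
  also have "... = (\<Sum>n. hausdorff_pre s \<delta> (A n)) + (\<Sum>n. ennreal e * ennreal ((1/2) ^ Suc n))"
    using \<open>0 < e\<close> by (subst suminf_add[symmetric])
                     (auto simp del: ennreal_suminf_cmult simp add: ennreal_mult[symmetric])
  also have "\<dots> = (\<Sum>n. hausdorff_pre s \<delta> (A n)) + e"
    unfolding ennreal_suminf_cmult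
    by (subst suminf_ennreal_eq[OF zero_le_power power_half_series]) auto
  finally show "hausdorff_pre s \<delta> (\<Union>i. A i) \<le> (\<Sum>n. hausdorff_pre s \<delta> (A n)) + e" .
qed

lemma hausdorff_pre_le_outer: "0 < \<delta> \<Longrightarrow> hausdorff_pre s \<delta> A \<le> hausdorff_outer s A"
  unfolding hausdorff_outer_def by (rule SUP_upper) simp

lemma hausdorff_outer_least: "(\<And>\<delta>. 0 < \<delta> \<Longrightarrow> hausdorff_pre s \<delta> A \<le> z) \<Longrightarrow> hausdorff_outer s A \<le> z"
  unfolding hausdorff_outer_def by (rule SUP_least) simp

lemma hausdorff_outer_mono: "A \<subseteq> B \<Longrightarrow> hausdorff_outer s A \<le> hausdorff_outer s B"
  by (meson hausdorff_outer_least hausdorff_pre_le_outer hausdorff_pre_mono order_trans)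

lemma hausdorff_outer_empty [simp]: "hausdorff_outer s {} = 0"
  using hausdorff_outer_least[of s "{}" 0] by (simp add: hausdorff_pre_empty)

lemma hausdorff_outer_UN_le: "hausdorff_outer s (\<Union>i. A i) \<le> (\<Sum>i::nat. hausdorff_outer s (A i))"
proof (rule hausdorff_outer_least)
  fix \<delta> :: real assume "0 < \<delta>"
  have "hausdorff_pre s \<delta> (\<Union>i. A i) \<le> (\<Sum>i. hausdorff_pre s \<delta> (A i))"
    by (rule hausdorff_pre_UN_le)
  also have "\<dots> \<le> (\<Sum>i. hausdorff_outer s (A i))"
    by (intro suminf_le hausdorff_pre_le_outer \<open>0 < \<delta>\<close>) auto
  finally show "hausdorff_pre s \<delta> (\<Union>i. A i) \<le> (\<Sum>i. hausdorff_outer s (A i))" .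
qed

lemma outer_measure_space_hausdorff: "outer_measure_space (Pow UNIV) (hausdorff_outer s)"
  unfolding outer_measure_space_def positive_def increasing_def countably_subadditive_def
  by (auto simp: hausdorff_outer_mono hausdorff_outer_UN_le)

lemma hausdorff_outer_Un_le: "hausdorff_outer s (A \<union> B) \<le> hausdorff_outer s A + hausdorff_outer s B"
proof -
  have "subadditive (Pow UNIV) (hausdorff_outer s)"
    using outer_measure_space_hausdorff[of s]
    by (intro ring_of_sets.countably_subadditive_subadditive[of UNIV] algebra.axioms(1)[OF algebra_Pow])
       (auto simp: outer_measure_space_def)
  then have "hausdorff_outer s (A \<union> (B - A)) \<le> hausdorff_outer s A + hausdorff_outer s (B - A)"
    by (rule subadditiveD) auto
  also have "\<dots> \<le> hausdorff_outer s A + hausdorff_outer s B"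
    by (intro add_left_mono hausdorff_outer_mono) auto
  finally show ?thesis by simp
qed

text \<open>For \<open>\<delta> < d\<close> no covering set meets both \<open>A\<close> and
  \<open>B\<close>, so every cover of the union splits in two. This metric property is behind the
  measurability of closed sets.\<close>

lemma hausdorff_outer_separated:
  assumes "0 < d" and sep: "\<And>x y. x \<in> A \<Longrightarrow> y \<in> B \<Longrightarrow> d \<le> dist x y"
  shows "hausdorff_outer s A + hausdorff_outer s B \<le> hausdorff_outer s (A \<union> B)"
proof -
  have *: "hausdorff_pre s \<delta> A + hausdorff_pre s \<delta> B \<le> hausdorff_pre s \<delta> (A \<union> B)"
    if "0 < \<delta>" "\<delta> < d" for \<delta>
  proof (rule hausdorff_pre_greatest)
    fix C assume C: "delta_cover \<delta> (A \<union> B) C"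
    \<comment> \<open>Sets that miss \<open>A\<close> are replaced by \<open>{}\<close>, whose gauge
      is 0 by convention. This matters for \<open>s = 0\<close>, where
      \<open>diameter {} ^ 0\<close> would contribute 1.\<close>
    define CA where "CA = (\<lambda>j. if C j \<inter> A = {} then {} else C j)"
    define CB where "CB = (\<lambda>j. if C j \<inter> B = {} then {} else C j)"
    have "delta_cover \<delta> A CA" "delta_cover \<delta> B CB"
      using C \<open>0 < \<delta>\<close> unfolding delta_cover_def CA_def CB_def by (fastforce split: if_splits)+
    then have "hausdorff_pre s \<delta> A + hausdorff_pre s \<delta> B
        \<le> (\<Sum>j. ennreal (hausdorff_gauge s (CA j))) + (\<Sum>j. ennreal (hausdorff_gauge s (CB j)))"
      by (intro add_mono hausdorff_pre_le)
    also have "\<dots> = (\<Sum>j. ennreal (hausdorff_gauge s (CA j)) + ennreal (hausdorff_gauge s (CB j)))"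
      by (rule suminf_add) auto
    also have "\<dots> \<le> (\<Sum>j. ennreal (hausdorff_gauge s (C j)))"
    proof (rule suminf_le)
      fix j
      have "C j \<inter> A = {} \<or> C j \<inter> B = {}"
      proof (rule ccontr)
        assume "\<not> ?thesis"
        then obtain x y where "x \<in> C j" "x \<in> A" "y \<in> C j" "y \<in> B" by blast
        then have "d \<le> dist x y" "dist x y \<le> diameter (C j)" "diameter (C j) \<le> \<delta>"
          using C sep by (auto simp: delta_cover_def intro!: diameter_bounded_bound)
        with that show False by linarith
      qed
      then show "ennreal (hausdorff_gauge s (CA j)) + ennreal (hausdorff_gauge s (CB j))
          \<le> ennreal (hausdorff_gauge s (C j))"
        by (auto simp: CA_def CB_def)
    qed auto
    finally show "hausdorff_pre s \<delta> A + hausdorff_pre s \<delta> B \<le> (\<Sum>j. ennreal (hausdorff_gauge s (C j)))" .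
  qed
  \<comment> \<open>The pre-measures increase as \<open>\<delta>\<close> decreases, so both suprema
    can be taken along a common \<open>\<delta>\<close>.\<close>
  have "(SUP \<delta>\<in>{0<..}. hausdorff_pre s \<delta> A + hausdorff_pre s \<delta> B)
      = hausdorff_outer s A + hausdorff_outer s B"
    unfolding hausdorff_outer_def
  proof (rule SUP_add_directed_ennreal)
    fix i j :: real assume "i \<in> {0<..}" "j \<in> {0<..}"
    then show "\<exists>k\<in>{0<..}. hausdorff_pre s i A + hausdorff_pre s j B \<le> hausdorff_pre s k A + hausdorff_pre s k B"
      by (intro bexI[of _ "min i j"] add_mono hausdorff_pre_antimono) auto
  qed
  moreover have "(SUP \<delta>\<in>{0<..}. hausdorff_pre s \<delta> A + hausdorff_pre s \<delta> B) \<le> hausdorff_outer s (A \<union> B)"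
  proof (rule SUP_least)
    fix \<delta> :: real assume "\<delta> \<in> {0<..}"
    define \<epsilon> where "\<epsilon> = min \<delta> (d/2)"
    have \<epsilon>: "0 < \<epsilon>" "\<epsilon> \<le> \<delta>" "\<epsilon> < d"
      using \<open>0 < d\<close> \<open>\<delta> \<in> _\<close> by (auto simp: \<epsilon>_def)
    have "hausdorff_pre s \<delta> A + hausdorff_pre s \<delta> B \<le> hausdorff_pre s \<epsilon> A + hausdorff_pre s \<epsilon> B"
      by (intro add_mono hausdorff_pre_antimono \<epsilon>)
    also have "\<dots> \<le> hausdorff_pre s \<epsilon> (A \<union> B)" using * \<epsilon> by blast
    also have "\<dots> \<le> hausdorff_outer s (A \<union> B)" using \<epsilon> by (intro hausdorff_pre_le_outer)
    finally show "hausdorff_pre s \<delta> A + hausdorff_pre s \<delta> B \<le> hausdorff_outer s (A \<union> B)" .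
  qed
  ultimately show ?thesis by simp
qed

text \<open>The points of \<open>X - F\<close> split into layers by their distance to \<open>F\<close>; layers of equal parity
  are pairwise separated, so their outer measures are summable.\<close>

lemma hausdorff_outer_closed_split:
  fixes F :: "'a::metric_space set"
  assumes F: "closed F"
  shows "hausdorff_outer s (X \<inter> F) + hausdorff_outer s (X - F) \<le> hausdorff_outer s X"
proof (cases "F = {} \<or> hausdorff_outer s X = top")
  case True
  then show ?thesis by auto
next
  case False
  then have Fne: "F \<noteq> {}" and fin: "hausdorff_outer s X < top" by (auto simp: less_top)
  define a where "a k = 1 / real (Suc k)" for k
  have a_pos: "0 < a k" for k by (simp add: a_def)
  have a_less: "a (Suc k) < a k" for k by (simp add: a_def frac_less2)
  have a_anti: "a l \<le> a k" if "k \<le> l" for k l using that by (simp add: a_def frac_le)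
  define Y where "Y k = {x\<in>X. a k \<le> infdist x F}" for k
  define R where "R k = {x\<in>X. a (Suc k) \<le> infdist x F \<and> infdist x F < a k}" for k
  have split: "hausdorff_outer s (X \<inter> F) + hausdorff_outer s (Y k) \<le> hausdorff_outer s X" for k
  proof -
    have "hausdorff_outer s (X \<inter> F) + hausdorff_outer s (Y k) \<le> hausdorff_outer s (X \<inter> F \<union> Y k)"
    proof (rule hausdorff_outer_separated[OF a_pos[of k]])
      fix x y assume "x \<in> X \<inter> F" "y \<in> Y k"
      then show "a k \<le> dist x y"
        using infdist_le[of x F y] by (auto simp: Y_def dist_commute)
    qed
    also have "\<dots> \<le> hausdorff_outer s X" by (rule hausdorff_outer_mono) (auto simp: Y_def)
    finally show ?thesis .
  qed
  have parity: "(\<Sum>k<N. hausdorff_outer s (R (2 * k + c))) \<le> hausdorff_outer s (\<Union>k<N. R (2 * k + c))" for N c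
  proof (induction N)
    case (Suc N)
    have "(\<Sum>k<Suc N. hausdorff_outer s (R (2 * k + c)))
        \<le> hausdorff_outer s (\<Union>k<N. R (2 * k + c)) + hausdorff_outer s (R (2 * N + c))"
      using Suc by (simp add: add_mono)
    also have "\<dots> \<le> hausdorff_outer s ((\<Union>k<N. R (2 * k + c)) \<union> R (2 * N + c))"
    proof (cases N)
      case (Suc M)
      show ?thesis
      proof (rule hausdorff_outer_separated)
        \<comment> \<open>One full layer lies between the layers \<open>2 * M + c\<close> and
          \<open>2 * N + c\<close>; its width is the separation.\<close>
        show "0 < a (2 * M + c + 1) - a (2 * N + c)"
          using a_less[of "2 * M + c + 1"] Suc by simp
        fix x y assume "x \<in> (\<Union>k<N. R (2 * k + c))" "y \<in> R (2 * N + c)"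
        then obtain k where k: "k \<le> M" "a (Suc (2 * k + c)) \<le> infdist x F" and y: "infdist y F < a (2 * N + c)"
          by (auto simp: R_def Suc less_Suc_eq_le)
        have "a (2 * M + c + 1) \<le> infdist x F"
          using k a_anti[of "Suc (2 * k + c)" "2 * M + c + 1"] by simp
        with y show "a (2 * M + c + 1) - a (2 * N + c) \<le> dist x y"
          using infdist_triangle_abs[of x F y] by linarith
      qed
    qed simp
    also have "(\<Union>k<N. R (2 * k + c)) \<union> R (2 * N + c) = (\<Union>k<Suc N. R (2 * k + c))"
      by (auto simp: less_Suc_eq)
    finally show ?case .
  qed simp
  have parity': "(\<Sum>k<N. hausdorff_outer s (R (2 * k + c))) \<le> hausdorff_outer s X" for N c
    by (rule order_trans[OF parity], rule hausdorff_outer_mono) (auto simp: R_def)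
  have even_odd: "(\<Sum>k<2*N. f k) = (\<Sum>k<N. f (2 * k + 0)) + (\<Sum>k<N. f (2 * k + 1))" for f :: "nat \<Rightarrow> ennreal" and N
    by (induction N) (simp_all add: algebra_simps)
  \<comment> \<open>Even and odd layers contribute at most \<open>hausdorff_outer s X\<close> each,
    so the series converges and its tails become small.\<close>
  have "(\<Sum>k. hausdorff_outer s (R k)) \<le> hausdorff_outer s X + hausdorff_outer s X"
    unfolding suminf_eq_SUP
  proof (rule SUP_least)
    fix N
    have "(\<Sum>k<N. hausdorff_outer s (R k)) \<le> (\<Sum>k<2*N. hausdorff_outer s (R k))"
      by (rule sum_mono2) auto
    also have "\<dots> \<le> hausdorff_outer s X + hausdorff_outer s X"
      unfolding even_odd by (intro add_mono parity')
    finally show "(\<Sum>k<N. hausdorff_outer s (R k)) \<le> hausdorff_outer s X + hausdorff_outer s X" .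
  qed
  then have sfin: "(\<Sum>k. hausdorff_outer s (R k)) < top"
    using fin by (auto intro: le_less_trans simp: ennreal_add_eq_top less_top)
  define r where "r k = enn2real (hausdorff_outer s (R k))" for k
  have r: "hausdorff_outer s (R k) = ennreal (r k)" "0 \<le> r k" for k
    using ennreal_suminf_lessD[OF sfin, of k] by (auto simp: r_def less_top)
  have summ: "summable r"
    using sfin r by (intro summable_suminf_not_top) (auto simp: less_top)
  show ?thesis
  proof (rule ennreal_le_epsilon)
    fix e :: real assume "0 < e"
    obtain N where N: "norm (\<Sum>i. r (i + N)) < e"
      using suminf_exist_split[OF \<open>0 < e\<close> summ] by blast
    have sub: "X - F \<subseteq> Y N \<union> (\<Union>i. R (i + N))"
    proof
      fix x assume x: "x \<in> X - F"
      have "0 < infdist x F"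
        using x F Fne infdist_nonneg[of x F] in_closed_iff_infdist_zero[of F x] by fastforce
      then obtain m where m: "a m < infdist x F"
        using nat_approx_posE[of "infdist x F"] by (auto simp: a_def)
      show "x \<in> Y N \<union> (\<Union>i. R (i + N))"
      proof (cases "a N \<le> infdist x F")
        case False
        \<comment> \<open>The first level below the distance of \<open>x\<close>; minimality puts
          \<open>x\<close> into the layer just before it.\<close>
        define k where "k = (LEAST k. a k \<le> infdist x F)"
        have k: "a k \<le> infdist x F" unfolding k_def by (rule LeastI[of _ m]) (use m in simp)
        have "N < k" using False k a_anti[of k N] by (meson not_le order_trans)
        then have "\<not> a (k - 1) \<le> infdist x F" unfolding k_def using not_less_Least[of "k-1" "\<lambda>k. a k \<le> infdist x F"]
          by (simp add: k_def)
        with k \<open>N < k\<close> x have "x \<in> R (k - 1)" by (auto simp: R_def)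
        then show ?thesis using \<open>N < k\<close> by (auto intro!: exI[of _ "k - 1 - N"])
      qed (use x in \<open>auto simp: Y_def\<close>)
    qed
    have "hausdorff_outer s (X - F) \<le> hausdorff_outer s (Y N) + (\<Sum>i. hausdorff_outer s (R (i + N)))"
      by (intro order_trans[OF hausdorff_outer_mono[OF sub]] order_trans[OF hausdorff_outer_Un_le]
            add_left_mono hausdorff_outer_UN_le)
    also have "(\<Sum>i. hausdorff_outer s (R (i + N))) = ennreal (\<Sum>i. r (i + N))"
      unfolding r(1) using r(2) summ by (intro suminf_ennreal2) (auto simp: summable_iff_shift)
    also have "\<dots> \<le> ennreal e" using N by (intro ennreal_leI) auto
    finally have "hausdorff_outer s (X \<inter> F) + hausdorff_outer s (X - F)
        \<le> hausdorff_outer s (X \<inter> F) + (hausdorff_outer s (Y N) + ennreal e)"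
      by (simp add: add_left_mono)
    also have "\<dots> \<le> hausdorff_outer s X + ennreal e"
      using split[of N] by (simp add: add.assoc[symmetric] add_right_mono)
    finally show "hausdorff_outer s (X \<inter> F) + hausdorff_outer s (X - F) \<le> hausdorff_outer s X + ennreal e" .
  qed
qed

text \<open>Caratheodory's construction: the splitting inequality makes closed sets measurable for
  the outer measure, and they generate the Borel sets.\<close>

lemma measure_space_hausdorff: "measure_space UNIV (sets borel) (hausdorff_outer s)"
proof -
  let ?L = "lambda_system UNIV (Pow UNIV) (hausdorff_outer s :: 'a set \<Rightarrow> ennreal)"
  have L: "measure_space UNIV ?L (hausdorff_outer s)"
    using sigma_algebra.caratheodory_lemma[OF sigma_algebra_Pow outer_measure_space_hausdorff] .
  have "F \<in> ?L" if "closed F" for F :: "'a set"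
  proof -
    have "hausdorff_outer s (F \<inter> X) + hausdorff_outer s ((UNIV - F) \<inter> X) = hausdorff_outer s X" for X
    proof (rule antisym)
      show "hausdorff_outer s (F \<inter> X) + hausdorff_outer s ((UNIV - F) \<inter> X) \<le> hausdorff_outer s X"
        using hausdorff_outer_closed_split[OF that, of s X] by (simp add: Int_commute Diff_eq)
      show "hausdorff_outer s X \<le> hausdorff_outer s (F \<inter> X) + hausdorff_outer s ((UNIV - F) \<inter> X)"
        using hausdorff_outer_Un_le[of s "F \<inter> X" "(UNIV - F) \<inter> X"]
        by (simp add: Int_Un_distrib2[symmetric])
    qed
    then show ?thesis by (simp add: lambda_system_def)
  qed
  then have "sigma_sets UNIV (Collect closed) \<subseteq> ?L"
    using L by (intro sigma_algebra.sigma_sets_subset) (auto simp: measure_space_def)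
  then have "sets borel \<subseteq> ?L" by (simp add: borel_eq_closed)
  then show ?thesis
    using measure_down[OF L] sets.sigma_algebra_axioms[of borel] by simp
qed

lemma space_hausdorff_measure [simp]: "space (hausdorff_measure s) = UNIV"
  and sets_hausdorff_measure [simp, measurable_cong]: "sets (hausdorff_measure s) = sets borel"
  by (simp_all add: hausdorff_measure_def space_measure_of_conv sets.sigma_sets_eq[of borel, simplified])

text \<open>\<open>measure_of\<close> returns the given set function only if that is countably
  additive on the generated algebra, which is why \<open>measure_space_hausdorff\<close> comes
  first.\<close>

lemma emeasure_hausdorff_measure:
  "A \<in> sets borel \<Longrightarrow> emeasure (hausdorff_measure s) A = hausdorff_outer s A"
  unfolding hausdorff_measure_def using measure_space_hausdorff[of s]
  by (intro emeasure_measure_of_sigma) (auto simp: measure_space_def)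

text \<open>Images of a cover have diameters enlarged at most by \<open>L\<close>. As
  \<open>f\<close> is Lipschitz on \<open>A\<close> only, each covering set is first cut down to
  \<open>C j \<inter> A\<close>.\<close>

lemma hausdorff_outer_lipschitz_image:
  fixes f :: "'a::metric_space \<Rightarrow> 'b::metric_space"
  assumes L: "0 < L" and lip: "\<And>x y. x \<in> A \<Longrightarrow> y \<in> A \<Longrightarrow> dist (f x) (f y) \<le> L * dist x y"
  shows "hausdorff_outer s (f ` A) \<le> ennreal (L ^ s) * hausdorff_outer s A"
proof (rule hausdorff_outer_least)
  fix \<delta> :: real assume "0 < \<delta>"
  have "ennreal (1 / L ^ s) * hausdorff_pre s \<delta> (f ` A) \<le> hausdorff_pre s (\<delta> / L) A"
  proof (rule hausdorff_pre_greatest)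
    fix C assume C: "delta_cover (\<delta> / L) A C"
    have d: "dist (f x) (f y) \<le> L * diameter (C j)" if "x \<in> C j \<inter> A" "y \<in> C j \<inter> A" for x y j
    proof -
      have "dist (f x) (f y) \<le> L * dist x y" using that lip by auto
      also have "\<dots> \<le> L * diameter (C j)"
        using that C L by (intro mult_left_mono diameter_bounded_bound) (auto simp: delta_cover_def)
      finally show ?thesis .
    qed
    have dn: "0 \<le> L * diameter (C j)" for j
      using C L by (auto simp: delta_cover_def intro!: mult_nonneg_nonneg diameter_ge_0)
    have bd: "bounded (f ` (C j \<inter> A))" for j
      by (rule bounded_subset[OF _ subset_refl]) (use d in \<open>fastforce simp: bounded_two_points\<close>)
    have "L * diameter (C j) \<le> \<delta>" for j
      using C L by (simp add: delta_cover_def pos_le_divide_eq mult.commute)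
    then have "diameter (f ` (C j \<inter> A)) \<le> \<delta>" for j
      using order_trans[OF diameter_le_dist[OF dn, of "f ` (C j \<inter> A)"]] d by blast
    with C bd have "delta_cover \<delta> (f ` A) (\<lambda>j. f ` (C j \<inter> A))"
      unfolding delta_cover_def by blast
    then have "ennreal (1 / L ^ s) * hausdorff_pre s \<delta> (f ` A)
        \<le> ennreal (1 / L ^ s) * (\<Sum>j. ennreal (hausdorff_gauge s (f ` (C j \<inter> A))))"
      by (intro mult_left_mono hausdorff_pre_le) auto
    also have "\<dots> = (\<Sum>j. ennreal (1 / L ^ s) * ennreal (hausdorff_gauge s (f ` (C j \<inter> A))))"
      by simp
    also have "\<dots> \<le> (\<Sum>j. ennreal (hausdorff_gauge s (C j)))"
    proof (rule suminf_le)
      fix j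
      show "ennreal (1 / L ^ s) * ennreal (hausdorff_gauge s (f ` (C j \<inter> A))) \<le> ennreal (hausdorff_gauge s (C j))"
      proof (cases "C j \<inter> A = {}")
        case False
        have "hausdorff_gauge s (f ` (C j \<inter> A)) \<le> unit_ball_vol (real s) * (L * diameter (C j) / 2) ^ s"
          using d dn[of j] bd by (intro hausdorff_gauge_le) auto
        also have "\<dots> = L ^ s * hausdorff_gauge s (C j)"
          using False by (auto simp: hausdorff_gauge_def power_mult_distrib power_divide)
        finally have "(1 / L ^ s) * hausdorff_gauge s (f ` (C j \<inter> A)) \<le> hausdorff_gauge s (C j)"
          using L by (simp add: field_simps)
        then show ?thesis
          using L hausdorff_gauge_nonneg[OF bd] by (subst ennreal_mult[symmetric]) (auto intro: ennreal_leI)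
      qed simp
    qed auto
    finally show "ennreal (1 / L ^ s) * hausdorff_pre s \<delta> (f ` A) \<le> (\<Sum>j. ennreal (hausdorff_gauge s (C j)))" .
  qed
  also have "\<dots> \<le> hausdorff_outer s A"
    using L \<open>0 < \<delta>\<close> by (intro hausdorff_pre_le_outer) simp
  finally have "ennreal (L ^ s) * (ennreal (1 / L ^ s) * hausdorff_pre s \<delta> (f ` A)) \<le> ennreal (L ^ s) * hausdorff_outer s A"
    by (rule mult_left_mono) simp
  then show "hausdorff_pre s \<delta> (f ` A) \<le> ennreal (L ^ s) * hausdorff_outer s A"
    using L by (simp add: mult.assoc[symmetric] ennreal_mult[symmetric])
qed

section \<open>The isodiametric inequality in codimension one\<close>

definition midpoints :: "'a::real_vector set \<Rightarrow> 'a set \<Rightarrow> 'a set" where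
  "midpoints A B = (\<lambda>(x, y). (1/2) *\<^sub>R (x + y)) ` (A \<times> B)"

lemma midpointsI: "x \<in> A \<Longrightarrow> y \<in> B \<Longrightarrow> (1/2) *\<^sub>R (x + y) \<in> midpoints A B"
  by (auto simp: midpoints_def)

lemma midpointsE:
  assumes "z \<in> midpoints A B"
  obtains x y where "x \<in> A" "y \<in> B" "z = (1/2) *\<^sub>R (x + y)"
  using assms by (auto simp: midpoints_def)

lemma midpoints_mono: "A \<subseteq> A' \<Longrightarrow> B \<subseteq> B' \<Longrightarrow> midpoints A B \<subseteq> midpoints A' B'"
  by (force simp: midpoints_def)

lemma midpoints_commute: "midpoints A B = midpoints B A"
proof -
  have "midpoints A B \<subseteq> midpoints B A" for A B :: "'a set"
  proof
    fix z assume "z \<in> midpoints A B"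
    then obtain x y where "x \<in> A" "y \<in> B" "z = (1/2) *\<^sub>R (y + x)"
      by (auto simp: midpoints_def add.commute)
    then show "z \<in> midpoints B A" by (auto intro: midpointsI)
  qed
  then show ?thesis by blast
qed

lemma compact_midpoints:
  fixes A :: "'a::real_normed_vector set"
  shows "compact A \<Longrightarrow> compact B \<Longrightarrow> compact (midpoints A B)"
  unfolding midpoints_def case_prod_beta
  by (intro compact_continuous_image compact_Times continuous_intros)

lemma measure_Un_negligible:
  assumes "S \<in> lmeasurable" "T \<in> lmeasurable" "negligible (S \<inter> T)"
  shows "measure lebesgue (S \<union> T) = measure lebesgue S + measure lebesgue T"
  using measure_Un3[OF assms(1,2)] negligible_imp_measure0[OF assms(3)] by simp

definition box_family :: "'a::euclidean_space set set \<Rightarrow> bool" where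
  "box_family \<A> \<longleftrightarrow> finite \<A> \<and> (\<forall>K\<in>\<A>. interior K \<noteq> {} \<and> (\<exists>c d. K = cbox c d)) \<and>
     pairwise (\<lambda>A B. interior A \<inter> interior B = {}) \<A>"

lemma box_familyE:
  assumes "box_family \<A>" "K \<in> \<A>"
  obtains a b where "K = cbox a b" "box a b \<noteq> {}"
proof -
  obtain a b where "K = cbox a b" "interior K \<noteq> {}" using assms unfolding box_family_def by blast
  with that[of a b] show ?thesis by simp
qed

text \<open>Degenerate traces are thrown away. This keeps the members nondegenerate and lets the
  number of boxes drop, on which the induction descends.\<close>

definition cut_family :: "'a::euclidean_space set set \<Rightarrow> 'a set \<Rightarrow> 'a set set" where
  "cut_family \<A> H = {K \<inter> H | K. K \<in> \<A> \<and> interior (K \<inter> H) \<noteq> {}}"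

definition axis_halfspace :: "'a::euclidean_space set \<Rightarrow> bool" where
  "axis_halfspace H \<longleftrightarrow> (\<exists>i\<in>Basis. \<exists>c. H = {x. x \<bullet> i \<le> c} \<or> H = {x. c \<le> x \<bullet> i})"

lemma axis_halfspaceI:
  "i \<in> Basis \<Longrightarrow> axis_halfspace {x. x \<bullet> i \<le> c}"
  "i \<in> Basis \<Longrightarrow> axis_halfspace {x. c \<le> x \<bullet> i}"
  by (auto simp: axis_halfspace_def)

lemma box_Int_halfspace: "axis_halfspace H \<Longrightarrow> \<exists>c d. cbox a b \<inter> H = cbox c d"
  unfolding axis_halfspace_def using interval_split[of _ a b] by blast

lemma compact_box_family: "box_family \<A> \<Longrightarrow> compact (\<Union>\<A>)"
  unfolding box_family_def by (intro compact_Union) auto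

lemma cut_family_subset: "cut_family \<A> H \<subseteq> (\<lambda>K. K \<inter> H) ` \<A>"
  by (auto simp: cut_family_def)

lemma box_family_cut:
  assumes "box_family \<A>" "axis_halfspace H"
  shows "box_family (cut_family \<A> H)"
proof -
  have "finite (cut_family \<A> H)"
    using assms cut_family_subset[of \<A> H] by (auto simp: box_family_def intro: finite_subset)
  moreover have "interior K \<noteq> {} \<and> (\<exists>c d. K = cbox c d)" if "K \<in> cut_family \<A> H" for K
  proof -
    obtain L where L: "L \<in> \<A>" "K = L \<inter> H" "interior K \<noteq> {}" using \<open>K \<in> _\<close> by (auto simp: cut_family_def)
    then obtain a b where "L = cbox a b" using assms(1) by (blast elim: box_familyE)
    then show ?thesis using L box_Int_halfspace[OF assms(2)] by simp
  qed
  moreover have "interior K \<inter> interior K' = {}"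
    if KK: "K \<in> cut_family \<A> H" "K' \<in> cut_family \<A> H" "K \<noteq> K'" for K K'
  proof -
    obtain L L' where L: "L \<in> \<A>" "K = L \<inter> H" "L' \<in> \<A>" "K' = L' \<inter> H" using KK by (auto simp: cut_family_def)
    then have "interior L \<inter> interior L' = {}" using assms KK unfolding box_family_def pairwise_def by metis
    moreover have "interior K \<subseteq> interior L" "interior K' \<subseteq> interior L'" using L by (auto intro: interior_mono[THEN subsetD])
    ultimately show ?thesis by blast
  qed
  ultimately show ?thesis unfolding box_family_def pairwise_def by blast
qed

lemma card_cut_family_le: "finite \<A> \<Longrightarrow> card (cut_family \<A> H) \<le> card \<A>"
  by (rule surj_card_le[OF _ cut_family_subset])

lemma card_cut_family_less:
  assumes "finite \<A>" "L \<in> \<A>" "interior (L \<inter> H) = {}"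
  shows "card (cut_family \<A> H) < card \<A>"
proof -
  have "cut_family \<A> H \<subseteq> (\<lambda>K. K \<inter> H) ` (\<A> - {L})" using assms by (auto simp: cut_family_def)
  then have "card (cut_family \<A> H) \<le> card (\<A> - {L})"
    using assms by (intro surj_card_le) auto
  also have "\<dots> < card \<A>" using assms by (intro card_Diff1_less)
  finally show ?thesis .
qed

text \<open>The discarded traces are boxes with empty interior, hence negligible.\<close>

lemma measure_cut_family:
  assumes "box_family \<A>" "axis_halfspace H"
  shows "measure lebesgue (\<Union>(cut_family \<A> H)) = measure lebesgue (\<Union>\<A> \<inter> H)"
proof -
  let ?D = "\<Union>K\<in>{K\<in>\<A>. interior (K \<inter> H) = {}}. K \<inter> H"
  have "negligible ?D"
  proof (rule negligible_Union)
    show "finite ((\<lambda>K. K \<inter> H) ` {K\<in>\<A>. interior (K \<inter> H) = {}})" using assms by (auto simp: box_family_def)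
    fix T assume "T \<in> (\<lambda>K. K \<inter> H) ` {K\<in>\<A>. interior (K \<inter> H) = {}}"
    then obtain K where K: "K \<in> \<A>" "interior (K \<inter> H) = {}" "T = K \<inter> H" by auto
    then obtain a b where "K = cbox a b" using assms(1) by (blast elim: box_familyE)
    then obtain c d where T: "T = cbox c d" using box_Int_halfspace[OF assms(2), of a b] K by auto
    then have "box c d = {}" using K interior_cbox[of c d] by simp
    with T show "negligible T" by (simp add: negligible_interval(1))
  qed
  moreover have "sym_diff (\<Union>(cut_family \<A> H)) (\<Union>\<A> \<inter> H) \<subseteq> ?D"
  proof -
    have "x \<in> \<Union>(cut_family \<A> H) \<or> x \<in> ?D" if x: "x \<in> \<Union>\<A> \<inter> H" for x
    proof -
      obtain K where "K \<in> \<A>" "x \<in> K \<inter> H" using x by blast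
      then show ?thesis by (cases "interior (K \<inter> H) = {}") (auto simp: cut_family_def simp del: interior_Int)
    qed
    moreover have "\<Union>(cut_family \<A> H) \<subseteq> \<Union>\<A> \<inter> H" by (auto simp: cut_family_def)
    ultimately show ?thesis by blast
  qed
  ultimately have "negligible (sym_diff (\<Union>(cut_family \<A> H)) (\<Union>\<A> \<inter> H))"
    by (rule negligible_subset)
  then show ?thesis
    by (intro measure_negligible_symdiff[symmetric] lmeasurable_compact compact_box_family box_family_cut assms)
       (simp add: Un_commute)
qed

lemma closed_axis_halfspace: "axis_halfspace H \<Longrightarrow> closed H"
  by (auto simp: axis_halfspace_def closed_halfspace_component_le closed_halfspace_component_ge)

lemma measure_split_halfspaces:
  fixes S :: "'a::euclidean_space set"
  assumes "compact S" "i \<in> Basis"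
  shows "measure lebesgue S = measure lebesgue (S \<inter> {x. x \<bullet> i \<le> c}) + measure lebesgue (S \<inter> {x. c \<le> x \<bullet> i})"
proof -
  have "measure lebesgue ((S \<inter> {x. x \<bullet> i \<le> c}) \<union> (S \<inter> {x. c \<le> x \<bullet> i}))
      = measure lebesgue (S \<inter> {x. x \<bullet> i \<le> c}) + measure lebesgue (S \<inter> {x. c \<le> x \<bullet> i})"
  proof (rule measure_Un_negligible)
    show "negligible (S \<inter> {x. x \<bullet> i \<le> c} \<inter> (S \<inter> {x. c \<le> x \<bullet> i}))"
      by (rule negligible_subset[OF negligible_standard_hyperplane[OF assms(2), of c]]) auto
  qed (auto intro!: lmeasurable_compact compact_Int_closed assms
        closed_halfspace_component_le closed_halfspace_component_ge)
  also have "(S \<inter> {x. x \<bullet> i \<le> c}) \<union> (S \<inter> {x. c \<le> x \<bullet> i}) = S" by auto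
  finally show ?thesis .
qed

text \<open>The volume below height \<open>t\<close> is Lipschitz in \<open>t\<close>, since a slab
  of \<open>S\<close> has at most its thickness times a fixed cross-section; the intermediate value
  theorem does the rest.\<close>

lemma exists_cut_fraction:
  fixes S :: "'a::euclidean_space set"
  assumes S: "compact S" and i: "i \<in> Basis" and th: "0 \<le> \<theta>" "\<theta> \<le> 1"
  shows "\<exists>t. measure lebesgue (S \<inter> {x. x \<bullet> i \<le> t}) = \<theta> * measure lebesgue S"
proof -
  define \<phi> where "\<phi> t = measure lebesgue (S \<inter> {x. x \<bullet> i \<le> t})" for t
  obtain a where a: "S \<subseteq> cbox (-a) a" using compact_imp_bounded[OF S] bounded_subset_cbox_symmetric by blast
  \<comment> \<open>Cross-section of a box around \<open>S\<close>. The absolute values keep it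
    nonnegative if that box is empty.\<close>
  define P where "P = (\<Prod>j\<in>Basis - {i}. \<bar>2 * (a \<bullet> j)\<bar>)"
  have P: "0 \<le> P" unfolding P_def by (intro prod_nonneg) auto
  have meas: "S \<inter> {x. x \<bullet> i \<le> t} \<in> lmeasurable" for t
    by (intro lmeasurable_compact compact_Int_closed S closed_halfspace_component_le)
  have lip: "\<phi> s \<le> \<phi> t" "\<phi> t \<le> \<phi> s + P * (t - s)" if "s \<le> t" for s t
  proof -
    show "\<phi> s \<le> \<phi> t" unfolding \<phi>_def
      using that by (intro measure_mono_fmeasurable meas fmeasurableD) auto
    let ?l = "\<Sum>j\<in>Basis. (if j = i then s else - (a \<bullet> j)) *\<^sub>R j" and ?u = "\<Sum>j\<in>Basis. (if j = i then t else (a \<bullet> j)) *\<^sub>R j"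
    have "S \<inter> {x. x \<bullet> i \<le> t} \<subseteq> (S \<inter> {x. x \<bullet> i \<le> s}) \<union> cbox ?l ?u"
      using a by (auto simp: mem_box subset_eq)
    then have "\<phi> t \<le> measure lebesgue ((S \<inter> {x. x \<bullet> i \<le> s}) \<union> cbox ?l ?u)"
      unfolding \<phi>_def by (intro measure_mono_fmeasurable meas fmeasurableD fmeasurable.Un) auto
    also have "\<dots> \<le> \<phi> s + measure lebesgue (cbox ?l ?u)"
      unfolding \<phi>_def by (intro measure_Un_le meas fmeasurableD) auto
    also have "measure lebesgue (cbox ?l ?u) \<le> (\<Prod>j\<in>Basis. if j = i then t - s else \<bar>2 * (a \<bullet> j)\<bar>)"
    proof -
      have "(\<Prod>j\<in>Basis. ?u \<bullet> j - ?l \<bullet> j) \<le> (\<Prod>j\<in>Basis. if j = i then t - s else \<bar>2 * (a \<bullet> j)\<bar>)"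
        if "\<forall>j\<in>Basis. ?l \<bullet> j \<le> ?u \<bullet> j"
        using that by (intro prod_mono) auto
      then show ?thesis
        using that by (auto simp: content_cbox_cases intro!: prod_nonneg)
    qed
    also have "\<dots> = P * (t - s)"
      using i by (subst prod.remove[of _ i]) (auto simp: P_def intro!: prod.cong)
    finally show "\<phi> t \<le> \<phi> s + P * (t - s)" by simp
  qed
  have "P-lipschitz_on UNIV \<phi>"
  proof (rule lipschitz_onI)
    fix x y :: real
    show "dist (\<phi> x) (\<phi> y) \<le> P * dist x y"
      using lip[of x y] lip[of y x] by (cases "x \<le> y") (auto simp: dist_real_def abs_if algebra_simps)
  qed (rule P)
  then have cont: "continuous_on UNIV \<phi>" by (rule lipschitz_on_continuous_on)
  have low: "\<phi> (- (a \<bullet> i) - 1) = 0"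
  proof -
    have "S \<inter> {x. x \<bullet> i \<le> - (a \<bullet> i) - 1} = {}" using a i by (force simp: mem_box)
    then show ?thesis by (simp add: \<phi>_def)
  qed
  \<comment> \<open>The \<open>max\<close> keeps the end points in order even for an empty
    box.\<close>
  have high: "\<phi> (max (a \<bullet> i) (- (a \<bullet> i))) = measure lebesgue S"
  proof -
    have "S \<inter> {x. x \<bullet> i \<le> max (a \<bullet> i) (- (a \<bullet> i))} = S" using a i by (force simp: mem_box)
    then show ?thesis by (simp add: \<phi>_def)
  qed
  have "\<exists>t. - (a \<bullet> i) - 1 \<le> t \<and> t \<le> max (a \<bullet> i) (- (a \<bullet> i)) \<and> \<phi> t = \<theta> * measure lebesgue S"
    using th by (intro IVT') (auto simp: low high intro!: mult_left_le_one_le continuous_on_subset[OF cont])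
  then show ?thesis by (auto simp: \<phi>_def)
qed

text \<open>The midpoint set contains the box whose sides are the means of the given sides; side by
  side this is the inequality between geometric and arithmetic mean.\<close>

lemma midpoints_cbox_ge:
  fixes a b c d :: "'a::euclidean_space"
  assumes ab: "box a b \<noteq> {}" and cd: "box c d \<noteq> {}"
  shows "sqrt (measure lebesgue (cbox a b) * measure lebesgue (cbox c d))
    \<le> measure lebesgue (midpoints (cbox a b) (cbox c d))"
proof -
  have sqrt_prod: "sqrt (prod f X) = (\<Prod>i\<in>X. sqrt (f i))" for f :: "'a \<Rightarrow> real" and X
    by (induction X rule: infinite_finite_induct) (auto simp: real_sqrt_mult)
  have ab': "a \<bullet> i < b \<bullet> i" and cd': "c \<bullet> i < d \<bullet> i" if "i \<in> Basis" for i
    using ab cd that by (auto simp: box_ne_empty)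
  let ?l = "(1/2) *\<^sub>R (a + c)" and ?u = "(1/2) *\<^sub>R (b + d)"
  have "cbox ?l ?u \<subseteq> midpoints (cbox a b) (cbox c d)"
  proof
    fix z assume z: "z \<in> cbox ?l ?u"
    \<comment> \<open>Relative position of \<open>z\<close> along side \<open>i\<close>;
      \<open>x\<close> and \<open>y\<close> take the same relative position in their own
      boxes.\<close>
    define L where "L i = (z \<bullet> i - ?l \<bullet> i) / (?u \<bullet> i - ?l \<bullet> i)" for i
    have pos: "0 < ?u \<bullet> i - ?l \<bullet> i" if "i \<in> Basis" for i
      using ab'[OF that] cd'[OF that] by (simp add: inner_add_left)
    have L: "0 \<le> L i" "L i \<le> 1" "z \<bullet> i = ?l \<bullet> i + L i * (?u \<bullet> i - ?l \<bullet> i)" if "i \<in> Basis" for i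
      using z pos[OF that] that by (auto simp: L_def mem_box divide_le_eq)
    define x where "x = (\<Sum>i\<in>Basis. (a \<bullet> i + L i * (b \<bullet> i - a \<bullet> i)) *\<^sub>R i)"
    define y where "y = (\<Sum>i\<in>Basis. (c \<bullet> i + L i * (d \<bullet> i - c \<bullet> i)) *\<^sub>R i)"
    have conv: "p \<le> p + l * (q - p)" "p + l * (q - p) \<le> q" if "p < q" "0 \<le> l" "l \<le> 1" for p q l :: real
      using that mult_right_mono[of l 1 "q - p"] mult_left_mono[of p q l] by (auto simp: algebra_simps)
    have xi: "x \<bullet> i = a \<bullet> i + L i * (b \<bullet> i - a \<bullet> i)" and yi: "y \<bullet> i = c \<bullet> i + L i * (d \<bullet> i - c \<bullet> i)"
      if "i \<in> Basis" for i
      using that by (simp_all add: x_def y_def)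
    have "x \<in> cbox a b" "y \<in> cbox c d"
    proof -
      have "a \<bullet> i \<le> x \<bullet> i \<and> x \<bullet> i \<le> b \<bullet> i \<and> c \<bullet> i \<le> y \<bullet> i \<and> y \<bullet> i \<le> d \<bullet> i" if "i \<in> Basis" for i
        unfolding xi[OF that] yi[OF that] by (intro conjI conv ab' cd' L that)
      then show "x \<in> cbox a b" "y \<in> cbox c d" unfolding mem_box by blast+
    qed
    moreover have "z = (1/2) *\<^sub>R (x + y)"
    proof (rule euclidean_eqI)
      fix i :: 'a assume i: "i \<in> Basis"
      show "z \<bullet> i = (1/2) *\<^sub>R (x + y) \<bullet> i"
        unfolding L(3)[OF i] inner_scaleR_left inner_add_left xi[OF i] yi[OF i] by (simp add: field_simps)
    qed
    ultimately show "z \<in> midpoints (cbox a b) (cbox c d)" by (auto intro: midpointsI)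
  qed
  then have *: "measure lebesgue (cbox ?l ?u) \<le> measure lebesgue (midpoints (cbox a b) (cbox c d))"
    by (intro measure_mono_fmeasurable lmeasurable_compact compact_midpoints) auto
  have "sqrt (measure lebesgue (cbox a b) * measure lebesgue (cbox c d))
      = (\<Prod>i\<in>Basis. sqrt ((b \<bullet> i - a \<bullet> i) * (d \<bullet> i - c \<bullet> i)))"
    using ab' cd' by (auto simp: content_cbox_cases less_imp_le prod.distrib[symmetric] sqrt_prod)
  also have "\<dots> \<le> (\<Prod>i\<in>Basis. ?u \<bullet> i - ?l \<bullet> i)"
  proof (rule prod_mono)
    fix i :: 'a assume i: "i \<in> Basis"
    have "sqrt ((b \<bullet> i - a \<bullet> i) * (d \<bullet> i - c \<bullet> i)) \<le> ((b \<bullet> i - a \<bullet> i) + (d \<bullet> i - c \<bullet> i)) / 2"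
      using ab'[OF i] cd'[OF i] by (intro arith_geo_mean_sqrt) auto
    also have "\<dots> = ?u \<bullet> i - ?l \<bullet> i" by (simp add: inner_add_left field_simps)
    finally show "0 \<le> sqrt ((b \<bullet> i - a \<bullet> i) * (d \<bullet> i - c \<bullet> i)) \<and>
        sqrt ((b \<bullet> i - a \<bullet> i) * (d \<bullet> i - c \<bullet> i)) \<le> ?u \<bullet> i - ?l \<bullet> i"
      using ab'[OF i] cd'[OF i] by simp
  qed
  also have "\<dots> = measure lebesgue (cbox ?l ?u)"
    using ab' cd' by (simp add: content_cbox_cases inner_add_left add_mono less_imp_le)
  finally show ?thesis using * by linarith
qed

text \<open>Hadwiger--Ohmann: cut both families by parallel hyperplanes in the same volume ratio; the midpoint sets of
  corresponding parts then lie on different sides of a hyperplane.\<close>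

lemma midpoints_box_family_cut:
  fixes \<A> \<B> :: "'a::euclidean_space set set"
  assumes A: "box_family \<A>" "2 \<le> card \<A>" and B: "box_family \<B>" "\<B> \<noteq> {}"
    and IH: "\<And>\<A>' \<B>' :: 'a set set. box_family \<A>' \<Longrightarrow> \<A>' \<noteq> {} \<Longrightarrow> box_family \<B>' \<Longrightarrow> \<B>' \<noteq> {} \<Longrightarrow>
       card \<A>' < card \<A> \<Longrightarrow> card \<B>' \<le> card \<B> \<Longrightarrow>
       sqrt (measure lebesgue (\<Union>\<A>') * measure lebesgue (\<Union>\<B>')) \<le> measure lebesgue (midpoints (\<Union>\<A>') (\<Union>\<B>'))"
  shows "sqrt (measure lebesgue (\<Union>\<A>) * measure lebesgue (\<Union>\<B>)) \<le> measure lebesgue (midpoints (\<Union>\<A>) (\<Union>\<B>))"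
proof -
  let ?m = "measure lebesgue"
  have pos: "0 < ?m K" if C: "box_family \<C>" "K \<in> \<C>" for K and \<C> :: "'a set set"
  proof -
    obtain a b where K: "K = cbox a b" "box a b \<noteq> {}" using box_familyE[OF C] by metis
    then show ?thesis by (simp add: content_pos_lt_eq box_ne_empty)
  qed
  obtain K1 K2 where K: "K1 \<in> \<A>" "K2 \<in> \<A>" "K1 \<noteq> K2"
  proof -
    have "finite \<A>" using A(1) by (simp add: box_family_def)
    moreover have "\<not> card \<A> \<le> Suc 0" using A(2) by simp
    ultimately show ?thesis using that card_le_Suc0_iff_eq[of \<A>] by blast
  qed
  then obtain a b c d where box: "K1 = cbox a b" "K2 = cbox c d" "box a b \<noteq> {}" "box c d \<noteq> {}"
    using box_familyE[OF A(1) K(1)] box_familyE[OF A(1) K(2)] by metis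
  have "interior K1 \<inter> interior K2 = {}" using A(1) K unfolding box_family_def pairwise_def by blast
  then have "box a b \<inter> box c d = {}" unfolding box interior_cbox .
  \<comment> \<open>Boxes with disjoint interiors are separated by a coordinate hyperplane.\<close>
  then obtain i where i: "i \<in> Basis" "b \<bullet> i \<le> c \<bullet> i \<or> d \<bullet> i \<le> a \<bullet> i"
    using box unfolding disjoint_interval box_ne_empty by (meson not_le)
  obtain L1 L2 e where L: "L1 \<in> \<A>" "L2 \<in> \<A>" "L1 \<subseteq> {x. x \<bullet> i \<le> e}" "L2 \<subseteq> {x. e \<le> x \<bullet> i}"
  proof (cases "b \<bullet> i \<le> c \<bullet> i")
    case True
    then show ?thesis using i box K by (intro that[of K1 K2 "b \<bullet> i"]) (force simp: mem_box)+
  next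
    case False
    then show ?thesis using i box K by (intro that[of K2 K1 "d \<bullet> i"]) (force simp: mem_box)+
  qed
  define H1 where "H1 = {x. x \<bullet> i \<le> e}"
  define H2 where "H2 = {x. e \<le> x \<bullet> i}"
  have H: "axis_halfspace H1" "axis_halfspace H2" unfolding H1_def H2_def by (intro axis_halfspaceI i)+
  have hyp: "interior (H1 \<inter> H2) = {}"
  proof -
    have "H1 \<inter> H2 = {x. i \<bullet> x = e}" by (auto simp: H1_def H2_def inner_commute)
    moreover have "interior {x. i \<bullet> x = e} = {}" using i by (intro interior_hyperplane) auto
    ultimately show ?thesis by (simp only:)
  qed
  \<comment> \<open>Each half-space loses \<open>L2\<close> or \<open>L1\<close>, so both parts of
    \<open>\<A>\<close> have fewer boxes, while the parts of \<open>\<B>\<close> have at most as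
    many as before.\<close>
  have less: "card (cut_family \<A> H1) < card \<A>" "card (cut_family \<A> H2) < card \<A>"
  proof -
    have "interior (L2 \<inter> H1) \<subseteq> interior (H1 \<inter> H2)" "interior (L1 \<inter> H2) \<subseteq> interior (H1 \<inter> H2)"
      using L by (intro interior_mono; auto simp: H1_def H2_def)+
    then have "interior (L2 \<inter> H1) = {}" "interior (L1 \<inter> H2) = {}" unfolding hyp by blast+
    with L A(1) show "card (cut_family \<A> H1) < card \<A>" "card (cut_family \<A> H2) < card \<A>"
      using card_cut_family_less[of \<A> L2 H1] card_cut_family_less[of \<A> L1 H2] unfolding box_family_def by blast+
  qed
  define \<alpha> where "\<alpha> = ?m (\<Union>\<A>)"
  define \<beta> where "\<beta> = ?m (\<Union>\<B>)"
  have cA: "compact (\<Union>\<A>)" and cB: "compact (\<Union>\<B>)" using A B by (auto intro: compact_box_family)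
  have ge: "?m L \<le> ?m S" if "compact S" "L \<subseteq> S" "compact L" for L S :: "'a set"
    using that by (intro measure_mono_fmeasurable lmeasurable_compact) (auto intro: fmeasurableD lmeasurable_compact)
  have cL: "compact L1" "compact L2" using L A(1) by (auto simp: box_family_def)
  have \<alpha>1: "0 < ?m (\<Union>\<A> \<inter> H1)" and \<alpha>2: "0 < ?m (\<Union>\<A> \<inter> H2)"
    using pos[OF A(1) L(1)] pos[OF A(1) L(2)]
      ge[of "\<Union>\<A> \<inter> H1" L1] ge[of "\<Union>\<A> \<inter> H2" L2] L cL Union_upper[OF L(1)] Union_upper[OF L(2)]
      compact_Int_closed[OF cA closed_axis_halfspace[OF H(1)]] compact_Int_closed[OF cA closed_axis_halfspace[OF H(2)]]
    by (auto simp: H1_def H2_def)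
  have \<alpha>: "\<alpha> = ?m (\<Union>\<A> \<inter> H1) + ?m (\<Union>\<A> \<inter> H2)"
    unfolding \<alpha>_def H1_def H2_def by (rule measure_split_halfspaces[OF cA i(1)])
  have \<alpha>pos: "0 < \<alpha>" using \<alpha> \<alpha>1 \<alpha>2 by linarith
  \<comment> \<open>Strictly between 0 and 1, so none of the four parts is empty. The bounds for the
    two parts carry the factors \<open>\<theta>\<close> and \<open>1 - \<theta>\<close>, which add
    up to 1.\<close>
  define \<theta> where "\<theta> = ?m (\<Union>\<A> \<inter> H1) / \<alpha>"
  have \<theta>: "0 < \<theta>" "\<theta> < 1" using \<alpha> \<alpha>1 \<alpha>2 by (auto simp: \<theta>_def)
  have \<beta>pos: "0 < \<beta>"
  proof -
    obtain K where K: "K \<in> \<B>" using B by blast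
    then have "?m K \<le> \<beta>" unfolding \<beta>_def using B(1) by (intro ge cB) (auto simp: box_family_def)
    with pos[OF B(1) K] show ?thesis by linarith
  qed
  obtain t where t: "?m (\<Union>\<B> \<inter> {x. x \<bullet> i \<le> t}) = \<theta> * \<beta>"
    using exists_cut_fraction[OF cB i(1), of \<theta>] \<theta> by (auto simp: \<beta>_def)
  define J1 where "J1 = {x. x \<bullet> i \<le> t}"
  define J2 where "J2 = {x. t \<le> x \<bullet> i}"
  have J: "axis_halfspace J1" "axis_halfspace J2" unfolding J1_def J2_def by (intro axis_halfspaceI i)+
  have b1: "?m (\<Union>\<B> \<inter> J1) = \<theta> * \<beta>" using t by (simp add: J1_def)
  have b2: "?m (\<Union>\<B> \<inter> J2) = (1 - \<theta>) * \<beta>"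
    using measure_split_halfspaces[OF cB i(1), of t] b1 by (simp add: \<beta>_def J1_def J2_def algebra_simps)
  have a1: "?m (\<Union>\<A> \<inter> H1) = \<theta> * \<alpha>" using \<alpha>pos by (simp add: \<theta>_def)
  have a2: "?m (\<Union>\<A> \<inter> H2) = (1 - \<theta>) * \<alpha>" using \<alpha> a1 by (simp add: algebra_simps)
  let ?A1 = "cut_family \<A> H1" and ?A2 = "cut_family \<A> H2" and ?B1 = "cut_family \<B> J1" and ?B2 = "cut_family \<B> J2"
  note bf = box_family_cut[OF A(1) H(1)] box_family_cut[OF A(1) H(2)] box_family_cut[OF B(1) J(1)] box_family_cut[OF B(1) J(2)]
  have mc: "?m (\<Union>?A1) = \<theta> * \<alpha>" "?m (\<Union>?A2) = (1 - \<theta>) * \<alpha>" "?m (\<Union>?B1) = \<theta> * \<beta>" "?m (\<Union>?B2) = (1 - \<theta>) * \<beta>"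
    by (simp_all add: measure_cut_family A B H J a1 a2 b1 b2)
  have ne: "?A1 \<noteq> {}" "?A2 \<noteq> {}" "?B1 \<noteq> {}" "?B2 \<noteq> {}"
    using mc \<theta> \<alpha>pos \<beta>pos by auto
  have finB: "finite \<B>" using B by (simp add: box_family_def)
  have I1: "sqrt ((\<theta> * \<alpha>) * (\<theta> * \<beta>)) \<le> ?m (midpoints (\<Union>?A1) (\<Union>?B1))"
    using IH[OF bf(1) ne(1) bf(3) ne(3) less(1) card_cut_family_le[OF finB]] by (simp add: mc)
  have I2: "sqrt (((1 - \<theta>) * \<alpha>) * ((1 - \<theta>) * \<beta>)) \<le> ?m (midpoints (\<Union>?A2) (\<Union>?B2))"
    using IH[OF bf(2) ne(2) bf(4) ne(4) less(2) card_cut_family_le[OF finB]] by (simp add: mc)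
  have q1: "sqrt ((\<theta> * \<alpha>) * (\<theta> * \<beta>)) = \<theta> * sqrt (\<alpha> * \<beta>)"
    using \<theta> by (simp add: real_sqrt_mult algebra_simps flip: power2_eq_square)
  have q2: "sqrt (((1 - \<theta>) * \<alpha>) * ((1 - \<theta>) * \<beta>)) = (1 - \<theta>) * sqrt (\<alpha> * \<beta>)"
  proof -
    have "((1 - \<theta>) * \<alpha>) * ((1 - \<theta>) * \<beta>) = (1 - \<theta>)\<^sup>2 * (\<alpha> * \<beta>)" by (simp add: power2_eq_square)
    then show ?thesis using \<theta> by (simp add: real_sqrt_mult)
  qed
  have cM: "compact (midpoints (\<Union>?A1) (\<Union>?B1))" "compact (midpoints (\<Union>?A2) (\<Union>?B2))" "compact (midpoints (\<Union>\<A>) (\<Union>\<B>))"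
    by (intro compact_midpoints compact_box_family bf A B)+
  have "sqrt (\<alpha> * \<beta>) \<le> ?m (midpoints (\<Union>?A1) (\<Union>?B1)) + ?m (midpoints (\<Union>?A2) (\<Union>?B2))"
    using I1 I2 unfolding q1 q2 by (simp add: algebra_simps)
  also have "\<dots> = ?m (midpoints (\<Union>?A1) (\<Union>?B1) \<union> midpoints (\<Union>?A2) (\<Union>?B2))"
  proof (rule measure_Un_negligible[symmetric])
    show "negligible (midpoints (\<Union>?A1) (\<Union>?B1) \<inter> midpoints (\<Union>?A2) (\<Union>?B2))"
    proof (rule negligible_subset[OF negligible_standard_hyperplane[OF i(1), of "(e + t) / 2"]])
      have "x \<bullet> i \<le> (e + t) / 2" if "x \<in> midpoints (\<Union>?A1) (\<Union>?B1)" for x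
        using that by (auto simp: midpoints_def cut_family_def H1_def J1_def inner_add_left)
      moreover have "(e + t) / 2 \<le> x \<bullet> i" if "x \<in> midpoints (\<Union>?A2) (\<Union>?B2)" for x
        using that by (auto simp: midpoints_def cut_family_def H2_def J2_def inner_add_left)
      ultimately show "midpoints (\<Union>?A1) (\<Union>?B1) \<inter> midpoints (\<Union>?A2) (\<Union>?B2) \<subseteq> {x. x \<bullet> i = (e + t) / 2}"
        by fastforce
    qed
  qed (intro lmeasurable_compact cM)+
  also have "\<dots> \<le> ?m (midpoints (\<Union>\<A>) (\<Union>\<B>))"
  proof (rule ge)
    have "\<Union>?A1 \<subseteq> \<Union>\<A>" "\<Union>?A2 \<subseteq> \<Union>\<A>" "\<Union>?B1 \<subseteq> \<Union>\<B>" "\<Union>?B2 \<subseteq> \<Union>\<B>" by (auto simp: cut_family_def)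
    then show "midpoints (\<Union>?A1) (\<Union>?B1) \<union> midpoints (\<Union>?A2) (\<Union>?B2) \<subseteq> midpoints (\<Union>\<A>) (\<Union>\<B>)"
      by (simp add: midpoints_mono)
  qed (intro cM compact_Un)+
  finally show ?thesis by (simp add: \<alpha>_def \<beta>_def)
qed

text \<open>The multiplicative form is free of the dimension and stable under proportional cuts.
  Whichever family has two boxes is cut; the induction ends with two single boxes.\<close>

lemma brunn_minkowski_box_family:
  fixes \<A> \<B> :: "'a::euclidean_space set set"
  assumes "box_family \<A>" "\<A> \<noteq> {}" "box_family \<B>" "\<B> \<noteq> {}"
  shows "sqrt (measure lebesgue (\<Union>\<A>) * measure lebesgue (\<Union>\<B>)) \<le> measure lebesgue (midpoints (\<Union>\<A>) (\<Union>\<B>))"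
  using assms
proof (induction "card \<A> + card \<B>" arbitrary: \<A> \<B> rule: less_induct)
  case less
  consider "2 \<le> card \<A>" | "2 \<le> card \<B>" | "card \<A> \<le> 1" "card \<B> \<le> 1" by linarith
  then show ?case
  proof cases
    case 1
    show ?thesis
      by (rule midpoints_box_family_cut[OF less.prems(1) 1 less.prems(3,4)]) (rule less.hyps; simp)
  next
    case 2
    have "sqrt (measure lebesgue (\<Union>\<B>) * measure lebesgue (\<Union>\<A>)) \<le> measure lebesgue (midpoints (\<Union>\<B>) (\<Union>\<A>))"
      by (rule midpoints_box_family_cut[OF less.prems(3) 2 less.prems(1,2)]) (rule less.hyps; simp)
    then show ?thesis by (simp add: mult.commute midpoints_commute)
  next
    case 3
    have fin: "finite \<A>" "finite \<B>" using less.prems by (auto simp: box_family_def)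
    then have "card \<A> = 1" "card \<B> = 1" using 3 less.prems by (auto simp: le_Suc_eq)
    then obtain A B where AB: "\<A> = {A}" "\<B> = {B}" by (auto simp: card_1_singleton_iff)
    then obtain a b c d where "A = cbox a b" "B = cbox c d" "box a b \<noteq> {}" "box c d \<noteq> {}"
      using box_familyE[OF less.prems(1), of A] box_familyE[OF less.prems(3), of B] by (metis singletonI)
    then show ?thesis using AB midpoints_cbox_ge[of a b c d] by simp
  qed
qed

section \<open>Slicing in a direction and volumes of cylinders\<close>

lemma negligible_borel_null_sets:
  "negligible A \<Longrightarrow> A \<in> sets borel \<Longrightarrow> A \<in> null_sets lborel"
  by (simp add: null_sets_def negligible_iff_emeasure0)

lemma nn_integral_lborel_shift:
  fixes f :: "'a::euclidean_space \<Rightarrow> ennreal"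
  assumes [measurable]: "f \<in> borel_measurable borel"
  shows "(\<integral>\<^sup>+x. f (a + x) \<partial>lborel) = (\<integral>\<^sup>+x. f x \<partial>lborel)"
proof -
  have "(\<integral>\<^sup>+x. f x \<partial>lborel) = (\<integral>\<^sup>+x. f x \<partial>distr lborel borel ((+) a))"
    by (simp add: lborel_distr_plus)
  also have "\<dots> = (\<integral>\<^sup>+x. f (a + x) \<partial>lborel)"
    by (subst nn_integral_distr) auto
  finally show ?thesis by simp
qed

lemma nn_integral_lborel_reflect:
  fixes f :: "real \<Rightarrow> ennreal"
  assumes [measurable]: "f \<in> borel_measurable borel"
  shows "(\<integral>\<^sup>+x. f (a - x) \<partial>lborel) = (\<integral>\<^sup>+x. f x \<partial>lborel)"
  using nn_integral_real_affine[of f "-1" a] by simp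

lemma emeasure_lborel_scale:
  fixes A :: "'a::euclidean_space set"
  assumes "c \<noteq> 0" and [measurable]: "A \<in> sets borel"
  shows "emeasure lborel A = ennreal (\<bar>c\<bar> ^ DIM('a)) * emeasure lborel {x. c *\<^sub>R x \<in> A}"
proof -
  have "emeasure lborel A = emeasure (density (distr lborel borel (\<lambda>x. 0 + c *\<^sub>R x)) (\<lambda>x. ennreal (\<bar>c\<bar> ^ DIM('a)))) A"
    using lborel_affine[of c "0::'a"] assms by simp
  also have "\<dots> = ennreal (\<bar>c\<bar> ^ DIM('a)) * emeasure (distr lborel borel (\<lambda>x. 0 + c *\<^sub>R x)) A"
    using assms by (subst emeasure_density_const) auto
  also have "emeasure (distr lborel borel (\<lambda>x::'a. 0 + c *\<^sub>R x)) A = emeasure lborel {x. c *\<^sub>R x \<in> A}"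
    by (subst emeasure_distr) (auto simp: vimage_def)
  finally show ?thesis .
qed

text \<open>Tonelli's theorem in the direction \<open>u\<close>: a weight \<open>\<psi>\<close> on the \<open>u\<close>-coordinate replaces
  integration over the hyperplane orthogonal to \<open>u\<close>, which has no Lebesgue measure of its own here.\<close>

lemma nn_integral_slices:
  fixes H :: "'a::euclidean_space \<Rightarrow> ennreal" and \<psi> :: "real \<Rightarrow> ennreal"
  assumes u: "u \<bullet> u = 1"
    and [measurable]: "H \<in> borel_measurable borel" "\<psi> \<in> borel_measurable borel"
  shows "(\<integral>\<^sup>+x. H x \<partial>lborel) * (\<integral>\<^sup>+t. \<psi> t \<partial>lborel)
    = (\<integral>\<^sup>+x. (\<integral>\<^sup>+t. H (x - (u \<bullet> x) *\<^sub>R u + t *\<^sub>R u) \<partial>lborel) * \<psi> (u \<bullet> x) \<partial>lborel)"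
proof -
  have [measurable]: "(\<lambda>x::'a. u \<bullet> x) \<in> borel_measurable borel" by simp
  have "(\<integral>\<^sup>+x. (\<integral>\<^sup>+t. H (x - (u \<bullet> x) *\<^sub>R u + t *\<^sub>R u) \<partial>lborel) * \<psi> (u \<bullet> x) \<partial>lborel)
      = (\<integral>\<^sup>+x. (\<integral>\<^sup>+t. H (t *\<^sub>R u + x) * \<psi> (u \<bullet> x) \<partial>lborel) \<partial>lborel)"
  proof (rule nn_integral_cong)
    \<comment> \<open>Shifting \<open>t\<close> by \<open>u \<bullet> x\<close> undoes the
      projection. After the interchange of integrals \<open>x\<close> is shifted by a multiple of
      \<open>u\<close>, so that only the weight still depends on \<open>t\<close>.\<close>
    fix x :: 'a
    have "(\<integral>\<^sup>+t. H (x - (u \<bullet> x) *\<^sub>R u + t *\<^sub>R u) \<partial>lborel)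
        = (\<integral>\<^sup>+t. H (x - (u \<bullet> x) *\<^sub>R u + ((u \<bullet> x) + t) *\<^sub>R u) \<partial>lborel)"
      by (rule nn_integral_lborel_shift[symmetric]) measurable
    also have "\<dots> = (\<integral>\<^sup>+t. H (t *\<^sub>R u + x) \<partial>lborel)"
      by (intro nn_integral_cong) (simp add: algebra_simps)
    finally show "(\<integral>\<^sup>+t. H (x - (u \<bullet> x) *\<^sub>R u + t *\<^sub>R u) \<partial>lborel) * \<psi> (u \<bullet> x)
        = (\<integral>\<^sup>+t. H (t *\<^sub>R u + x) * \<psi> (u \<bullet> x) \<partial>lborel)"
      by (simp add: nn_integral_multc)
  qed
  also have "\<dots> = (\<integral>\<^sup>+t. (\<integral>\<^sup>+x. H (t *\<^sub>R u + x) * \<psi> (u \<bullet> x) \<partial>lborel) \<partial>lborel)"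
    by (rule lborel_pair.Fubini') measurable
  also have "\<dots> = (\<integral>\<^sup>+t. (\<integral>\<^sup>+x. H x * \<psi> (u \<bullet> x - t * (u \<bullet> u)) \<partial>lborel) \<partial>lborel)"
  proof (rule nn_integral_cong)
    fix t :: real
    show "(\<integral>\<^sup>+x. H (t *\<^sub>R u + x) * \<psi> (u \<bullet> x) \<partial>lborel) = (\<integral>\<^sup>+x. H x * \<psi> (u \<bullet> x - t * (u \<bullet> u)) \<partial>lborel)"
      using nn_integral_lborel_shift[of "\<lambda>x. H x * \<psi> (u \<bullet> x - t * (u \<bullet> u))" "t *\<^sub>R u"]
      by (simp add: inner_add_right)
  qed
  also have "\<dots> = (\<integral>\<^sup>+x. (\<integral>\<^sup>+t. H x * \<psi> (u \<bullet> x - t * (u \<bullet> u)) \<partial>lborel) \<partial>lborel)"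
    by (rule lborel_pair.Fubini') measurable
  also have "\<dots> = (\<integral>\<^sup>+x. H x * (\<integral>\<^sup>+t. \<psi> t \<partial>lborel) \<partial>lborel)"
    by (intro nn_integral_cong) (simp add: u nn_integral_cmult nn_integral_lborel_reflect)
  also have "\<dots> = (\<integral>\<^sup>+x. H x \<partial>lborel) * (\<integral>\<^sup>+t. \<psi> t \<partial>lborel)"
    by (simp add: nn_integral_multc)
  finally show ?thesis by simp
qed

definition cylinder :: "'a::euclidean_space \<Rightarrow> real \<Rightarrow> real \<Rightarrow> 'a set" where
  "cylinder u \<rho> h = {x. norm (x - (u \<bullet> x) *\<^sub>R u) \<le> \<rho> \<and> \<bar>u \<bullet> x\<bar> \<le> h}"

lemma cylinder_closed: "closed (cylinder u \<rho> h)"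
  unfolding cylinder_def Collect_conj_eq
  by (intro closed_Int closed_Collect_le continuous_intros)

lemma cylinder_borel [measurable]: "cylinder u \<rho> h \<in> sets borel"
  by (intro borel_closed cylinder_closed)

lemma norm_orth_decomp:
  fixes u x :: "'a::real_inner"
  assumes "u \<bullet> u = 1"
  shows "norm (x - (u \<bullet> x) *\<^sub>R u + t *\<^sub>R u)^2 = norm (x - (u \<bullet> x) *\<^sub>R u)^2 + t^2"
proof -
  have "orthogonal (x - (u \<bullet> x) *\<^sub>R u) (t *\<^sub>R u)"
    using assms by (simp add: orthogonal_def inner_diff_left inner_commute[of x])
  from norm_add_Pythagorean[OF this] have "norm (x - (u \<bullet> x) *\<^sub>R u + t *\<^sub>R u)^2 = norm (x - (u \<bullet> x) *\<^sub>R u)^2 + norm (t *\<^sub>R u)^2" .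
  moreover have "norm u = 1" using assms by (simp add: norm_eq_sqrt_inner)
  ultimately show ?thesis by simp
qed

text \<open>Along \<open>u\<close> the cylinder is cut in intervals of length \<open>2 * h\<close>
  or not at all. The reference height \<open>1/2\<close> is that of the weight
  \<open>\<psi>\<close>, whose integral is 1.\<close>

lemma emeasure_cylinder_height:
  fixes u :: "'a::euclidean_space"
  assumes u: "u \<bullet> u = 1" and h: "0 \<le> h"
  shows "emeasure lborel (cylinder u \<rho> h) = ennreal (2 * h) * emeasure lborel (cylinder u \<rho> (1/2))"
proof -
  define \<psi> :: "real \<Rightarrow> ennreal" where "\<psi> = indicator {-1/2..1/2}"
  have [measurable]: "\<psi> \<in> borel_measurable borel" by (simp add: \<psi>_def)
  have "emeasure lborel (cylinder u \<rho> h) = (\<integral>\<^sup>+x. indicator (cylinder u \<rho> h) x \<partial>lborel) * (\<integral>\<^sup>+t. \<psi> t \<partial>lborel)"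
    by (simp add: \<psi>_def)
  also have "\<dots> = (\<integral>\<^sup>+x. (\<integral>\<^sup>+t. indicator (cylinder u \<rho> h) (x - (u \<bullet> x) *\<^sub>R u + t *\<^sub>R u) \<partial>lborel) * \<psi> (u \<bullet> x) \<partial>lborel)"
    by (rule nn_integral_slices[OF u]) measurable
  also have "\<dots> = (\<integral>\<^sup>+x. ennreal (2 * h) * indicator (cylinder u \<rho> (1/2)) x \<partial>lborel)"
  proof (rule nn_integral_cong)
    fix x :: 'a
    have ux: "u \<bullet> (x - (u \<bullet> x) *\<^sub>R u + t *\<^sub>R u) = t" for t using u by (simp add: inner_diff_right inner_add_right)
    have "(x - (u \<bullet> x) *\<^sub>R u + t *\<^sub>R u \<in> cylinder u \<rho> h) \<longleftrightarrow> norm (x - (u \<bullet> x) *\<^sub>R u) \<le> \<rho> \<and> t \<in> {-h..h}" for t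
      unfolding cylinder_def mem_Collect_eq ux by auto
    then have "(\<integral>\<^sup>+t. indicator (cylinder u \<rho> h) (x - (u \<bullet> x) *\<^sub>R u + t *\<^sub>R u) \<partial>lborel)
        = (\<integral>\<^sup>+t. (if norm (x - (u \<bullet> x) *\<^sub>R u) \<le> \<rho> then 1 else 0) * indicator {-h..h} t \<partial>lborel)"
      by (intro nn_integral_cong) (auto simp: indicator_def)
    also have "\<dots> = (if norm (x - (u \<bullet> x) *\<^sub>R u) \<le> \<rho> then ennreal (2 * h) else 0)"
      using h by (simp add: nn_integral_cmult)
    finally show "(\<integral>\<^sup>+t. indicator (cylinder u \<rho> h) (x - (u \<bullet> x) *\<^sub>R u + t *\<^sub>R u) \<partial>lborel) * \<psi> (u \<bullet> x)
        = ennreal (2 * h) * indicator (cylinder u \<rho> (1/2)) x"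
      by (auto simp: \<psi>_def cylinder_def indicator_def)
  qed
  also have "\<dots> = ennreal (2 * h) * emeasure lborel (cylinder u \<rho> (1/2))"
    by (simp add: nn_integral_cmult)
  finally show ?thesis .
qed

text \<open>Dilation by \<open>\<rho>\<close> costs the full power of the dimension; restoring the
  height gives one power back.\<close>

lemma emeasure_cylinder_radius:
  fixes u :: "'a::euclidean_space"
  assumes u: "u \<bullet> u = 1" and \<rho>: "0 < \<rho>"
  shows "emeasure lborel (cylinder u \<rho> (1/2)) = ennreal (\<rho> ^ (DIM('a) - 1)) * emeasure lborel (cylinder u 1 (1/2))"
proof -
  have "{x. \<rho> *\<^sub>R x \<in> cylinder u \<rho> (1/2)} = cylinder u 1 (1 / (2 * \<rho>))"
  proof -
    have "\<rho> *\<^sub>R x - (u \<bullet> (\<rho> *\<^sub>R x)) *\<^sub>R u = \<rho> *\<^sub>R (x - (u \<bullet> x) *\<^sub>R u)" for x by (simp add: algebra_simps)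
    then have "norm (\<rho> *\<^sub>R x - (u \<bullet> (\<rho> *\<^sub>R x)) *\<^sub>R u) = \<rho> * norm (x - (u \<bullet> x) *\<^sub>R u)" for x
      using \<rho> by (metis norm_scaleR abs_of_pos)
    then show ?thesis using \<rho> unfolding cylinder_def by (auto simp: abs_mult field_simps)
  qed
  then have "emeasure lborel (cylinder u \<rho> (1/2)) = ennreal (\<rho> ^ DIM('a)) * emeasure lborel (cylinder u 1 (1 / (2 * \<rho>)))"
    using emeasure_lborel_scale[of \<rho> "cylinder u \<rho> (1/2)"] \<rho> by simp
  also have "\<dots> = ennreal (\<rho> ^ DIM('a)) * (ennreal (1 / \<rho>) * emeasure lborel (cylinder u 1 (1/2)))"
    using \<rho> by (subst emeasure_cylinder_height[OF u]) auto
  also have "\<dots> = ennreal (\<rho> ^ DIM('a) * (1 / \<rho>)) * emeasure lborel (cylinder u 1 (1/2))"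
    using \<rho> by (subst mult.assoc[symmetric], subst ennreal_mult[symmetric]) auto
  also have "\<rho> ^ DIM('a) * (1 / \<rho>) = \<rho> ^ (DIM('a) - 1)"
    using \<rho> power_Suc[of \<rho> "DIM('a) - 1"] by simp
  finally show ?thesis .
qed

lemma nn_integral_half_ball_power:
  "(\<integral>\<^sup>+t. indicator {-1..1} t * ennreal (sqrt (1 - t\<^sup>2) ^ n) \<partial>lborel)
    = ennreal (unit_ball_vol (real (Suc n)) / unit_ball_vol (real n))"
proof -
  have "unit_ball_vol n * Beta (1/2) (n / 2 + 1) = unit_ball_vol (Suc n)"
    by (auto simp: unit_ball_vol_def Beta_def Gamma_eq_zero_iff field_simps
          Gamma_one_half_real powr_half_sqrt [symmetric] powr_add [symmetric])
  then have "Beta (1/2) (n / 2 + 1) = unit_ball_vol (real (Suc n)) / unit_ball_vol (real n)"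
    using unit_ball_vol_pos[of "real n"] by (simp add: eq_divide_eq mult.commute del: unit_ball_vol_pos)
  moreover have "(\<integral>\<^sup>+t. indicator {-1..1} t * ennreal (sqrt (1 - t\<^sup>2) ^ n) \<partial>lborel)
      = (\<integral>\<^sup>+x. ennreal (indicator {-1..1} x * sqrt (1 - x\<^sup>2) ^ n) \<partial>lborel)"
    by (intro nn_integral_cong) (auto simp: indicator_def)
  ultimately show ?thesis using emeasure_cball_aux_integral[of n] by simp
qed

text \<open>The slice of the unit ball at height \<open>t\<close> is a cylinder section of radius
  \<open>sqrt (1 - t^2)\<close>, so the ball volume is the unknown constant times a Beta integral.
  That integral is a quotient of consecutive unit ball volumes, which identifies the
  constant.\<close>

lemma emeasure_cylinder_unit:
  fixes u :: "'a::euclidean_space"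
  assumes u: "u \<bullet> u = 1"
  shows "emeasure lborel (cylinder u 1 (1/2)) = ennreal (unit_ball_vol (real (DIM('a) - 1)))"
proof -
  define n where "n = DIM('a) - 1"
  have n: "DIM('a) = Suc n" by (simp add: n_def)
  define \<psi> :: "real \<Rightarrow> ennreal" where "\<psi> = indicator {-1/2..1/2}"
  have [measurable]: "\<psi> \<in> borel_measurable borel" by (simp add: \<psi>_def)
  have [measurable]: "cball (0::'a) 1 \<in> sets borel" by (simp add: borel_closed)
  let ?\<kappa> = "emeasure lborel (cylinder u 1 (1/2))"
  have [measurable]: "(\<lambda>x::'a. u \<bullet> x) \<in> borel_measurable borel" by simp
  have "ennreal (unit_ball_vol (real (Suc n))) = (\<integral>\<^sup>+x. indicator (cball (0::'a) 1) x \<partial>lborel) * (\<integral>\<^sup>+t. \<psi> t \<partial>lborel)"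
    by (simp add: \<psi>_def emeasure_cball n)
  also have "\<dots> = (\<integral>\<^sup>+x. (\<integral>\<^sup>+t. indicator (cball 0 1) (x - (u \<bullet> x) *\<^sub>R u + t *\<^sub>R u) \<partial>lborel) * \<psi> (u \<bullet> x) \<partial>lborel)"
    by (rule nn_integral_slices[OF u]) measurable
  also have "\<dots> = (\<integral>\<^sup>+x. (\<integral>\<^sup>+t. indicator (cball 0 1) (x - (u \<bullet> x) *\<^sub>R u + t *\<^sub>R u) * \<psi> (u \<bullet> x) \<partial>lborel) \<partial>lborel)"
    by (intro nn_integral_cong nn_integral_multc[symmetric]) measurable
  also have "\<dots> = (\<integral>\<^sup>+t. (\<integral>\<^sup>+x. indicator (cball 0 1) (x - (u \<bullet> x) *\<^sub>R u + t *\<^sub>R u) * \<psi> (u \<bullet> x) \<partial>lborel) \<partial>lborel)"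
    by (rule lborel_pair.Fubini') measurable
  also have "\<dots> = (\<integral>\<^sup>+t. indicator {-1..1} t * ennreal (sqrt (1 - t\<^sup>2) ^ n) * ?\<kappa> \<partial>lborel)"
  proof (rule nn_integral_cong_AE)
    \<comment> \<open>At the heights 1 and -1 the radius vanishes and the scaling of cylinders does
      not apply.\<close>
    have "AE t in lborel. t \<noteq> (1::real)" "AE t in lborel. t \<noteq> (-1::real)"
      by (rule AE_lborel_singleton)+
    then show "AE t in lborel. (\<integral>\<^sup>+x. indicator (cball 0 1) (x - (u \<bullet> x) *\<^sub>R u + t *\<^sub>R u) * \<psi> (u \<bullet> x) \<partial>lborel)
        = indicator {-1..1} t * ennreal (sqrt (1 - t\<^sup>2) ^ n) * ?\<kappa>"
    proof eventually_elim
      case (elim t)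
      have ball: "x - (u \<bullet> x) *\<^sub>R u + t *\<^sub>R u \<in> cball 0 1 \<longleftrightarrow> norm (x - (u \<bullet> x) *\<^sub>R u)^2 \<le> 1 - t^2" for x
      proof -
        have "x - (u \<bullet> x) *\<^sub>R u + t *\<^sub>R u \<in> cball 0 1 \<longleftrightarrow> norm (x - (u \<bullet> x) *\<^sub>R u + t *\<^sub>R u)^2 \<le> 1"
          by (simp add: power_le_one_iff)
        then show ?thesis unfolding norm_orth_decomp[OF u] by auto
      qed
      show ?case
      proof (cases "\<bar>t\<bar> < 1")
        case True
        then have t: "0 < 1 - t^2" by (simp add: abs_square_less_1)
        have "indicator (cball 0 1) (x - (u \<bullet> x) *\<^sub>R u + t *\<^sub>R u) * \<psi> (u \<bullet> x) = indicator (cylinder u (sqrt (1 - t^2)) (1/2)) x" for x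
        proof -
          have "norm (x - (u \<bullet> x) *\<^sub>R u)^2 \<le> 1 - t^2 \<longleftrightarrow> norm (x - (u \<bullet> x) *\<^sub>R u) \<le> sqrt (1 - t^2)"
            by (metis norm_ge_zero real_sqrt_abs abs_of_nonneg real_sqrt_le_iff)
          then show ?thesis using ball[of x] by (auto simp: indicator_def \<psi>_def cylinder_def)
        qed
        then have "(\<integral>\<^sup>+x. indicator (cball 0 1) (x - (u \<bullet> x) *\<^sub>R u + t *\<^sub>R u) * \<psi> (u \<bullet> x) \<partial>lborel) = emeasure lborel (cylinder u (sqrt (1 - t^2)) (1/2))"
          by simp
        also have "\<dots> = ennreal (sqrt (1 - t\<^sup>2) ^ n) * ?\<kappa>"
          using t by (subst emeasure_cylinder_radius[OF u]) (auto simp: n_def)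
        finally show ?thesis using True by (auto simp: indicator_def)
      next
        case False
        then have "1 < \<bar>t\<bar>" using elim by auto
        then have "1 - t^2 < 0" by (metis diff_less_0_iff_less one_less_power power2_abs zero_less_numeral)
        then have "x - (u \<bullet> x) *\<^sub>R u + t *\<^sub>R u \<notin> cball 0 1" for x
          unfolding ball by (smt (verit) zero_le_power2)
        then show ?thesis using \<open>1 < \<bar>t\<bar>\<close> by (auto simp: indicator_def)
      qed
    qed
  qed
  also have "\<dots> = ennreal (unit_ball_vol (real (Suc n)) / unit_ball_vol (real n)) * ?\<kappa>"
    by (subst nn_integral_multc) (simp_all add: nn_integral_half_ball_power)
  finally have eq: "ennreal (unit_ball_vol (real (Suc n))) = ennreal (unit_ball_vol (real (Suc n)) / unit_ball_vol (real n)) * ?\<kappa>" .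
  have pos: "0 < unit_ball_vol (real (Suc n))" "0 < unit_ball_vol (real n)" by simp_all
  have "ennreal (unit_ball_vol (real n)) = ennreal (unit_ball_vol (real n) / unit_ball_vol (real (Suc n))) * ennreal (unit_ball_vol (real (Suc n)))"
    using pos by (simp add: ennreal_mult[symmetric] del: of_nat_Suc unit_ball_vol_pos)
  also have "\<dots> = ennreal (unit_ball_vol (real n) / unit_ball_vol (real (Suc n))) * (ennreal (unit_ball_vol (real (Suc n)) / unit_ball_vol (real n)) * ?\<kappa>)"
    by (subst eq) simp
  also have "\<dots> = ?\<kappa>"
    using pos by (simp add: mult.assoc[symmetric] ennreal_mult[symmetric] del: of_nat_Suc unit_ball_vol_pos)
  finally show ?thesis by (simp add: n_def)
qed

lemma emeasure_cylinder:
  fixes u :: "'a::euclidean_space"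
  assumes u: "u \<bullet> u = 1" and "0 < \<rho>" "0 \<le> h"
  shows "emeasure lborel (cylinder u \<rho> h) = ennreal (2 * h * unit_ball_vol (real (DIM('a) - 1)) * \<rho> ^ (DIM('a) - 1))"
  using assms by (simp add: emeasure_cylinder_height[OF u, of h] emeasure_cylinder_radius[OF u] emeasure_cylinder_unit[OF u]
      ennreal_mult[symmetric] mult_ac)

section \<open>Isodiametric estimate for sheets\<close>

lemma box_family_reflect:
  fixes \<A> :: "'a::euclidean_space set set"
  assumes "box_family \<A>"
  shows "box_family ((`) uminus ` \<A>)"
proof -
  have cb: "uminus ` cbox a b = cbox (-b) (-a)" for a b :: 'a
  proof
    show "cbox (-b) (-a) \<subseteq> uminus ` cbox a b"
    proof
      fix x assume "x \<in> cbox (-b) (-a)"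
      then have "- x \<in> cbox a b" by (force simp: mem_box)
      then show "x \<in> uminus ` cbox a b" by (metis add.inverse_inverse image_eqI)
    qed
  qed (auto simp: mem_box)
  have 1: "interior K \<noteq> {} \<and> (\<exists>c d. K = cbox c d)" if K: "K \<in> (`) uminus ` \<A>" for K
  proof -
    obtain L where "L \<in> \<A>" "K = uminus ` L" using K by blast
    then show ?thesis using box_familyE[OF assms, of L] assms unfolding box_family_def
      by (metis cb image_is_empty interior_negations)
  qed
  have 2: "interior K \<inter> interior K' = {}" if K: "K \<in> (`) uminus ` \<A>" "K' \<in> (`) uminus ` \<A>" "K \<noteq> K'" for K K'
  proof -
    obtain L L' where L: "L \<in> \<A>" "K = uminus ` L" "L' \<in> \<A>" "K' = uminus ` L'" using K by blast
    then have "interior L \<inter> interior L' = {}" using assms K unfolding box_family_def pairwise_def by metis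
    then show ?thesis unfolding L interior_negations by auto
  qed
  have "finite ((`) uminus ` \<A>)" using assms unfolding box_family_def by simp
  then show ?thesis
    unfolding box_family_def pairwise_def by (intro conjI ballI impI 1 2)
qed

text \<open>Isodiametric inequality in codimension one, from the Brunn--Minkowski inequality applied to
  \<open>A\<close> and its reflection: \<open>(A - A)/2\<close> lies in a cylinder of the right size.\<close>

lemma isodiametric_cover:
  fixes C :: "'a::euclidean_space set"
  assumes u: "u \<bullet> u = 1" and C: "bounded C" and \<eta>: "0 < \<eta>"
  obtains T where "T \<in> lmeasurable" "{x + t *\<^sub>R u | x t. x \<in> C \<and> 0 < t \<and> t \<le> 1} \<subseteq> T"
    "measure lebesgue T \<le> (1 + diameter C) * hausdorff_gauge (DIM('a) - 1) C + \<eta>"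
proof (cases "C = {}")
  case True
  then show ?thesis using \<eta> by (intro that[of "{}"]) auto
next
  case False
  define s where "s = DIM('a) - 1"
  define d where "d = diameter C"
  have d: "0 \<le> d" unfolding d_def by (rule diameter_ge_0[OF C])
  \<comment> \<open>Volume of the cylinder of radius \<open>d / 2 + \<zeta>\<close> and half-height
    \<open>(1 + d) / 2 + \<zeta>\<close>; the slack \<open>\<zeta>\<close> pays for replacing the
    sheet by boxes within distance \<open>\<zeta>\<close> of it.\<close>
  define V where "V \<zeta> = 2 * ((1 + d) / 2 + \<zeta>) * unit_ball_vol (real s) * (d / 2 + \<zeta>) ^ s" for \<zeta>
  have V0: "V 0 = (1 + d) * hausdorff_gauge s C"
    using False by (simp add: V_def hausdorff_gauge_def d_def power_divide field_simps)
  have "isCont V 0" unfolding V_def by (intro continuous_intros)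
  then have "\<forall>\<^sub>F \<zeta> in at_right 0. V \<zeta> < V 0 + \<eta>"
    using \<eta> by (intro order_tendstoD(2)[of V "V 0"]) (auto simp: isCont_def intro: tendsto_within_subset filterlim_at_split[THEN iffD1, THEN conjunct2])
  moreover have "\<forall>\<^sub>F \<zeta>::real in at_right 0. 0 < \<zeta>" by (rule eventually_at_right_less)
  ultimately obtain \<zeta> where \<zeta>: "0 < \<zeta>" "V \<zeta> < V 0 + \<eta>"
    using eventually_happens[OF eventually_conj] by (metis (mono_tags, lifting) trivial_limit_at_right_real)
  \<comment> \<open>As \<open>C\<close> is arbitrary, the sheet may fail to be measurable; a
    countable union of boxes covering it will serve as \<open>T\<close>.\<close>
  define S where "S = {x + t *\<^sub>R u | x t. x \<in> C \<and> 0 < t \<and> t \<le> 1}"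
  have nu: "norm u = 1" using u by (simp add: norm_eq_sqrt_inner)
  have "bounded S"
  proof -
    obtain B where B: "\<And>x. x \<in> C \<Longrightarrow> norm x \<le> B" using C by (auto simp: bounded_iff)
    have "norm y \<le> B + 1" if "y \<in> S" for y
      using that B nu by (auto simp: S_def intro!: order_trans[OF norm_triangle_ineq] add_mono)
    then show ?thesis by (auto simp: bounded_iff)
  qed
  then obtain a where a: "S \<subseteq> cbox (-a) a" using bounded_subset_cbox_symmetric by blast
  define b where "b = a + One"
  have "S \<noteq> {}" using False by (auto simp: S_def intro!: exI[of _ 1])
  then have anz: "\<forall>i\<in>Basis. 0 \<le> a \<bullet> i" using a by (force simp: mem_box)
  have b: "S \<subseteq> cbox (-b) b" "box (-b) b \<noteq> {}"
  proof -
    have "cbox (-a) a \<subseteq> cbox (-b) b" by (auto simp: subset_box b_def inner_add_left inner_diff_left)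
    with a show "S \<subseteq> cbox (-b) b" by blast
    show "box (-b) b \<noteq> {}" using anz by (auto simp: b_def box_ne_empty inner_add_left inner_diff_left add_pos_nonneg)
  qed
  \<comment> \<open>Covering lemma with a constant gauge: each box lies in a
    \<open>\<zeta>\<close>-ball around a point of the sheet. Volume bounds pass from finite
    subfamilies to the whole family.\<close>
  obtain \<D> where \<D>: "countable \<D>" "\<Union>\<D> \<subseteq> cbox (-b) b"
    "\<And>K. K \<in> \<D> \<Longrightarrow> interior K \<noteq> {} \<and> (\<exists>c d. K = cbox c d)"
    "pairwise (\<lambda>A B. interior A \<inter> interior B = {}) \<D>"
    "\<And>K. K \<in> \<D> \<Longrightarrow> \<exists>x\<in>S \<inter> K. K \<subseteq> ball x \<zeta>" "S \<subseteq> \<Union>\<D>"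
    by (rule covering_lemma[OF b gauge_ball[OF \<zeta>(1)]]) (rule that; assumption)
  have bound: "measure lebesgue (\<Union>\<E>) \<le> V \<zeta>" if \<E>: "\<E> \<subseteq> \<D>" "finite \<E>" for \<E>
  proof (cases "\<E> = {}")
    case True
    then show ?thesis using \<zeta> d by (auto simp: V_def intro!: mult_nonneg_nonneg)
  next
    case False
    let ?A = "\<Union>\<E>"
    let ?\<R> = "(`) uminus ` \<E>"
    have fam: "box_family \<E>" using \<E> \<D>(3,4) by (auto simp: box_family_def intro: pairwise_subset)
    note fam' = box_family_reflect[OF fam]
    have R: "\<Union>?\<R> = uminus ` ?A" by auto
    have mR: "measure lebesgue (uminus ` ?A) = measure lebesgue ?A"
    proof -
      have "compact ?A" "compact (uminus ` ?A)" using compact_box_family[OF fam] compact_negations by auto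
      then have [measurable]: "?A \<in> sets borel" "uminus ` ?A \<in> sets borel" by (auto intro: borel_compact)
      have "{x. (-1) *\<^sub>R x \<in> ?A} = uminus ` ?A" by (auto simp: image_iff) (metis add.inverse_inverse)
      then have "emeasure lborel (uminus ` ?A) = emeasure lborel ?A"
        using emeasure_lborel_scale[of "-1" ?A] by simp
      then show ?thesis by (simp add: measure_def)
    qed
    have "measure lebesgue ?A = sqrt (measure lebesgue ?A * measure lebesgue (\<Union>?\<R>))"
      unfolding R mR by simp
    also have "\<dots> \<le> measure lebesgue (midpoints ?A (\<Union>?\<R>))"
      using False by (intro brunn_minkowski_box_family fam fam') auto
    also have "\<dots> \<le> measure lebesgue (cylinder u (d / 2 + \<zeta>) ((1 + d) / 2 + \<zeta>))"
    proof (rule measure_mono_fmeasurable)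
      show "midpoints ?A (\<Union>?\<R>) \<in> sets lebesgue"
        by (intro fmeasurableD lmeasurable_compact compact_midpoints compact_box_family fam fam')
      show "cylinder u (d / 2 + \<zeta>) ((1 + d) / 2 + \<zeta>) \<in> lmeasurable"
        using \<zeta> d by (intro fmeasurableI) (auto simp: emeasure_cylinder[OF u])
      show "midpoints ?A (\<Union>?\<R>) \<subseteq> cylinder u (d / 2 + \<zeta>) ((1 + d) / 2 + \<zeta>)"
      proof
        fix z assume "z \<in> midpoints ?A (\<Union>?\<R>)"
        then obtain x w where "x \<in> ?A" "w \<in> uminus ` ?A" "z = (1/2) *\<^sub>R (x + w)"
          unfolding R by (rule midpointsE)
        then obtain y where xy: "x \<in> ?A" "y \<in> ?A" and z: "z = (1/2) *\<^sub>R (x - y)" by auto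
        have near: "\<exists>c\<in>C. \<exists>t e. x = c + t *\<^sub>R u + e \<and> 0 < t \<and> t \<le> 1 \<and> norm e \<le> \<zeta>" if x: "x \<in> ?A" for x
        proof -
          obtain K where "K \<in> \<D>" "x \<in> K" using x \<E> by blast
          then obtain y where y: "y \<in> S" "x \<in> ball y \<zeta>" using \<D>(5) by blast
          then obtain c t where ct: "c \<in> C" "0 < t" "t \<le> 1" "y = c + t *\<^sub>R u" by (auto simp: S_def)
          have "x = c + t *\<^sub>R u + (x - y)" "norm (x - y) \<le> \<zeta>"
            using y ct by (auto simp: dist_norm norm_minus_commute)
          with ct show ?thesis by blast
        qed
        obtain c t e where x: "c \<in> C" "x = c + t *\<^sub>R u + e" "0 < t" "t \<le> 1" "norm e \<le> \<zeta>" using near[OF xy(1)] by blast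
        obtain c' t' e' where y: "c' \<in> C" "y = c' + t' *\<^sub>R u + e'" "0 < t'" "t' \<le> 1" "norm e' \<le> \<zeta>" using near[OF xy(2)] by blast
        have cc: "norm (c - c') \<le> d"
          using diameter_bounded_bound[OF C x(1) y(1)] by (simp add: d_def dist_norm)
        have proj: "norm (v - (u \<bullet> v) *\<^sub>R u) \<le> norm v" for v
        proof (rule power2_le_imp_le)
          have "norm v ^ 2 = norm (v - (u \<bullet> v) *\<^sub>R u)^2 + (u \<bullet> v)^2"
            using norm_orth_decomp[OF u, of v "u \<bullet> v"] by simp
          then show "norm (v - (u \<bullet> v) *\<^sub>R u)^2 \<le> norm v ^ 2" by simp
        qed simp
        have ip: "\<bar>u \<bullet> v\<bar> \<le> norm v" for v using Cauchy_Schwarz_ineq2[of u v] nu by simp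
        define w where "w = (c - c') + (e - e')"
        have w: "norm w \<le> d + 2 * \<zeta>"
          unfolding w_def using cc x(5) y(5) norm_triangle_ineq[of "c - c'" "e - e'"] norm_triangle_ineq4[of e e'] by linarith
        \<comment> \<open>As \<open>t - t'\<close> lies in [-1, 1], halving gives a height of at
          most \<open>(1 + d) / 2 + \<zeta>\<close>; the term along \<open>u\<close> does not affect
          the radius.\<close>
        have xy': "x - y = w + (t - t') *\<^sub>R u" by (simp add: x(2) y(2) w_def algebra_simps)
        have "z - (u \<bullet> z) *\<^sub>R u = (1/2) *\<^sub>R (w - (u \<bullet> w) *\<^sub>R u)"
          unfolding z xy' using u by (simp add: algebra_simps)
        then have "norm (z - (u \<bullet> z) *\<^sub>R u) \<le> d / 2 + \<zeta>"
          using proj[of w] w by simp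
        moreover have "u \<bullet> z = (u \<bullet> w + (t - t')) / 2" unfolding z xy' using u by (simp add: inner_add_right)
        then have "\<bar>u \<bullet> z\<bar> \<le> (1 + d) / 2 + \<zeta>"
        proof -
          assume uz: "u \<bullet> z = (u \<bullet> w + (t - t')) / 2"
          have q: "u \<bullet> w \<le> d + 2 * \<zeta>" "- (u \<bullet> w) \<le> d + 2 * \<zeta>" using ip[of w] w by auto
          show ?thesis unfolding uz using q x(3,4) y(3,4) by (intro abs_leI) (simp_all add: field_simps)
        qed
        ultimately show "z \<in> cylinder u (d / 2 + \<zeta>) ((1 + d) / 2 + \<zeta>)" by (simp add: cylinder_def)
      qed
    qed
    also have "\<dots> = V \<zeta>"
    proof -
      have "emeasure lebesgue (cylinder u (d / 2 + \<zeta>) ((1 + d) / 2 + \<zeta>)) = ennreal (V \<zeta>)"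
        using \<zeta> d by (simp add: emeasure_cylinder[OF u] V_def s_def)
      moreover have "0 \<le> V \<zeta>" using \<zeta> d by (auto simp: V_def intro!: mult_nonneg_nonneg)
      ultimately show ?thesis by (simp add: measure_def)
    qed
    finally show ?thesis .
  qed
  have lm: "K \<in> lmeasurable" if "K \<in> \<D>" for K using \<D>(3)[OF that] by auto
  have "\<Union>\<D> \<in> lmeasurable" by (rule fmeasurable_Union_bound[OF \<D>(1) lm bound])
  moreover have "measure lebesgue (\<Union>\<D>) \<le> V \<zeta>" by (rule measure_Union_bound[OF \<D>(1) lm bound])
  ultimately show ?thesis
    using \<D>(6) \<zeta>(2) by (intro that[of "\<Union>\<D>"]) (auto simp: S_def V0 s_def d_def)
qed


text \<open>Every covering set contributes the sheet over it, whose volume exceeds the gauge at most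
  by the factor \<open>1 + \<delta>\<close> and a summable error. Height 1 of the sheet makes the
  limiting constant 1.\<close>

lemma emeasure_sheet_le_hausdorff:
  fixes E :: "'a::euclidean_space set"
  assumes u: "u \<bullet> u = 1" and W: "W \<in> sets lebesgue"
    and sub: "W \<subseteq> {x + t *\<^sub>R u | x t. x \<in> E \<and> 0 < t \<and> t \<le> 1}"
  shows "emeasure lebesgue W \<le> hausdorff_outer (DIM('a) - 1) E"
proof -
  define s where "s = DIM('a) - 1"
  have *: "emeasure lebesgue W \<le> ennreal (1 + \<delta>) * hausdorff_outer s E" if "0 < \<delta>" for \<delta>
  proof -
    have "ennreal (1 / (1 + \<delta>)) * emeasure lebesgue W \<le> hausdorff_pre s \<delta> E"
    proof (rule hausdorff_pre_greatest)
      fix C assume C: "delta_cover \<delta> E C"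
      have "emeasure lebesgue W \<le> ennreal (1 + \<delta>) * (\<Sum>j. ennreal (hausdorff_gauge s (C j)))"
      proof (rule ennreal_le_epsilon)
        fix e :: real assume e: "0 < e"
        have "\<exists>T. T \<in> lmeasurable \<and> {x + t *\<^sub>R u | x t. x \<in> C j \<and> 0 < t \<and> t \<le> 1} \<subseteq> T \<and>
            measure lebesgue T \<le> (1 + diameter (C j)) * hausdorff_gauge s (C j) + e * (1/2)^Suc j" for j
        proof -
          have bj: "bounded (C j)" and pj: "0 < e * (1/2)^Suc j" using C e by (auto simp: delta_cover_def)
          show ?thesis unfolding s_def by (rule isodiametric_cover[OF u bj pj]) (intro exI conjI)
        qed
        then have "\<exists>T. \<forall>j. T j \<in> lmeasurable \<and> {x + t *\<^sub>R u | x t. x \<in> C j \<and> 0 < t \<and> t \<le> 1} \<subseteq> T j \<and>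
            measure lebesgue (T j) \<le> (1 + diameter (C j)) * hausdorff_gauge s (C j) + e * (1/2)^Suc j"
          by (intro choice allI)
        then obtain T where T: "\<And>j. T j \<in> lmeasurable"
          "\<And>j. {x + t *\<^sub>R u | x t. x \<in> C j \<and> 0 < t \<and> t \<le> 1} \<subseteq> T j"
          "\<And>j. measure lebesgue (T j) \<le> (1 + diameter (C j)) * hausdorff_gauge s (C j) + e * (1/2)^Suc j"
          by blast
        have "W \<subseteq> (\<Union>j. T j)"
        proof
          fix y assume "y \<in> W"
          then obtain x t where xt: "x \<in> E" "y = x + t *\<^sub>R u" "0 < t" "t \<le> 1" using sub by blast
          then obtain j where "x \<in> C j" using C by (auto simp: delta_cover_def)
          then show "y \<in> (\<Union>j. T j)" using T(2)[of j] xt by blast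
        qed
        then have "emeasure lebesgue W \<le> emeasure lebesgue (\<Union>j. T j)"
          by (rule emeasure_mono) (use T(1) in auto)
        also have "\<dots> \<le> (\<Sum>j. emeasure lebesgue (T j))"
          by (rule emeasure_subadditive_countably) (use T(1) in auto)
        also have "\<dots> \<le> (\<Sum>j. ennreal (1 + \<delta>) * ennreal (hausdorff_gauge s (C j)) + ennreal e * ennreal ((1/2)^Suc j))"
        proof (rule suminf_le)
          fix j
          have g: "0 \<le> hausdorff_gauge s (C j)" "diameter (C j) \<le> \<delta>"
            using C by (auto simp: delta_cover_def hausdorff_gauge_nonneg)
          have "emeasure lebesgue (T j) = ennreal (measure lebesgue (T j))"
            using T(1) by (simp add: emeasure_eq_measure2)
          also have "\<dots> \<le> ennreal ((1 + \<delta>) * hausdorff_gauge s (C j) + e * (1/2)^Suc j)"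
            using g by (intro ennreal_leI order_trans[OF T(3)] add_mono mult_right_mono) auto
          also have "\<dots> = ennreal (1 + \<delta>) * ennreal (hausdorff_gauge s (C j)) + ennreal e * ennreal ((1/2)^Suc j)"
            using g e that by (simp add: ennreal_mult[symmetric] del: ennreal_plus power_Suc add: ennreal_plus[symmetric])
          finally show "emeasure lebesgue (T j) \<le> ennreal (1 + \<delta>) * ennreal (hausdorff_gauge s (C j)) + ennreal e * ennreal ((1/2)^Suc j)" .
        qed auto
        also have "\<dots> = (\<Sum>j. ennreal (1 + \<delta>) * ennreal (hausdorff_gauge s (C j))) + (\<Sum>j. ennreal e * ennreal ((1/2)^Suc j))"
          by (rule suminf_add[symmetric]) auto
        also have "\<dots> = ennreal (1 + \<delta>) * (\<Sum>j. ennreal (hausdorff_gauge s (C j))) + ennreal e"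
          unfolding ennreal_suminf_cmult
          by (subst suminf_ennreal_eq[OF zero_le_power power_half_series]) auto
        finally show "emeasure lebesgue W \<le> ennreal (1 + \<delta>) * (\<Sum>j. ennreal (hausdorff_gauge s (C j))) + ennreal e" .
      qed
      then have "ennreal (1 / (1 + \<delta>)) * emeasure lebesgue W
          \<le> ennreal (1 / (1 + \<delta>)) * (ennreal (1 + \<delta>) * (\<Sum>j. ennreal (hausdorff_gauge s (C j))))"
        by (rule mult_left_mono) simp
      also have "\<dots> = (\<Sum>j. ennreal (hausdorff_gauge s (C j)))"
        using that by (simp add: mult.assoc[symmetric] ennreal_mult[symmetric] del: ennreal_plus)
      finally show "ennreal (1 / (1 + \<delta>)) * emeasure lebesgue W \<le> (\<Sum>j. ennreal (hausdorff_gauge s (C j)))" .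
    qed
    also have "\<dots> \<le> hausdorff_outer s E" using that by (rule hausdorff_pre_le_outer)
    finally have "ennreal (1 + \<delta>) * (ennreal (1 / (1 + \<delta>)) * emeasure lebesgue W) \<le> ennreal (1 + \<delta>) * hausdorff_outer s E"
      by (rule mult_left_mono) simp
    then show ?thesis
      using that by (simp add: mult.assoc[symmetric] ennreal_mult[symmetric] del: ennreal_plus)
  qed
  show ?thesis unfolding s_def[symmetric]
  proof (rule ennreal_le_epsilon)
    fix e :: real assume fin: "hausdorff_outer s E < top" and e: "0 < e"
    then obtain h where h: "hausdorff_outer s E = ennreal h" "0 \<le> h" by (cases "hausdorff_outer s E") auto
    \<comment> \<open>The choice \<open>\<delta> = e / (h + 1)\<close> gives
      \<open>\<delta> * h \<le> e\<close>; the summand 1 covers \<open>h = 0\<close>.\<close>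
    have "emeasure lebesgue W \<le> ennreal (1 + e / (h + 1)) * ennreal h"
      using *[of "e / (h + 1)"] e h by simp
    also have "\<dots> = ennreal ((1 + e / (h + 1)) * h)" using e h by (simp add: ennreal_mult del: ennreal_plus)
    also have "\<dots> \<le> ennreal (h + e)"
      using e h by (intro ennreal_leI) (simp add: field_simps)
    also have "\<dots> = hausdorff_outer s E + ennreal e" using e h by simp
    finally show "emeasure lebesgue W \<le> hausdorff_outer s E + ennreal e" .
  qed
qed

section \<open>Covering by balls and slices\<close>

text \<open>A countable index set may be finite; spare indices receive radius -1, that is, an empty
  ball of volume 0.\<close>

lemma cball_family_sequence:
  fixes a :: "'i \<Rightarrow> 'a::euclidean_space"
  assumes "countable I"
  obtains c \<rho> where "(\<Union>i\<in>I. cball (a i) (r i)) = (\<Union>j::nat. cball (c j) (\<rho> j))"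
    "\<And>j. \<rho> j \<in> r ` I \<union> {-1}"
    "(\<Sum>j. emeasure lborel (cball (c j) (\<rho> j))) = (\<integral>\<^sup>+i. emeasure lborel (cball (a i) (r i)) \<partial>count_space I)"
proof -
  define J where "J = to_nat_on I ` I"
  define g where "g = from_nat_into I"
  have bij: "bij_betw g J I"
    unfolding bij_betw_def J_def g_def using assms by (auto simp: inj_on_def image_image)
  define \<rho> where "\<rho> j = (if j \<in> J then r (g j) else -1)" for j
  define c where "c j = a (g j)" for j
  have gI: "g ` J = I" using bij by (simp add: bij_betw_def)
  have "(\<Union>j. cball (c j) (\<rho> j)) = (\<Union>j\<in>J. cball (a (g j)) (r (g j)))"
  proof -
    have "cball (c j) (\<rho> j) = (if j \<in> J then cball (a (g j)) (r (g j)) else {})" for j by (simp add: c_def \<rho>_def)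
    then show ?thesis by auto
  qed
  also have "\<dots> = (\<Union>i\<in>I. cball (a i) (r i))" using gI by blast
  finally have 1: "(\<Union>i\<in>I. cball (a i) (r i)) = (\<Union>j. cball (c j) (\<rho> j))" ..
  have "(\<Sum>j. emeasure lborel (cball (c j) (\<rho> j))) = (\<integral>\<^sup>+j. emeasure lborel (cball (c j) (\<rho> j)) \<partial>count_space UNIV)"
    by (simp add: nn_integral_count_space_nat)
  also have "\<dots> = (\<integral>\<^sup>+j. emeasure lborel (cball (a (g j)) (r (g j))) * indicator J j \<partial>count_space UNIV)"
    by (intro nn_integral_cong) (auto simp: c_def \<rho>_def)
  also have "\<dots> = (\<integral>\<^sup>+j. emeasure lborel (cball (a (g j)) (r (g j))) \<partial>count_space J)"
    by (simp add: nn_integral_count_space_indicator)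
  also have "\<dots> = (\<integral>\<^sup>+i. emeasure lborel (cball (a i) (r i)) \<partial>count_space I)"
    by (rule nn_integral_bij_count_space[OF bij])
  finally have 2: "(\<Sum>j. emeasure lborel (cball (c j) (\<rho> j))) = (\<integral>\<^sup>+i. emeasure lborel (cball (a i) (r i)) \<partial>count_space I)" .
  have "\<rho> j \<in> r ` I \<union> {-1}" for j using gI by (auto simp: \<rho>_def)
  with 1 2 show ?thesis by (intro that[of c \<rho>])
qed

lemma disjoint_cballs_measure_le:
  fixes a :: "'i \<Rightarrow> 'a::euclidean_space"
  assumes "countable I" "pairwise (\<lambda>i j. disjnt (cball (a i) (r i)) (cball (a j) (r j))) I"
    and "open U" "(\<Union>i\<in>I. cball (a i) (r i)) \<subseteq> U"
  shows "(\<integral>\<^sup>+i. emeasure lborel (cball (a i) (r i)) \<partial>count_space I) \<le> emeasure lborel U"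
proof -
  have "(\<integral>\<^sup>+i. emeasure lborel (cball (a i) (r i)) \<partial>count_space I) = emeasure lborel (\<Union>i\<in>I. cball (a i) (r i))"
    using assms by (intro emeasure_UN_countable[symmetric])
      (auto simp: disjoint_family_on_def pairwise_def disjnt_def borel_closed)
  also have "\<dots> \<le> emeasure lborel U" using assms by (intro emeasure_mono) (auto intro: borel_open)
  finally show ?thesis .
qed

text \<open>Inside an open set of volume at most \<open>\<eta> / 5^n\<close>, Vitali's lemma selects
  disjoint balls whose fivefold enlargements cover \<open>N\<close>. This explains the bounds
  \<open>\<delta> / 5\<close> and \<open>\<eta> / 5 ^ n\<close>.\<close>

lemma negligible_cball_cover:
  fixes N :: "'a::euclidean_space set"
  assumes N: "negligible N" and "0 < \<delta>" "0 < \<eta>"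
  obtains c r where "N \<subseteq> (\<Union>j::nat. cball (c j) (r j))" "\<And>j. r j \<le> \<delta>"
    "(\<Sum>j. emeasure lborel (cball (c j) (r j))) \<le> ennreal \<eta>"
proof -
  define n where "n = DIM('a)"
  have NL: "N \<in> sets lebesgue" "emeasure lebesgue N = 0"
    using N negligible_imp_sets negligible_iff_emeasure0 by blast+
  define \<epsilon> where "\<epsilon> = \<eta> / 5 ^ n"
  have "0 < \<epsilon>" using assms by (simp add: \<epsilon>_def)
  obtain U where U: "open U" "N \<subseteq> U" "U - N \<in> lmeasurable" "emeasure lebesgue (U - N) < ennreal \<epsilon>"
    using sets_lebesgue_outer_open[OF NL(1) \<open>0 < \<epsilon>\<close>] .
  have "emeasure lebesgue U \<le> emeasure lebesgue (U - N) + emeasure lebesgue N"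
    using U NL by (intro order_trans[OF emeasure_mono[of U "(U - N) \<union> N"] emeasure_subadditive]) auto
  then have mU: "emeasure lborel U \<le> ennreal \<epsilon>" using U NL by (simp add: borel_open)
  define K where "K = {(x::'a, r). x \<in> N \<and> 0 < r \<and> r \<le> \<delta> / 5 \<and> cball x r \<subseteq> U}"
  have cov: "N \<subseteq> (\<Union>i\<in>K. cball (fst i) (snd i))"
  proof
    fix x assume x: "x \<in> N"
    obtain e where e: "0 < e" "cball x e \<subseteq> U" using U x open_contains_cball by blast
    have "(x, min e (\<delta>/5)) \<in> K" using e assms x by (auto simp: K_def subset_eq)
    then show "x \<in> (\<Union>i\<in>K. cball (fst i) (snd i))" using e assms by (intro UN_I[of "(x, min e (\<delta>/5))"]) auto
  qed
  have Kr: "0 < snd i \<and> snd i \<le> \<delta> / 5" if "i \<in> K" for i using that by (auto simp: K_def)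
  obtain C where C: "countable C" "C \<subseteq> K"
    "pairwise (\<lambda>i j. disjnt (cball (fst i) (snd i)) (cball (fst j) (snd j))) C"
    "N \<subseteq> (\<Union>i\<in>C. cball (fst i) (5 * snd i))"
    by (rule Vitali_covering_lemma_cballs[OF cov Kr]) (assumption | rule that; assumption)+
  obtain c r where cr: "(\<Union>i\<in>C. cball (fst i) (5 * snd i)) = (\<Union>j::nat. cball (c j) (r j))"
    "\<And>j. r j \<in> (\<lambda>i. 5 * snd i) ` C \<union> {-1}"
    "(\<Sum>j. emeasure lborel (cball (c j) (r j))) = (\<integral>\<^sup>+i. emeasure lborel (cball (fst i) (5 * snd i)) \<partial>count_space C)"
    by (rule cball_family_sequence[OF C(1), of fst "\<lambda>i. 5 * snd i"]) (rule that; assumption)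
  have "(\<integral>\<^sup>+i. emeasure lborel (cball (fst i) (5 * snd i)) \<partial>count_space C)
      = (\<integral>\<^sup>+i. ennreal (5 ^ n) * emeasure lborel (cball (fst i) (snd i)) \<partial>count_space C)"
  proof (rule nn_integral_cong)
    fix i assume "i \<in> space (count_space C)"
    then have "0 < snd i" using C(2) by (auto simp: K_def)
    then show "emeasure lborel (cball (fst i) (5 * snd i)) = ennreal (5 ^ n) * emeasure lborel (cball (fst i) (snd i))"
      by (simp add: emeasure_cball n_def power_mult_distrib ennreal_mult[symmetric] mult_ac)
  qed
  also have "\<dots> = ennreal (5 ^ n) * (\<integral>\<^sup>+i. emeasure lborel (cball (fst i) (snd i)) \<partial>count_space C)"
    by (simp add: nn_integral_cmult)
  also have "\<dots> \<le> ennreal (5 ^ n) * ennreal \<epsilon>"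
  proof (intro mult_left_mono order_trans[OF disjoint_cballs_measure_le[OF C(1,3) U(1)] mU])
    show "(\<Union>i\<in>C. cball (fst i) (snd i)) \<subseteq> U" using C(2) by (fastforce simp: K_def)
  qed simp
  also have "\<dots> = ennreal \<eta>" using \<open>0 < \<epsilon>\<close> by (simp add: ennreal_mult[symmetric] \<epsilon>_def)
  finally have "(\<Sum>j. emeasure lborel (cball (c j) (r j))) \<le> ennreal \<eta>" using cr(3) by simp
  moreover have "r j \<le> \<delta>" for j
    using cr(2)[of j] C(2) assms by (auto simp: K_def)
  ultimately show ?thesis using C(4) cr(1) by (intro that[of c r]) auto
qed

text \<open>Vitali's theorem fills an open superset up to a null set with disjoint balls, whose
  volumes add up to no more than that of the superset. The null set left over is covered
  separately.\<close>

lemma lebesgue_cball_cover: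
  fixes W :: "'a::euclidean_space set"
  assumes W: "W \<in> sets lebesgue" and fin: "emeasure lebesgue W < top" and "0 < \<delta>" "0 < \<eta>"
  obtains c r where "W \<subseteq> (\<Union>j::nat. cball (c j) (r j))" "\<And>j. r j \<le> \<delta>"
    "(\<Sum>j. emeasure lborel (cball (c j) (r j))) \<le> emeasure lebesgue W + ennreal \<eta>"
proof -
  obtain U where U: "open U" "W \<subseteq> U" "U - W \<in> lmeasurable" "emeasure lebesgue (U - W) < ennreal (\<eta>/2)"
    using sets_lebesgue_outer_open[OF W, of "\<eta>/2"] assms by auto
  have "emeasure lebesgue U \<le> emeasure lebesgue W + emeasure lebesgue (U - W)"
    using U W by (intro order_trans[OF emeasure_mono[of U "W \<union> (U - W)"] emeasure_subadditive]) auto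
  then have mU: "emeasure lborel U \<le> emeasure lebesgue W + ennreal (\<eta>/2)"
    using U by (simp add: borel_open) (meson add_left_mono less_imp_le order_trans)
  define K where "K = {(x::'a, r). 0 < r \<and> r \<le> \<delta> \<and> cball x r \<subseteq> U}"
  have fine: "\<exists>i. i \<in> K \<and> x \<in> cball (fst i) (snd i) \<and> snd i < d" if x: "x \<in> U" "0 < d" for x d
  proof -
    obtain e where e: "0 < e" "cball x e \<subseteq> U" using U x open_contains_cball by blast
    have "(x, min e (min \<delta> (d/2))) \<in> K" using e assms that by (auto simp: K_def subset_eq)
    then show ?thesis using e assms that by (intro exI[of _ "(x, min e (min \<delta> (d/2)))"]) auto
  qed
  have Kr: "0 < snd i" if "i \<in> K" for i using that by (auto simp: K_def)
  obtain C where C: "countable C" "C \<subseteq> K"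
    "pairwise (\<lambda>i j. disjnt (cball (fst i) (snd i)) (cball (fst j) (snd j))) C"
    "negligible (U - (\<Union>i\<in>C. cball (fst i) (snd i)))"
    by (rule Vitali_covering_theorem_cballs[OF Kr fine]) (assumption | rule that; assumption)+
  obtain c1 r1 where 1: "(\<Union>i\<in>C. cball (fst i) (snd i)) = (\<Union>j::nat. cball (c1 j) (r1 j))"
    "\<And>j. r1 j \<in> snd ` C \<union> {-1}"
    "(\<Sum>j. emeasure lborel (cball (c1 j) (r1 j))) = (\<integral>\<^sup>+i. emeasure lborel (cball (fst i) (snd i)) \<partial>count_space C)"
    by (rule cball_family_sequence[OF C(1), of fst snd]) (rule that; assumption)
  have s1: "(\<Sum>j. emeasure lborel (cball (c1 j) (r1 j))) \<le> emeasure lebesgue W + ennreal (\<eta>/2)"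
    unfolding 1(3) using C(2) by (intro order_trans[OF disjoint_cballs_measure_le[OF C(1,3) U(1)] mU]) (fastforce simp: K_def)
  obtain c2 r2 where 2: "U - (\<Union>i\<in>C. cball (fst i) (snd i)) \<subseteq> (\<Union>j::nat. cball (c2 j) (r2 j))" "\<And>j. r2 j \<le> \<delta>"
    "(\<Sum>j. emeasure lborel (cball (c2 j) (r2 j))) \<le> ennreal (\<eta>/2)"
    by (rule negligible_cball_cover[OF C(4) \<open>0 < \<delta>\<close> half_gt_zero[OF \<open>0 < \<eta>\<close>]]) (rule that; assumption)
  \<comment> \<open>Row 0 is the Vitali family, row 1 the cover of the null set; all further rows
    are empty balls.\<close>
  define cc where "cc = (\<lambda>(k::nat, j). if k = 0 then c1 j else c2 j)"
  define rr where "rr = (\<lambda>(k::nat, j). if k = 0 then r1 j else if k = 1 then r2 j else -1)"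
  define c where "c = cc \<circ> prod_decode"
  define r where "r = rr \<circ> prod_decode"
  let ?f = "\<lambda>i. emeasure lborel (cball (cc i) (rr i))"
  have "(\<Sum>j. emeasure lborel (cball (c j) (r j))) = (\<Sum>k. \<Sum>j. ?f (k, j))"
    using suminf_ennreal_2dimen[of "\<lambda>k. \<Sum>j. ?f (k, j)" ?f] by (simp add: c_def r_def comp_def)
  also have "\<dots> = (\<Sum>k\<in>{0,1}. \<Sum>j. ?f (k, j))"
    by (rule suminf_finite) (auto simp: rr_def)
  also have "\<dots> = (\<Sum>j. emeasure lborel (cball (c1 j) (r1 j))) + (\<Sum>j. emeasure lborel (cball (c2 j) (r2 j)))"
    by (simp add: cc_def rr_def)
  also have "\<dots> \<le> emeasure lebesgue W + ennreal (\<eta>/2) + ennreal (\<eta>/2)"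
    by (intro add_mono s1 2)
  also have "\<dots> = emeasure lebesgue W + ennreal \<eta>"
    using assms by (simp add: add.assoc ennreal_plus[symmetric] del: ennreal_plus)
  finally have s: "(\<Sum>j. emeasure lborel (cball (c j) (r j))) \<le> emeasure lebesgue W + ennreal \<eta>" .
  have "r1 j \<le> \<delta>" for j using 1(2)[of j] C(2) assms by (auto simp: K_def)
  then have rd: "r j \<le> \<delta>" for j using 2(2) assms by (auto simp: r_def rr_def split: prod.split)
  have "W \<subseteq> (\<Union>j. cball (c j) (r j))"
  proof
    fix x assume "x \<in> W"
    then have "x \<in> (\<Union>j. cball (c1 j) (r1 j)) \<or> x \<in> (\<Union>j. cball (c2 j) (r2 j))"
      using U(2) 2(1) unfolding 1(1)[symmetric] by blast
    then obtain j where "x \<in> cball (cc (0, j)) (rr (0, j)) \<or> x \<in> cball (cc (1, j)) (rr (1, j))"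
      by (auto simp: cc_def rr_def)
    then obtain k where "x \<in> cball (cc (k, j)) (rr (k, j))" by blast
    then show "x \<in> (\<Union>j. cball (c j) (r j))"
      by (intro UN_I[of "prod_encode (k, j)"]) (auto simp: c_def r_def)
  qed
  with rd s show ?thesis by (intro that[of c r])
qed

section \<open>Averaging over the slices of a ball cover\<close>

lemma nn_integral_ball_slices:
  fixes h r :: real
  assumes "0 \<le> r"
  shows "(\<integral>\<^sup>+\<tau>. indicator {h - r..h + r} \<tau> * ennreal (unit_ball_vol (real s) * sqrt (r\<^sup>2 - (\<tau> - h)\<^sup>2) ^ s) \<partial>lborel)
    \<le> ennreal (unit_ball_vol (real (Suc s)) * r ^ Suc s)"
\<comment> \<open>The affine substitution degenerates for \<open>r = 0\<close>, but then the
  integrand is supported at a single point.\<close>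
proof (cases "r = 0")
  case True
  have "AE \<tau> in lborel. indicator {h - r..h + r} \<tau> * ennreal (unit_ball_vol (real s) * sqrt (r\<^sup>2 - (\<tau> - h)\<^sup>2) ^ s) = 0"
    using AE_lborel_singleton[of h] by eventually_elim (auto simp: True indicator_def)
  then have "(\<integral>\<^sup>+\<tau>. indicator {h - r..h + r} \<tau> * ennreal (unit_ball_vol (real s) * sqrt (r\<^sup>2 - (\<tau> - h)\<^sup>2) ^ s) \<partial>lborel) = 0"
    by (subst nn_integral_0_iff_AE) auto
  then show ?thesis by simp
next
  case False
  with assms have r: "0 < r" by simp
  have "(\<integral>\<^sup>+\<tau>. indicator {h - r..h + r} \<tau> * ennreal (unit_ball_vol (real s) * sqrt (r\<^sup>2 - (\<tau> - h)\<^sup>2) ^ s) \<partial>lborel)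
      = ennreal \<bar>r\<bar> * (\<integral>\<^sup>+t. indicator {h - r..h + r} (h + r * t) * ennreal (unit_ball_vol (real s) * sqrt (r\<^sup>2 - (h + r * t - h)\<^sup>2) ^ s) \<partial>lborel)"
    using r by (intro nn_integral_real_affine) auto
  also have "\<dots> = ennreal r * (\<integral>\<^sup>+t. ennreal (unit_ball_vol (real s) * r ^ s) * (indicator {-1..1} t * ennreal (sqrt (1 - t\<^sup>2) ^ s)) \<partial>lborel)"
  proof -
    have "indicator {h - r..h + r} (h + r * t) * ennreal (unit_ball_vol (real s) * sqrt (r\<^sup>2 - (h + r * t - h)\<^sup>2) ^ s)
        = ennreal (unit_ball_vol (real s) * r ^ s) * (indicator {-1..1} t * ennreal (sqrt (1 - t\<^sup>2) ^ s))" for t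
    proof (cases "t \<in> {-1..1}")
      case True
      have "r * t \<in> {-r..r}" using True r mult_left_mono[of t 1 r] mult_left_mono[of "-1" t r] by auto
      moreover have "sqrt (r\<^sup>2 - (h + r * t - h)\<^sup>2) = r * sqrt (1 - t\<^sup>2)"
      proof -
        have "r\<^sup>2 - (h + r * t - h)\<^sup>2 = r\<^sup>2 * (1 - t\<^sup>2)" by (simp add: power2_eq_square algebra_simps)
        then show ?thesis using r by (simp add: real_sqrt_mult)
      qed
      moreover have "0 \<le> sqrt (1 - t\<^sup>2)" using True by (simp add: abs_square_le_1 abs_le_iff)
      ultimately show ?thesis
        using True r by (simp add: power_mult_distrib ennreal_mult[symmetric] mult.assoc)
    next
      case False
      then have "r * t \<notin> {-r..r}"
        using r by (metis atLeastAtMost_iff mult_le_cancel_left_pos mult.right_neutral mult_minus_right)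
      then show ?thesis using False by (auto simp: indicator_def)
    qed
    then show ?thesis using r by simp
  qed
  also have "\<dots> = ennreal r * (ennreal (unit_ball_vol (real s) * r ^ s) * ennreal (unit_ball_vol (real (Suc s)) / unit_ball_vol (real s)))"
    by (subst nn_integral_cmult) (simp_all add: nn_integral_half_ball_power del: of_nat_Suc)
  also have "\<dots> = ennreal (unit_ball_vol (real (Suc s)) * r ^ Suc s)"
  proof -
    have "0 < unit_ball_vol (real s)" by simp
    then show ?thesis
      using r by (simp add: ennreal_mult[symmetric] mult_ac del: of_nat_Suc unit_ball_vol_pos)
  qed
  finally show ?thesis by simp
qed


text \<open>Every height \<open>\<tau>\<close> of a ball cover of \<open>W\<close> yields a cover of \<open>F\<close> by slices of the balls; averaging
  over \<open>\<tau>\<close> turns the total gauge of the slices into the total volume of the balls.\<close>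

lemma hausdorff_hyperplane_le:
  fixes F W :: "'a::euclidean_space set"
  assumes u: "u \<bullet> u = 1" and F: "\<And>x. x \<in> F \<Longrightarrow> u \<bullet> x = 0" and ab: "a < b"
    and W: "W \<in> sets lebesgue" "emeasure lebesgue W < top"
    and sub: "\<And>x \<tau>. x \<in> F \<Longrightarrow> a < \<tau> \<Longrightarrow> \<tau> < b \<Longrightarrow> x + \<tau> *\<^sub>R u \<in> W"
  shows "ennreal (b - a) * hausdorff_outer (DIM('a) - 1) F \<le> emeasure lebesgue W"
proof -
  define s where "s = DIM('a) - 1"
  have n: "DIM('a) = Suc s" by (simp add: s_def)
  have *: "ennreal (b - a) * hausdorff_pre s \<delta> F \<le> emeasure lebesgue W" if \<delta>: "0 < \<delta>" for \<delta>
  proof (rule ennreal_le_epsilon)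
    fix \<eta> :: real assume \<eta>: "0 < \<eta>"
    \<comment> \<open>Radii up to \<open>\<delta> / 2\<close> make every slice an admissible
      covering set.\<close>
    obtain c r where cr: "W \<subseteq> (\<Union>j::nat. cball (c j) (r j))" "\<And>j. r j \<le> \<delta> / 2"
      "(\<Sum>j. emeasure lborel (cball (c j) (r j))) \<le> emeasure lebesgue W + ennreal \<eta>"
      using lebesgue_cball_cover[OF W, of "\<delta>/2" \<eta>] \<delta> \<eta> by auto
    define g where "g j \<tau> = indicator {u \<bullet> c j - r j..u \<bullet> c j + r j} \<tau> *
        ennreal (unit_ball_vol (real s) * sqrt ((r j)\<^sup>2 - (\<tau> - u \<bullet> c j)\<^sup>2) ^ s)" for j \<tau>
    have [measurable]: "g j \<in> borel_measurable borel" for j unfolding g_def by measurable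
    have slice: "hausdorff_pre s \<delta> F \<le> (\<Sum>j. g j \<tau>)" if \<tau>: "a < \<tau>" "\<tau> < b" for \<tau>
    proof -
      \<comment> \<open>Slices at height \<open>\<tau>\<close>, moved back into \<open>F\<close>. By
        Pythagoras each lies within \<open>\<rho> j\<close> of the projected centre.\<close>
      define C where "C j = {x\<in>F. x + \<tau> *\<^sub>R u \<in> cball (c j) (r j)}" for j
      define \<rho> where "\<rho> j = sqrt ((r j)\<^sup>2 - (\<tau> - u \<bullet> c j)\<^sup>2)" for j
      have C: "\<bar>\<tau> - u \<bullet> c j\<bar> \<le> r j \<and> norm (x - (c j - (u \<bullet> c j) *\<^sub>R u)) \<le> \<rho> j" if x: "x \<in> C j" for x j
      proof -
        define v where "v = x + \<tau> *\<^sub>R u - c j"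
        have v: "norm v \<le> r j" using x by (simp add: C_def v_def dist_norm norm_minus_commute)
        have uv: "u \<bullet> v = \<tau> - u \<bullet> c j" using x F[of x] u by (simp add: v_def C_def inner_diff_right inner_add_right)
        have dec: "norm v ^ 2 = norm (v - (u \<bullet> v) *\<^sub>R u)^2 + (u \<bullet> v)^2"
          using norm_orth_decomp[OF u, of v "u \<bullet> v"] by simp
        have "v - (u \<bullet> v) *\<^sub>R u = x - (c j - (u \<bullet> c j) *\<^sub>R u)" unfolding uv by (simp add: v_def algebra_simps)
        moreover have "norm v ^ 2 \<le> (r j)^2" using v by (simp add: power_mono)
        ultimately have "norm (x - (c j - (u \<bullet> c j) *\<^sub>R u))^2 \<le> (r j)^2 - (\<tau> - u \<bullet> c j)^2"
          using dec uv by simp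
        then have "norm (x - (c j - (u \<bullet> c j) *\<^sub>R u)) \<le> \<rho> j" unfolding \<rho>_def by (rule real_le_rsqrt)
        moreover have "\<bar>u \<bullet> v\<bar> \<le> norm v"
          using Cauchy_Schwarz_ineq2[of u v] u by (simp add: norm_eq_sqrt_inner)
        ultimately show ?thesis using v uv by simp
      qed
      have dC: "dist x y \<le> 2 * \<rho> j" if "x \<in> C j" "y \<in> C j" for x y j
        using C[OF that(1)] C[OF that(2)] dist_triangle2[of x y "c j - (u \<bullet> c j) *\<^sub>R u"] by (simp add: dist_norm)
      have dC': "dist x y \<le> \<delta>" if xy: "x \<in> C j" "y \<in> C j" for x y j
      proof -
        have "dist (x + \<tau> *\<^sub>R u) (y + \<tau> *\<^sub>R u) \<le> r j + r j"
          using xy by (intro order_trans[OF dist_triangle2[of _ _ "c j"] add_mono]) (auto simp: C_def dist_commute)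
        then show ?thesis using cr(2)[of j] by simp
      qed
      have bC: "bounded (C j)" for j using dC' by (auto simp: bounded_two_points)
      have "delta_cover \<delta> F C"
        unfolding delta_cover_def
      proof (intro conjI allI bC)
        show "F \<subseteq> (\<Union>j. C j)" using cr(1) sub \<tau> by (fastforce simp: C_def)
        show "diameter (C j) \<le> \<delta>" for j using \<delta> dC' by (intro diameter_le_dist) auto
      qed
      then have "hausdorff_pre s \<delta> F \<le> (\<Sum>j. ennreal (hausdorff_gauge s (C j)))" by (rule hausdorff_pre_le)
      also have "\<dots> \<le> (\<Sum>j. g j \<tau>)"
      proof (rule suminf_le)
        fix j
        show "ennreal (hausdorff_gauge s (C j)) \<le> g j \<tau>"
        proof (cases "C j = {}")
          case False
          then obtain x where x: "x \<in> C j" by blast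
          have "0 \<le> \<rho> j" using C[OF x] norm_ge_zero order_trans by blast
          then have "hausdorff_gauge s (C j) \<le> unit_ball_vol (real s) * \<rho> j ^ s"
            using dC bC by (intro hausdorff_gauge_le) auto
          moreover have "\<tau> \<in> {u \<bullet> c j - r j..u \<bullet> c j + r j}" using C[OF x] by auto
          ultimately show ?thesis by (simp add: g_def \<rho>_def ennreal_leI)
        qed simp
      qed auto
      finally show ?thesis .
    qed
    have "ennreal (b - a) * hausdorff_pre s \<delta> F = (\<integral>\<^sup>+\<tau>. hausdorff_pre s \<delta> F * indicator {a<..<b} \<tau> \<partial>lborel)"
      using ab by (simp add: nn_integral_cmult_indicator mult.commute)
    also have "\<dots> \<le> (\<integral>\<^sup>+\<tau>. (\<Sum>j. g j \<tau>) \<partial>lborel)"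
      using slice by (intro nn_integral_mono) (auto simp: indicator_def)
    also have "\<dots> = (\<Sum>j. \<integral>\<^sup>+\<tau>. g j \<tau> \<partial>lborel)" by (rule nn_integral_suminf) measurable
    also have "\<dots> \<le> (\<Sum>j. emeasure lborel (cball (c j) (r j)))"
    proof (rule suminf_le)
      fix j
      show "(\<integral>\<^sup>+\<tau>. g j \<tau> \<partial>lborel) \<le> emeasure lborel (cball (c j) (r j))"
      proof (cases "0 \<le> r j")
        case True
        then show ?thesis unfolding g_def emeasure_cball[OF True] n by (rule nn_integral_ball_slices)
      next
        case False
        then show ?thesis by (simp add: g_def)
      qed
    qed auto
    also have "\<dots> \<le> emeasure lebesgue W + ennreal \<eta>" by (rule cr)
    finally show "ennreal (b - a) * hausdorff_pre s \<delta> F \<le> emeasure lebesgue W + ennreal \<eta>" .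
  qed
  have "hausdorff_outer s F \<le> ennreal (1 / (b - a)) * emeasure lebesgue W"
  proof (rule hausdorff_outer_least)
    fix \<delta> :: real assume "0 < \<delta>"
    have "ennreal (1 / (b - a)) * (ennreal (b - a) * hausdorff_pre s \<delta> F) \<le> ennreal (1 / (b - a)) * emeasure lebesgue W"
      by (intro mult_left_mono * \<open>0 < \<delta>\<close>) simp
    then show "hausdorff_pre s \<delta> F \<le> ennreal (1 / (b - a)) * emeasure lebesgue W"
      using ab by (simp add: mult.assoc[symmetric] ennreal_mult[symmetric])
  qed
  then have "ennreal (b - a) * hausdorff_outer s F \<le> ennreal (b - a) * (ennreal (1 / (b - a)) * emeasure lebesgue W)"
    by (rule mult_left_mono) simp
  then show ?thesis
    using ab by (simp add: mult.assoc[symmetric] ennreal_mult[symmetric] s_def)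
qed

text \<open>A ball of radius \<open>r\<close> meets only levels of \<open>p\<close> within
  \<open>L * r\<close> of that of its centre. A ball cover of the cone with small total volume thus
  yields covers of the scaled copies \<open>\<tau> Z\<close> whose total gauge, averaged over
  \<open>\<tau>\<close>, is small. This averaging stands in for a coarea inequality.\<close>

lemma hausdorff_outer_cone_null:
  fixes Z :: "'a::euclidean_space set" and p :: "'a \<Rightarrow> real"
  assumes L: "0 < L" and lip: "\<And>x y. \<bar>p x - p y\<bar> \<le> L * norm (x - y)"
    and hom: "\<And>c x. 0 \<le> c \<Longrightarrow> p (c *\<^sub>R x) = c * p x"
    and Z: "\<And>x. x \<in> Z \<Longrightarrow> p x = 1"
    and null: "negligible {\<tau> *\<^sub>R x | \<tau> x. x \<in> Z \<and> 0 < \<tau> \<and> \<tau> \<le> 1}"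
  shows "hausdorff_outer (DIM('a) - 1) Z = 0"
proof -
  define s where "s = DIM('a) - 1"
  have n: "DIM('a) = Suc s" by (simp add: s_def)
  \<comment> \<open>The gauge bound \<open>unit_ball_vol s * (2 * r) ^ s\<close> of one slice, times
    the length \<open>2 * L * r\<close> of its interval of levels, divided by the volume of the
    ball.\<close>
  define \<kappa> where "\<kappa> = unit_ball_vol (real s) * 2 ^ s * (2 * L) / unit_ball_vol (real (Suc s))"
  have \<omega>: "0 < unit_ball_vol (real s)" "0 < unit_ball_vol (real (Suc s))" by simp_all
  then have \<kappa>: "0 < \<kappa>" using L by (simp add: \<kappa>_def del: of_nat_Suc)
  have "hausdorff_pre s \<delta> Z \<le> 0" if \<delta>: "0 < \<delta>" for \<delta>
  proof (rule ennreal_le_epsilon)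
    fix e :: real assume e: "0 < e"
    \<comment> \<open>The levels fill an interval of length 1/2, whence the factor 2.\<close>
    define \<eta> where "\<eta> = e / (2 * \<kappa>)"
    have \<eta>: "0 < \<eta>" using e \<kappa> by (simp add: \<eta>_def)
    obtain c r where cr: "{\<tau> *\<^sub>R x | \<tau> x. x \<in> Z \<and> 0 < \<tau> \<and> \<tau> \<le> 1} \<subseteq> (\<Union>j::nat. cball (c j) (r j))" "\<And>j. r j \<le> \<delta> / 4"
      "(\<Sum>j. emeasure lborel (cball (c j) (r j))) \<le> ennreal \<eta>"
      using negligible_cball_cover[OF null, of "\<delta>/4" \<eta>] \<delta> \<eta> by auto
    define g where "g j \<tau> = (if 0 \<le> r j then ennreal (unit_ball_vol (real s) * (2 * r j) ^ s) else 0)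
        * indicator {p (c j) - L * r j..p (c j) + L * r j} \<tau>" for j \<tau>
    have [measurable]: "g j \<in> borel_measurable borel" for j unfolding g_def by measurable
    have slice: "hausdorff_pre s \<delta> Z \<le> (\<Sum>j. g j \<tau>)" if \<tau>: "1/2 < \<tau>" "\<tau> < 1" for \<tau>
    proof -
      define C where "C j = {x\<in>Z. \<tau> *\<^sub>R x \<in> cball (c j) (r j)}" for j
      \<comment> \<open>Dividing by \<open>\<tau> > 1/2\<close> at most doubles a slice, so radii up
        to \<open>\<delta> / 4\<close> give diameters up to \<open>\<delta>\<close>.\<close>
      have dC: "dist x y \<le> 2 * (2 * r j)" if xy: "x \<in> C j" "y \<in> C j" for x y j
      proof -
        have "\<tau> * dist x y = dist (\<tau> *\<^sub>R x) (\<tau> *\<^sub>R y)"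
          using \<tau> by (simp add: dist_norm scaleR_diff_right[symmetric] del: scaleR_diff_right)
        also have "\<dots> \<le> r j + r j"
          using xy by (intro order_trans[OF dist_triangle2[of _ _ "c j"] add_mono]) (auto simp: C_def dist_commute)
        finally have "\<tau> * dist x y \<le> 2 * r j" by simp
        moreover have "(1/2) * dist x y \<le> \<tau> * dist x y" using \<tau> by (intro mult_right_mono) auto
        ultimately show ?thesis by simp
      qed
      have bC: "bounded (C j)" for j using dC by (auto simp: bounded_two_points)
      have "delta_cover \<delta> Z C"
        unfolding delta_cover_def
      proof (intro conjI allI bC)
        show "Z \<subseteq> (\<Union>j. C j)"
        proof
          fix x assume x: "x \<in> Z"
          then have "\<tau> *\<^sub>R x \<in> {\<tau> *\<^sub>R x | \<tau> x. x \<in> Z \<and> 0 < \<tau> \<and> \<tau> \<le> 1}" using \<tau> by force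
          then obtain j where "\<tau> *\<^sub>R x \<in> cball (c j) (r j)" using cr(1) by blast
          then show "x \<in> (\<Union>j. C j)" using x by (auto simp: C_def)
        qed
        show "diameter (C j) \<le> \<delta>" for j
        proof (rule diameter_le_dist)
          show "dist x y \<le> \<delta>" if "x \<in> C j" "y \<in> C j" for x y using dC[OF that] cr(2)[of j] by linarith
        qed (use \<delta> in simp)
      qed
      then have "hausdorff_pre s \<delta> Z \<le> (\<Sum>j. ennreal (hausdorff_gauge s (C j)))" by (rule hausdorff_pre_le)
      also have "\<dots> \<le> (\<Sum>j. g j \<tau>)"
      proof (rule suminf_le)
        fix j
        show "ennreal (hausdorff_gauge s (C j)) \<le> g j \<tau>"
        proof (cases "C j = {}")
          case False
          then obtain x where x: "x \<in> C j" by blast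
          then have xb: "norm (\<tau> *\<^sub>R x - c j) \<le> r j" by (simp add: C_def dist_norm norm_minus_commute)
          then have r: "0 \<le> r j" using norm_ge_zero order_trans by blast
          then have "hausdorff_gauge s (C j) \<le> unit_ball_vol (real s) * (2 * r j) ^ s"
            using dC bC by (intro hausdorff_gauge_le) auto
          moreover have "\<bar>\<tau> - p (c j)\<bar> \<le> L * r j"
          proof -
            have "p (\<tau> *\<^sub>R x) = \<tau>" using hom[of \<tau> x] Z[of x] x \<tau> by (simp add: C_def)
            then have "\<bar>\<tau> - p (c j)\<bar> \<le> L * norm (\<tau> *\<^sub>R x - c j)" using lip[of "\<tau> *\<^sub>R x" "c j"] by simp
            also have "\<dots> \<le> L * r j" using L xb by (intro mult_left_mono) auto
            finally show ?thesis .
          qed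
          then have "\<tau> \<in> {p (c j) - L * r j..p (c j) + L * r j}" by auto
          ultimately show ?thesis using r by (simp add: g_def ennreal_leI)
        qed simp
      qed auto
      finally show ?thesis .
    qed
    have "ennreal (1/2) * hausdorff_pre s \<delta> Z = (\<integral>\<^sup>+\<tau>. hausdorff_pre s \<delta> Z * indicator {1/2<..<1::real} \<tau> \<partial>lborel)"
      by (subst nn_integral_cmult_indicator) (simp_all add: mult.commute)
    also have "\<dots> \<le> (\<integral>\<^sup>+\<tau>. (\<Sum>j. g j \<tau>) \<partial>lborel)"
      using slice by (intro nn_integral_mono) (auto simp: indicator_def)
    also have "\<dots> = (\<Sum>j. \<integral>\<^sup>+\<tau>. g j \<tau> \<partial>lborel)" by (rule nn_integral_suminf) measurable
    also have "\<dots> = (\<Sum>j. ennreal \<kappa> * emeasure lborel (cball (c j) (r j)))"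
    proof (rule suminf_cong)
      fix j
      show "(\<integral>\<^sup>+\<tau>. g j \<tau> \<partial>lborel) = ennreal \<kappa> * emeasure lborel (cball (c j) (r j))"
      proof (cases "0 \<le> r j")
        case True
        have "(\<integral>\<^sup>+\<tau>. g j \<tau> \<partial>lborel) = ennreal (unit_ball_vol (real s) * (2 * r j) ^ s) * ennreal (2 * (L * r j))"
          unfolding g_def using True L by (subst nn_integral_cmult_indicator) auto
        also have "\<dots> = ennreal (unit_ball_vol (real s) * (2 * r j) ^ s * (2 * (L * r j)))"
          using True L by (intro ennreal_mult[symmetric]) auto
        also have "unit_ball_vol (real s) * (2 * r j) ^ s * (2 * (L * r j)) = \<kappa> * (unit_ball_vol (real (Suc s)) * r j ^ Suc s)"
          using \<omega> by (simp add: \<kappa>_def power_mult_distrib field_simps del: of_nat_Suc unit_ball_vol_pos)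
        also have "ennreal \<dots> = ennreal \<kappa> * emeasure lborel (cball (c j) (r j))"
          unfolding emeasure_cball[OF True] n using \<kappa> True \<omega> by (intro ennreal_mult) (auto simp del: of_nat_Suc)
        finally show ?thesis .
      next
        case False
        then show ?thesis by (simp add: g_def)
      qed
    qed
    also have "\<dots> = ennreal \<kappa> * (\<Sum>j. emeasure lborel (cball (c j) (r j)))" by simp
    also have "\<dots> \<le> ennreal \<kappa> * ennreal \<eta>" by (intro mult_left_mono cr) simp
    also have "\<dots> = ennreal (e / 2)" using \<kappa> \<eta> by (simp add: ennreal_mult[symmetric] \<eta>_def)
    finally have "ennreal 2 * (ennreal (1/2) * hausdorff_pre s \<delta> Z) \<le> ennreal 2 * ennreal (e / 2)"
      by (rule mult_left_mono) simp
    moreover have "ennreal 2 * (ennreal (1/2) * hausdorff_pre s \<delta> Z) = hausdorff_pre s \<delta> Z"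
    proof -
      have "ennreal 2 * ennreal (1/2) = ennreal (2 * (1/2))" by (rule ennreal_mult[symmetric]) auto
      then show ?thesis by (simp only: mult.assoc[symmetric]) simp
    qed
    moreover have "ennreal 2 * ennreal (e / 2) = ennreal e" using e by (subst ennreal_mult[symmetric]) auto
    ultimately show "hausdorff_pre s \<delta> Z \<le> 0 + ennreal e" by (simp only: add_0)
  qed
  then have "hausdorff_outer s Z \<le> 0" by (rule hausdorff_outer_least)
  then show ?thesis by (simp add: s_def)
qed

section \<open>Gauge functions and their smooth points\<close>

definition second_quot :: "('a::euclidean_space \<Rightarrow> real) \<Rightarrow> 'a \<Rightarrow> real \<Rightarrow> 'a \<Rightarrow> real" where
  "second_quot f i t x = (f (x + t *\<^sub>R i) + f (x - t *\<^sub>R i) - 2 * f x) / t"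

text \<open>For convex \<open>f\<close> the second quotient is nonnegative and decreases as the step
  shrinks; its limit is the jump of the directional derivative along \<open>i\<close>. Countably
  many conditions, along the axes only, keep the set Borel, and for convex \<open>f\<close> it is
  exactly the set of differentiability.\<close>

definition smooth_points :: "('a::euclidean_space \<Rightarrow> real) \<Rightarrow> 'a set" where
  "smooth_points f = {x. \<forall>i\<in>Basis. \<forall>m::nat. \<exists>k::nat. second_quot f i (1 / real (Suc k)) x < 1 / real (Suc m)}"

text \<open>Using \<open>lim\<close> along the steps \<open>1 / (k + 1)\<close> makes this a Borel
  function on the whole space; for convex \<open>f\<close> its components are right derivatives,
  also at kinks.\<close>

definition grad :: "('a::euclidean_space \<Rightarrow> real) \<Rightarrow> 'a \<Rightarrow> 'a" where
  "grad f x = (\<Sum>i\<in>Basis. lim (\<lambda>k. (f (x + (1 / real (Suc k)) *\<^sub>R i) - f x) * real (Suc k)) *\<^sub>R i)"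

lemma second_quot_measurable:
  assumes "continuous_on UNIV f"
  shows "second_quot f i t \<in> borel_measurable borel"
  unfolding second_quot_def divide_inverse
  by (intro borel_measurable_continuous_onI continuous_intros continuous_on_compose2[OF assms]) auto

lemma smooth_points_borel:
  assumes "continuous_on UNIV f"
  shows "smooth_points f \<in> sets borel"
proof -
  note [measurable] = second_quot_measurable[OF assms]
  have "smooth_points f = (\<Inter>i\<in>Basis. \<Inter>m. \<Union>k. {x. second_quot f i (1 / real (Suc k)) x < 1 / real (Suc m)})"
    by (auto simp: smooth_points_def)
  also have "\<dots> \<in> sets borel" by (intro sets.countable_INT'' sets.countable_UN'' sets.finite_INT) auto
  finally show ?thesis .
qed

lemma grad_measurable:
  assumes "continuous_on UNIV f"
  shows "grad f \<in> borel_measurable borel"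
  unfolding grad_def
proof (intro borel_measurable_sum borel_measurable_scaleR borel_measurable_const borel_measurable_lim_metric)
  fix i :: 'a and k :: nat
  show "(\<lambda>x. (f (x + (1 / real (Suc k)) *\<^sub>R i) - f x) * real (Suc k)) \<in> borel_measurable borel"
    by (intro borel_measurable_continuous_onI continuous_intros continuous_on_compose2[OF assms]) auto
qed

text \<open>Along a progression with step \<open>t\<close> the second differences telescope, so at most boundedly many
  of its points can carry a kink of a given size.\<close>

lemma negligible_nonsmooth_points:
  fixes f :: "'a::euclidean_space \<Rightarrow> real"
  assumes conv: "convex_on UNIV f" and lip: "\<And>x y. \<bar>f x - f y\<bar> \<le> L * norm (x - y)"
  shows "negligible (- smooth_points f)"
proof -
  have Lnn: "0 \<le> L"
  proof -
    obtain b :: 'a where "b \<in> Basis" using nonempty_Basis by blast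
    then show ?thesis using lip[of b 0] by (simp add: order_trans[OF abs_ge_zero])
  qed
  have cont: "continuous_on UNIV f"
    by (rule lipschitz_on_continuous_on[of L], rule lipschitz_onI) (use lip Lnn in \<open>auto simp: dist_norm\<close>)
  note [measurable] = second_quot_measurable[OF cont]
  \<comment> \<open>Points whose jump along \<open>i\<close> is at least
    \<open>1 / (m + 1)\<close>.\<close>
  define N where "N i m = {x. \<forall>k::nat. 1 / real (Suc m) \<le> second_quot f i (1 / real (Suc k)) x}" for i :: 'a and m :: nat
  have [measurable]: "N i m \<in> sets borel" for i m unfolding N_def by measurable
  have null: "negligible (N i m)" if i: "i \<in> Basis" for i m
  proof -
    have ball0: "emeasure lborel (N i m \<inter> ball 0 (real R)) = 0" for R :: nat
    proof -
      \<comment> \<open>The shifts below have length at most 1, which the enlarged ball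
        absorbs.\<close>
      define V where "V = measure lborel (ball (0::'a) (real R + 1))"
      have V: "emeasure lborel (ball (0::'a) (real R + 1)) = ennreal V"
        unfolding V_def using emeasure_lborel_ball_finite[of "0::'a" "real R + 1"]
        by (intro emeasure_eq_ennreal_measure) (auto simp: less_top)
      have "ennreal (real (Suc k)) * emeasure lborel (N i m \<inter> ball 0 (real R)) \<le> ennreal (2 * L * real (Suc m) * V)" for k
      proof -
        define t where "t = 1 / real (Suc k)"
        have t: "0 < t" "real (Suc k) * t = 1" by (auto simp: t_def)
        have count: "(\<Sum>j<Suc k. indicator (N i m) (x + (real j * t) *\<^sub>R i)) \<le> 2 * L * real (Suc m)" for x
        proof -
          \<comment> \<open>Increments of \<open>f\<close> along the progression. Subtraction in
            \<open>real\<close> lets \<open>h 0\<close> reach one step behind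
            \<open>x\<close>.\<close>
          define h where "h j = f (x + (real j * t) *\<^sub>R i) - f (x + ((real j - 1) * t) *\<^sub>R i)" for j :: nat
          have h: "\<bar>h j\<bar> \<le> L * t" for j
          proof -
            have "(x + (real j * t) *\<^sub>R i) - (x + ((real j - 1) * t) *\<^sub>R i) = t *\<^sub>R i" by (simp add: algebra_simps)
            then show ?thesis
              using lip[of "x + (real j * t) *\<^sub>R i" "x + ((real j - 1) * t) *\<^sub>R i"] i t by (simp add: h_def)
          qed
          have ind: "indicator (N i m) (x + (real j * t) *\<^sub>R i) \<le> real (Suc m) / t * (h (Suc j) - h j)" for j
          proof -
            define y where "y = x + (real j * t) *\<^sub>R i"
            have e: "y + t *\<^sub>R i = x + (real (Suc j) * t) *\<^sub>R i" "y - t *\<^sub>R i = x + ((real j - 1) * t) *\<^sub>R i"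
              by (simp_all add: y_def algebra_simps)
            have "h (Suc j) = f (y + t *\<^sub>R i) - f y" "h j = f y - f (y - t *\<^sub>R i)"
              unfolding h_def e by (simp_all add: y_def)
            then have eq: "second_quot f i t y = (h (Suc j) - h j) / t"
              unfolding second_quot_def by simp
            have "f y \<le> (1/2) * f (y + t *\<^sub>R i) + (1/2) * f (y - t *\<^sub>R i)"
              using convex_onD[OF conv, of "1/2" "y + t *\<^sub>R i" "y - t *\<^sub>R i"]
              by (simp add: algebra_simps flip: scaleR_left_distrib)
            then have "0 \<le> second_quot f i t y" using t by (simp add: second_quot_def)
            moreover have "1 \<le> real (Suc m) * second_quot f i t y" if "y \<in> N i m"
              using that by (auto simp: N_def t_def divide_le_eq mult.commute dest!: spec[of _ k])
            ultimately have "indicator (N i m) y \<le> real (Suc m) * second_quot f i t y"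
              by (auto simp: indicator_def)
            then show ?thesis unfolding eq by (simp add: y_def)
          qed
          have "(\<Sum>j<Suc k. indicator (N i m) (x + (real j * t) *\<^sub>R i)) \<le> (\<Sum>j<Suc k. real (Suc m) / t * (h (Suc j) - h j))"
            by (intro sum_mono ind)
          also have "\<dots> = real (Suc m) / t * (h (Suc k) - h 0)"
            unfolding sum_distrib_left[symmetric] sum_lessThan_telescope ..
          also have "\<dots> \<le> real (Suc m) / t * (2 * (L * t))"
            using h[of "Suc k"] h[of 0] t by (intro mult_left_mono) auto
          also have "\<dots> = 2 * L * real (Suc m)" using t by simp
          finally show ?thesis .
        qed
        let ?B = "ball (0::'a) (real R + 1)"
        have [measurable]: "?B \<in> sets borel" by (simp add: borel_open)
        have shift: "emeasure lborel (N i m \<inter> ball 0 (real R)) \<le> (\<integral>\<^sup>+x. ennreal (indicator (N i m) (x + (real j * t) *\<^sub>R i)) * indicator ?B x \<partial>lborel)"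
          if j: "j < Suc k" for j
        proof -
          have "emeasure lborel (N i m \<inter> ball 0 (real R)) = (\<integral>\<^sup>+x. indicator (N i m \<inter> ball 0 (real R)) x \<partial>lborel)"
            by (simp add: borel_open)
          also have "\<dots> = (\<integral>\<^sup>+x. indicator (N i m \<inter> ball 0 (real R)) ((real j * t) *\<^sub>R i + x) \<partial>lborel)"
            by (intro nn_integral_lborel_shift[symmetric] borel_measurable_indicator sets.Int) (auto simp: borel_open)
          also have "\<dots> \<le> (\<integral>\<^sup>+x. ennreal (indicator (N i m) (x + (real j * t) *\<^sub>R i)) * indicator ?B x \<partial>lborel)"
          proof (rule nn_integral_mono)
            fix x :: 'a
            have "real j * t \<le> 1" using j t by (simp add: t_def)
            moreover have "norm x \<le> norm ((real j * t) *\<^sub>R i + x) + norm ((real j * t) *\<^sub>R i)"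
              using norm_triangle_ineq4[of "(real j * t) *\<^sub>R i + x" "(real j * t) *\<^sub>R i"] by simp
            ultimately have "x \<in> ?B" if "(real j * t) *\<^sub>R i + x \<in> ball 0 (real R)" using that i t by (simp add: mem_ball_0)
            then show "indicator (N i m \<inter> ball 0 (real R)) ((real j * t) *\<^sub>R i + x)
                \<le> ennreal (indicator (N i m) (x + (real j * t) *\<^sub>R i)) * indicator ?B x"
              by (auto simp: indicator_def add.commute)
          qed
          finally show ?thesis .
        qed
        \<comment> \<open>All \<open>k + 1\<close> translates have the same mass, while their
          indicators add up to at most \<open>2 * L * (m + 1)\<close> at each point. The bound does
          not depend on \<open>k\<close>, so the mass is zero.\<close>
        have "ennreal (real (Suc k)) * emeasure lborel (N i m \<inter> ball 0 (real R))
            = (\<Sum>j<Suc k. emeasure lborel (N i m \<inter> ball 0 (real R)))"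
          by (simp add: ennreal_of_nat_eq_real_of_nat del: sum.lessThan_Suc)
        also have "\<dots> \<le> (\<Sum>j<Suc k. \<integral>\<^sup>+x. ennreal (indicator (N i m) (x + (real j * t) *\<^sub>R i)) * indicator ?B x \<partial>lborel)"
          by (intro sum_mono shift) simp
        also have "\<dots> = (\<integral>\<^sup>+x. (\<Sum>j<Suc k. ennreal (indicator (N i m) (x + (real j * t) *\<^sub>R i)) * indicator ?B x) \<partial>lborel)"
          by (rule nn_integral_sum[symmetric]) measurable
        also have "\<dots> \<le> (\<integral>\<^sup>+x. ennreal (2 * L * real (Suc m)) * indicator ?B x \<partial>lborel)"
        proof (rule nn_integral_mono)
          fix x :: 'a
          have "(\<Sum>j<Suc k. ennreal (indicator (N i m) (x + (real j * t) *\<^sub>R i)) * indicator ?B x)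
              = ennreal (\<Sum>j<Suc k. indicator (N i m) (x + (real j * t) *\<^sub>R i)) * indicator ?B x"
            unfolding sum_distrib_right[symmetric] by (subst sum_ennreal) auto
          also have "\<dots> \<le> ennreal (2 * L * real (Suc m)) * indicator ?B x"
            by (intro mult_right_mono ennreal_leI count) simp
          finally show "(\<Sum>j<Suc k. ennreal (indicator (N i m) (x + (real j * t) *\<^sub>R i)) * indicator ?B x)
              \<le> ennreal (2 * L * real (Suc m)) * indicator ?B x" .
        qed
        also have "\<dots> = ennreal (2 * L * real (Suc m)) * ennreal V"
          by (subst nn_integral_cmult_indicator) (auto simp: V borel_open)
        also have "\<dots> = ennreal (2 * L * real (Suc m) * V)"
          using Lnn by (intro ennreal_mult[symmetric]) (auto simp: V_def)
        finally show ?thesis .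
      qed
      note bound = this
      have "emeasure lborel (N i m \<inter> ball 0 (real R)) < top"
        by (rule le_less_trans[OF emeasure_mono emeasure_lborel_ball_finite[of 0 "real R", unfolded infinity_ennreal_def]]) (auto simp: borel_open)
      then obtain v where v: "emeasure lborel (N i m \<inter> ball 0 (real R)) = ennreal v" "0 \<le> v"
        by (cases "emeasure lborel (N i m \<inter> ball 0 (real R))") auto
      have le: "real (Suc k) * v \<le> 2 * L * real (Suc m) * V" for k
      proof -
        have "ennreal (real (Suc k) * v) \<le> ennreal (2 * L * real (Suc m) * V)"
          using bound[of k] v by (simp add: ennreal_mult del: of_nat_Suc)
        moreover have "0 \<le> 2 * L * real (Suc m) * V" using Lnn by (auto simp: V_def)
        ultimately show ?thesis by (simp add: ennreal_le_iff del: of_nat_Suc)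
      qed
      have "v = 0"
      proof (rule ccontr)
        assume "v \<noteq> 0"
        then have "0 < v" using v by simp
        then obtain k :: nat where "2 * L * real (Suc m) * V < real k * v" using reals_Archimedean3 by blast
        then show False using le[of k] \<open>0 < v\<close> by (simp add: algebra_simps)
      qed
      then show ?thesis using v by simp
    qed
    have "N i m = (\<Union>R. N i m \<inter> ball 0 (real R))"
      by (auto simp: dist_norm) (use reals_Archimedean2 in blast)
    moreover have "emeasure lborel (\<Union>R. N i m \<inter> ball 0 (real R)) = 0"
      by (rule emeasure_UN_eq_0) (auto simp: ball0)
    ultimately show ?thesis by (simp add: negligible_iff_emeasure0)
  qed
  have "- smooth_points f = (\<Union>i\<in>Basis. \<Union>m. N i m)"
    by (simp add: set_eq_iff smooth_points_def N_def not_less)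
  then show ?thesis using null by (auto intro!: negligible_Union negligible_Union_nat)
qed

text \<open>Lets the single small step provided by \<open>smooth_points\<close> control all shorter
  steps.\<close>

lemma second_quot_mono:
  assumes conv: "convex_on UNIV f" and "0 < s" "s \<le> t"
  shows "second_quot f i s x \<le> second_quot f i t x"
proof -
  have *: "f (x + s *\<^sub>R v) \<le> f x + (s / t) * (f (x + t *\<^sub>R v) - f x)" for v
  proof -
    have "f ((1 - s / t) *\<^sub>R x + (s / t) *\<^sub>R (x + t *\<^sub>R v)) \<le> (1 - s / t) * f x + (s / t) * f (x + t *\<^sub>R v)"
      using assms by (intro convex_onD[OF conv]) auto
    moreover have "(1 - s / t) *\<^sub>R x + (s / t) *\<^sub>R (x + t *\<^sub>R v) = x + s *\<^sub>R v"
      using assms by (simp add: algebra_simps)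
    ultimately have "f (x + s *\<^sub>R v) \<le> (1 - s / t) * f x + (s / t) * f (x + t *\<^sub>R v)" by (simp only:)
    then show ?thesis by (simp add: algebra_simps)
  qed
  have "f (x + s *\<^sub>R i) + f (x - s *\<^sub>R i) - 2 * f x \<le> (s / t) * (f (x + t *\<^sub>R i) + f (x - t *\<^sub>R i) - 2 * f x)"
  proof -
    have "f (x + s *\<^sub>R i) + f (x - s *\<^sub>R i) - 2 * f x
        \<le> (s / t) * (f (x + t *\<^sub>R i) - f x) + (s / t) * (f (x - t *\<^sub>R i) - f x)"
      using *[of i] *[of "- i"] by simp
    also have "\<dots> = (s / t) * (f (x + t *\<^sub>R i) + f (x - t *\<^sub>R i) - 2 * f x)"
      unfolding distrib_left[symmetric] by simp
    finally show ?thesis .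
  qed
  then show ?thesis using assms by (simp add: second_quot_def field_simps)
qed

text \<open>Forward quotients of a convex function fall as the step shrinks and stay above every
  backward quotient, so they converge. The two inequalities say that the limit is a subgradient
  along the axis.\<close>

lemma tendsto_grad_component:
  fixes f :: "'a::euclidean_space \<Rightarrow> real"
  assumes conv: "convex_on UNIV f" and i: "i \<in> Basis"
  shows "(\<lambda>k. (f (x + (1 / real (Suc k)) *\<^sub>R i) - f x) * real (Suc k)) \<longlonglongrightarrow> grad f x \<bullet> i"
    and "0 < t \<Longrightarrow> t * (grad f x \<bullet> i) \<le> f (x + t *\<^sub>R i) - f x"
    and "0 < t \<Longrightarrow> - (t * (grad f x \<bullet> i)) \<le> f (x - t *\<^sub>R i) - f x"
proof -
  define q where "q t = (f (x + t *\<^sub>R i) - f x) / t" for t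
  have mono: "q s \<le> q t" if "0 < s" "s \<le> t" for s t
  proof -
    have "f ((1 - s / t) *\<^sub>R x + (s / t) *\<^sub>R (x + t *\<^sub>R i)) \<le> (1 - s / t) * f x + (s / t) * f (x + t *\<^sub>R i)"
      using that by (intro convex_onD[OF conv]) auto
    moreover have "(1 - s / t) *\<^sub>R x + (s / t) *\<^sub>R (x + t *\<^sub>R i) = x + s *\<^sub>R i"
      using that by (simp add: algebra_simps)
    ultimately show ?thesis using that by (simp add: q_def field_simps)
  qed
  have low: "- ((f (x - t *\<^sub>R i) - f x) / t) \<le> q s" if "0 < s" "0 < t" for s t
  proof -
    have "f ((1 - s / (s + t)) *\<^sub>R (x + s *\<^sub>R i) + (s / (s + t)) *\<^sub>R (x - t *\<^sub>R i)) \<le> (1 - s / (s + t)) * f (x + s *\<^sub>R i) + (s / (s + t)) * f (x - t *\<^sub>R i)"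
      using that by (intro convex_onD[OF conv]) auto
    moreover have "(1 - s / (s + t)) *\<^sub>R (x + s *\<^sub>R i) + (s / (s + t)) *\<^sub>R (x - t *\<^sub>R i) = x"
    proof -
      define \<alpha> where "\<alpha> = s / (s + t)"
      have "(1 - \<alpha>) * s - \<alpha> * t = 0" using that by (simp add: \<alpha>_def field_simps)
      moreover have "(1 - \<alpha>) *\<^sub>R (x + s *\<^sub>R i) + \<alpha> *\<^sub>R (x - t *\<^sub>R i) = x + ((1 - \<alpha>) * s - \<alpha> * t) *\<^sub>R i"
        by (simp add: algebra_simps)
      ultimately show ?thesis by (simp add: \<alpha>_def)
    qed
    ultimately have "(s + t) * f x \<le> (s + t) * ((1 - s / (s + t)) * f (x + s *\<^sub>R i) + (s / (s + t)) * f (x - t *\<^sub>R i))"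
      using that by (intro mult_left_mono) auto
    also have "\<dots> = ((s + t) * (1 - s / (s + t))) * f (x + s *\<^sub>R i) + ((s + t) * (s / (s + t))) * f (x - t *\<^sub>R i)"
      by (simp only: distrib_left mult.assoc)
    also have "\<dots> = t * f (x + s *\<^sub>R i) + s * f (x - t *\<^sub>R i)"
    proof -
      have "(s + t) * (1 - s / (s + t)) = t" "(s + t) * (s / (s + t)) = s" using that by (simp_all add: field_simps)
      then show ?thesis by (simp only:)
    qed
    finally show ?thesis using that by (simp add: q_def field_simps)
  qed
  let ?X = "\<lambda>k. q (1 / real (Suc k))"
  have "decseq ?X" unfolding decseq_def by (intro allI impI mono) (auto simp: frac_le)
  moreover have "\<And>k. - ((f (x - 1 *\<^sub>R i) - f x) / 1) \<le> ?X k" by (rule low) auto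
  ultimately obtain l where l: "?X \<longlonglongrightarrow> l" "\<And>k. l \<le> ?X k" using decseq_convergent by blast
  have X: "(\<lambda>k. (f (x + (1 / real (Suc k)) *\<^sub>R i) - f x) * real (Suc k)) = ?X" by (auto simp: q_def)
  then have gl: "grad f x \<bullet> i = l" using i l(1) by (simp add: grad_def X limI)
  show "(\<lambda>k. (f (x + (1 / real (Suc k)) *\<^sub>R i) - f x) * real (Suc k)) \<longlonglongrightarrow> grad f x \<bullet> i"
    unfolding X gl by (rule l)
  assume t: "0 < t"
  obtain k :: nat where "1 / real (Suc k) < t" using nat_approx_posE[OF t] by blast
  then have "l \<le> q t" using l(2)[of k] mono[of "1 / real (Suc k)" t] by simp
  then show "t * (grad f x \<bullet> i) \<le> f (x + t *\<^sub>R i) - f x" unfolding gl using t by (simp add: q_def field_simps)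
  have "- ((f (x - t *\<^sub>R i) - f x) / t) \<le> l"
    by (rule LIMSEQ_le_const[OF l(1)]) (use low t in auto)
  then show "- (t * (grad f x \<bullet> i)) \<le> f (x - t *\<^sub>R i) - f x" unfolding gl using t by (simp add: field_simps)
qed

text \<open>The excess \<open>\<psi>\<close> over the linear part is convex. It is small along the
  axes by the second quotient, Jensen's inequality spreads this to all directions, and convexity at
  0 turns the upper bound into a lower one.\<close>

lemma smooth_point_has_derivative:
  fixes f :: "'a::euclidean_space \<Rightarrow> real"
  assumes conv: "convex_on UNIV f" and x: "x \<in> smooth_points f"
  shows "(f has_derivative (\<lambda>v. grad f x \<bullet> v)) (at x)"
proof -
  define n where "n = real DIM('a)"
  have n: "1 \<le> n" by (simp add: n_def Suc_leI)
  define \<psi> where "\<psi> v = f (x + v) - f x - grad f x \<bullet> v" for v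
  have convex\<psi>: "convex_on UNIV \<psi>"
  proof (rule convex_onI)
    fix t :: real and a b :: 'a assume t: "0 < t" "t < 1"
    have "f ((1 - t) *\<^sub>R (x + a) + t *\<^sub>R (x + b)) \<le> (1 - t) * f (x + a) + t * f (x + b)"
      using t by (intro convex_onD[OF conv]) auto
    moreover have "(1 - t) *\<^sub>R (x + a) + t *\<^sub>R (x + b) = x + ((1 - t) *\<^sub>R a + t *\<^sub>R b)" by (simp add: algebra_simps)
    ultimately show "\<psi> ((1 - t) *\<^sub>R a + t *\<^sub>R b) \<le> (1 - t) * \<psi> a + t * \<psi> b"
      by (simp add: \<psi>_def algebra_simps inner_add_right inner_diff_right)
  qed simp
  have main: "\<exists>d>0. \<forall>v. norm v < d \<longrightarrow> \<psi> v \<le> e * norm v" if e: "0 < e" for e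
  proof -
    have "\<exists>k. \<forall>c. \<bar>c\<bar> \<le> 1 / real (Suc k) \<longrightarrow> \<psi> (c *\<^sub>R i) \<le> (e / n) * \<bar>c\<bar>" if i: "i \<in> Basis" for i
    proof -
      obtain m :: nat where m: "1 / real (Suc m) < e / n" using nat_approx_posE[of "e / n"] e n by auto
      obtain k where k: "second_quot f i (1 / real (Suc k)) x < 1 / real (Suc m)" using x i by (auto simp: smooth_points_def)
      have "\<psi> (c *\<^sub>R i) \<le> (e / n) * \<bar>c\<bar>" if c: "\<bar>c\<bar> \<le> 1 / real (Suc k)" for c
      proof (cases "c = 0")
        case False
        define t where "t = \<bar>c\<bar>"
        have t: "0 < t" using False by (simp add: t_def)
        have "second_quot f i t x \<le> second_quot f i (1 / real (Suc k)) x"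
          using c t by (intro second_quot_mono[OF conv]) (auto simp: t_def)
        then have "second_quot f i t x \<le> e / n" using k m by linarith
        then have W: "f (x + t *\<^sub>R i) + f (x - t *\<^sub>R i) - 2 * f x \<le> (e / n) * t"
          using t by (simp add: second_quot_def divide_le_eq)
        \<comment> \<open>The values of \<open>\<psi>\<close> on both sides of 0 add up to the
          second difference, and the opposite one is nonnegative by the subgradient
          inequality.\<close>
        have "\<psi> (t *\<^sub>R i) \<le> (e / n) * t"
          using W tendsto_grad_component(3)[OF conv i t, of x] by (simp add: \<psi>_def algebra_simps)
        moreover have "\<psi> ((- t) *\<^sub>R i) \<le> (e / n) * t"
          using W tendsto_grad_component(2)[OF conv i t, of x] by (simp add: \<psi>_def algebra_simps)
        ultimately show ?thesis unfolding t_def by (cases "0 \<le> c") auto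
      qed (simp add: \<psi>_def)
      then show ?thesis by blast
    qed
    then obtain k where k: "\<And>i c. i \<in> Basis \<Longrightarrow> \<bar>c\<bar> \<le> 1 / real (Suc (k i)) \<Longrightarrow> \<psi> (c *\<^sub>R i) \<le> (e / n) * \<bar>c\<bar>"
      by metis
    define d where "d = Min ((\<lambda>i. 1 / real (Suc (k i))) ` (Basis::'a set)) / n"
    have dpos: "0 < d" using n by (simp add: d_def)
    have "\<psi> v \<le> e * norm v" if v: "norm v < d" for v
    proof -
      \<comment> \<open>\<open>v\<close> is the mean of \<open>n\<close> axis vectors, each
        \<open>n\<close> times a component of \<open>v\<close>; for this reason \<open>d\<close> was
        divided by \<open>n\<close>.\<close>
      have "\<psi> (\<Sum>i\<in>Basis. (1 / n) *\<^sub>R ((n * (v \<bullet> i)) *\<^sub>R i)) \<le> (\<Sum>i\<in>Basis. (1 / n) * \<psi> ((n * (v \<bullet> i)) *\<^sub>R i))"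
        using n by (intro convex_on_sum[OF _ _ convex\<psi>]) (auto simp: n_def)
      also have "(\<Sum>i\<in>Basis. (1 / n) *\<^sub>R ((n * (v \<bullet> i)) *\<^sub>R i)) = v" using n by (simp add: euclidean_representation)
      also have "(\<Sum>i\<in>Basis. (1 / n) * \<psi> ((n * (v \<bullet> i)) *\<^sub>R i)) \<le> (\<Sum>i\<in>(Basis::'a set). (1 / n) * ((e / n) * (n * norm v)))"
      proof (intro sum_mono mult_left_mono)
        fix i :: 'a assume i: "i \<in> Basis"
        have vi: "\<bar>n * (v \<bullet> i)\<bar> \<le> n * norm v" using Basis_le_norm[OF i, of v] n by (simp add: abs_mult)
        also have "\<dots> \<le> n * d" using v n by (intro mult_left_mono) auto
        also have "\<dots> \<le> 1 / real (Suc (k i))" using n i by (simp add: d_def)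
        finally have "\<psi> ((n * (v \<bullet> i)) *\<^sub>R i) \<le> (e / n) * \<bar>n * (v \<bullet> i)\<bar>" by (rule k[OF i])
        also have "\<dots> \<le> (e / n) * (n * norm v)" using vi e n by (intro mult_left_mono) auto
        finally show "\<psi> ((n * (v \<bullet> i)) *\<^sub>R i) \<le> (e / n) * (n * norm v)" .
      qed (use n in simp)
      also have "\<dots> = e * norm v" using n by (simp add: n_def)
      finally show ?thesis .
    qed
    with dpos show ?thesis by blast
  qed
  show ?thesis
    unfolding has_derivative_at_alt
  proof (intro conjI allI impI bounded_linear_inner_right)
    fix e :: real assume "0 < e"
    then obtain d where d: "0 < d" "\<And>v. norm v < d \<Longrightarrow> \<psi> v \<le> e * norm v" using main by blast
    have "norm (f y - f x - grad f x \<bullet> (y - x)) \<le> e * norm (y - x)" if "norm (y - x) < d" for y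
    proof -
      have "\<psi> 0 \<le> (1/2) * \<psi> (y - x) + (1/2) * \<psi> (- (y - x))"
        using convex_onD[OF convex\<psi>, of "1/2" "y - x" "- (y - x)"] by (simp add: algebra_simps)
      moreover have "\<psi> 0 = 0" by (simp add: \<psi>_def)
      ultimately have "- \<psi> (y - x) \<le> \<psi> (- (y - x))" by linarith
      also have "\<dots> \<le> e * norm (y - x)" using d(2)[of "- (y - x)"] that by (simp add: norm_minus_commute)
      finally have "\<bar>\<psi> (y - x)\<bar> \<le> e * norm (y - x)" using d(2)[OF that] by (simp add: abs_le_iff)
      then show ?thesis by (simp add: \<psi>_def)
    qed
    with d(1) show "\<exists>d>0. \<forall>y. norm (y - x) < d \<longrightarrow> norm (f y - f x - grad f x \<bullet> (y - x)) \<le> e * norm (y - x)" by blast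
  qed
qed

text \<open>The converse, through which invariance properties of derivatives carry over to
  \<open>smooth_points\<close> and \<open>grad\<close>.\<close>

lemma has_derivative_smooth_point:
  fixes f :: "'a::euclidean_space \<Rightarrow> real"
  assumes "(f has_derivative (\<lambda>v. g \<bullet> v)) (at x)"
  shows "x \<in> smooth_points f" and "grad f x = g"
proof -
  have lim: "(\<lambda>k. (f (x + (1 / real (Suc k)) *\<^sub>R v) - f x) * real (Suc k)) \<longlonglongrightarrow> g \<bullet> v" for v
  proof -
    have 0: "(\<lambda>t. (f (x + t *\<^sub>R v) - f x) / t) \<midarrow>0\<rightarrow> g \<bullet> v"
    proof -
      have "((\<lambda>t. f (x + t *\<^sub>R v)) has_derivative (\<lambda>t. g \<bullet> (t *\<^sub>R v))) (at 0)"
        by (rule has_derivative_compose[of "\<lambda>t. x + t *\<^sub>R v" _ 0 UNIV f "\<lambda>v. g \<bullet> v"])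
           (auto intro!: derivative_eq_intros simp: assms)
      then have "((\<lambda>t. f (x + t *\<^sub>R v)) has_real_derivative (g \<bullet> v)) (at 0)"
        by (simp add: has_field_derivative_def mult.commute[of _ "g \<bullet> v"])
      then show ?thesis by (simp add: has_field_derivative_iff)
    qed
    have "(\<lambda>k. (f (x + (1 / real (Suc k)) *\<^sub>R v) - f x) / (1 / real (Suc k))) \<longlonglongrightarrow> g \<bullet> v"
    proof (rule filterlim_compose[OF 0])
      have "(\<lambda>k. 1 / real (Suc k)) \<longlonglongrightarrow> 0" using LIMSEQ_inverse_real_of_nat by (simp only: inverse_eq_divide)
      then show "filterlim (\<lambda>k. 1 / real (Suc k)) (at 0) sequentially" by (simp add: filterlim_at del: of_nat_Suc)
    qed
    then show ?thesis by (simp add: divide_inverse[of _ "inverse _"] mult.commute)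
  qed
  have "grad f x = (\<Sum>i\<in>Basis. (g \<bullet> i) *\<^sub>R i)"
    unfolding grad_def by (intro sum.cong refl) (simp only: limI[OF lim])
  then show "grad f x = g" by (simp add: euclidean_representation)
  have "\<exists>k. second_quot f i (1 / real (Suc k)) x < 1 / real (Suc m)" for i m
  proof -
    have "(\<lambda>k. (f (x + (1 / real (Suc k)) *\<^sub>R i) - f x) * real (Suc k) + (f (x + (1 / real (Suc k)) *\<^sub>R (- i)) - f x) * real (Suc k)) \<longlonglongrightarrow> g \<bullet> i + g \<bullet> (- i)"
      by (intro tendsto_add lim)
    then have "(\<lambda>k. second_quot f i (1 / real (Suc k)) x) \<longlonglongrightarrow> 0"
      by (simp add: second_quot_def algebra_simps)
    then have "\<forall>\<^sub>F k in sequentially. second_quot f i (1 / real (Suc k)) x < 1 / real (Suc m)"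
      by (rule order_tendstoD(2)) simp
    then show ?thesis by (auto simp: eventually_sequentially)
  qed
  then show "x \<in> smooth_points f" by (simp add: smooth_points_def)
qed

section \<open>The gauge of a convex body and its gradient\<close>

definition minkowski_gauge :: "'a::real_normed_vector set \<Rightarrow> 'a \<Rightarrow> real" where
  "minkowski_gauge K x = Inf {s. 0 < s \<and> (1 / s) *\<^sub>R x \<in> K}"

text \<open>The explicit inner radius makes the gauge Lipschitz with constant
  \<open>1 / \<rho>\<close>. The locale is used for the body itself and for the intersection bodies,
  where the radius is halved.\<close>

locale centered_body =
  fixes K :: "'a::euclidean_space set" and \<rho> :: real
  assumes compact_K: "compact K" and convex_K: "convex K"
    and \<rho>_pos: "0 < \<rho>" and cball_K: "cball 0 \<rho> \<subseteq> K"
begin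

definition p :: "'a \<Rightarrow> real" where "p = minkowski_gauge K"

lemma zero_in_K: "0 \<in> K"
  using cball_K \<rho>_pos by (auto simp: subset_eq)

lemma scale_in_K: "x \<in> K \<Longrightarrow> 0 \<le> c \<Longrightarrow> c \<le> 1 \<Longrightarrow> c *\<^sub>R x \<in> K"
  using convexD[OF convex_K zero_in_K, of x "1 - c" c] by simp

text \<open>The admissible scales form an up-set because \<open>K\<close> is star-shaped about 0,
  and their infimum is attained because \<open>K\<close> is closed. Most facts about
  \<open>p\<close> rest on this equivalence.\<close>

lemma gauge_le_iff:
  assumes "0 < s"
  shows "p x \<le> s \<longleftrightarrow> (1 / s) *\<^sub>R x \<in> K"
proof
  let ?S = "{s. 0 < s \<and> (1 / s) *\<^sub>R x \<in> K}"
  have bdd: "bdd_below ?S" by (intro bdd_belowI[of _ 0]) auto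
  have ne: "?S \<noteq> {}"
  proof -
    \<comment> \<open>The summand 1 keeps the scale positive at \<open>x = 0\<close>.\<close>
    define t where "t = norm x / \<rho> + 1"
    have t: "0 < t" using \<rho>_pos by (simp add: t_def add_nonneg_pos)
    have "norm x \<le> \<rho> * t" using \<rho>_pos by (simp add: t_def field_simps)
    then have "(1 / t) *\<^sub>R x \<in> cball 0 \<rho>" using t by (simp add: field_simps)
    then have "t \<in> ?S" using t cball_K by blast
    then show ?thesis by blast
  qed
  show "p x \<le> s" if "(1 / s) *\<^sub>R x \<in> K"
    unfolding p_def minkowski_gauge_def using that assms by (intro cInf_lower bdd) auto
  assume ps: "p x \<le> s"
  have t_in: "(1 / t) *\<^sub>R x \<in> K" if "s < t" for t
  proof -
    have "Inf ?S < t" using ps that by (simp add: p_def minkowski_gauge_def)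
    then obtain r where r: "r \<in> ?S" "r < t" using cInf_lessD[OF ne] by blast
    then show ?thesis using scale_in_K[of "(1 / r) *\<^sub>R x" "r / t"] by simp
  qed
  have "(\<lambda>k. (1 / (s + 1 / real (Suc k))) *\<^sub>R x) \<longlonglongrightarrow> (1 / (s + 0)) *\<^sub>R x"
    using assms by (intro tendsto_intros LIMSEQ_inverse_real_of_nat[unfolded inverse_eq_divide]) auto
  then show "(1 / s) *\<^sub>R x \<in> K"
    using closed_sequentially[OF compact_imp_closed[OF compact_K], of "\<lambda>k. (1 / (s + 1 / real (Suc k))) *\<^sub>R x"] t_in
    by simp
qed

lemma gauge_nonneg: "0 \<le> p x"
proof (rule ccontr)
  assume "\<not> 0 \<le> p x"
  then have neg: "p x < 0" by simp
  let ?S = "{s. 0 < s \<and> (1 / s) *\<^sub>R x \<in> K}"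
  have ne: "?S \<noteq> {}"
  proof -
    have "p x \<le> 1" using neg by simp
    then have "1 \<in> ?S" using gauge_le_iff[of 1 x] by simp
    then show ?thesis by blast
  qed
  then have "0 \<le> Inf ?S" by (intro cInf_greatest) auto
  then show False using neg by (simp add: p_def minkowski_gauge_def)
qed

lemma gauge_le_norm: "p x \<le> norm x / \<rho>"
proof (cases "x = 0")
  case True
  have "p x \<le> e" if "0 < e" for e using gauge_le_iff[OF that, of x] zero_in_K True by simp
  then have "p x \<le> 0" by (meson field_le_epsilon add_0 not_le dense)
  then show ?thesis by (simp add: True)
next
  case False
  then have s: "0 < norm x / \<rho>" using \<rho>_pos by simp
  have "(1 / (norm x / \<rho>)) *\<^sub>R x \<in> cball 0 \<rho>" using False \<rho>_pos by simp
  then show ?thesis using gauge_le_iff[OF s, of x] cball_K by blast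
qed

lemma gauge_zero [simp]: "p 0 = 0"
  using gauge_le_norm[of 0] gauge_nonneg[of 0] by simp

lemma eq_by_upper_bounds:
  fixes a b :: real
  assumes "0 \<le> a" "0 \<le> b" "\<And>s. 0 < s \<Longrightarrow> a \<le> s \<longleftrightarrow> b \<le> s"
  shows "a = b"
proof (rule ccontr)
  assume "a \<noteq> b"
  then have "0 < (a + b) / 2" "a \<le> (a + b) / 2 \<longleftrightarrow> \<not> b \<le> (a + b) / 2" using assms(1,2) by auto
  with assms(3)[of "(a + b) / 2"] show False by blast
qed

lemma gauge_scale: "0 \<le> c \<Longrightarrow> p (c *\<^sub>R x) = c * p x"
proof (cases "c = 0")
  case False
  assume "0 \<le> c"
  with False have c: "0 < c" by simp
  show ?thesis
  proof (rule eq_by_upper_bounds)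
    fix s :: real assume s: "0 < s"
    have "p (c *\<^sub>R x) \<le> s \<longleftrightarrow> (1 / s) *\<^sub>R (c *\<^sub>R x) \<in> K" by (rule gauge_le_iff[OF s])
    also have "(1 / s) *\<^sub>R (c *\<^sub>R x) = (1 / (s / c)) *\<^sub>R x" by simp
    also have "\<dots> \<in> K \<longleftrightarrow> p x \<le> s / c" using gauge_le_iff[of "s / c" x] s c by simp
    also have "\<dots> \<longleftrightarrow> c * p x \<le> s" using c by (simp add: field_simps)
    finally show "p (c *\<^sub>R x) \<le> s \<longleftrightarrow> c * p x \<le> s" .
  qed (use c gauge_nonneg in auto)
qed simp

lemma gauge_add: "p (x + y) \<le> p x + p y"
proof (rule field_le_epsilon)
  fix e :: real assume e: "0 < e"
  define s where "s = p x + e / 2"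
  define t where "t = p y + e / 2"
  have st: "0 < s" "0 < t" using gauge_nonneg e by (auto simp: s_def t_def add_nonneg_pos)
  have "(1 / s) *\<^sub>R x \<in> K" "(1 / t) *\<^sub>R y \<in> K"
    using gauge_le_iff[OF st(1), of x] gauge_le_iff[OF st(2), of y] e by (auto simp: s_def t_def)
  then have "(s / (s + t)) *\<^sub>R ((1 / s) *\<^sub>R x) + (t / (s + t)) *\<^sub>R ((1 / t) *\<^sub>R y) \<in> K"
    using st by (intro convexD[OF convex_K]) (auto simp: add_divide_distrib[symmetric])
  then have "(1 / (s + t)) *\<^sub>R (x + y) \<in> K" using st by (simp add: scaleR_add_right)
  then have "p (x + y) \<le> s + t" using gauge_le_iff[of "s + t" "x + y"] st by simp
  then show "p (x + y) \<le> p x + p y + e" by (simp add: s_def t_def)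
qed

lemma gauge_lipschitz: "\<bar>p x - p y\<bar> \<le> (1 / \<rho>) * norm (x - y)"
  using gauge_add[of "x - y" y] gauge_add[of "y - x" x] gauge_le_norm[of "x - y"] gauge_le_norm[of "y - x"]
  by (simp add: norm_minus_commute abs_le_iff)

lemma gauge_continuous: "continuous_on UNIV p"
  by (rule lipschitz_on_continuous_on[of "1 / \<rho>"], rule lipschitz_onI)
     (use gauge_lipschitz \<rho>_pos in \<open>auto simp: dist_norm\<close>)

lemma gauge_measurable [measurable]: "p \<in> borel_measurable borel"
  by (rule borel_measurable_continuous_onI[OF gauge_continuous])

lemma gauge_convex: "convex_on UNIV p"
proof (rule convex_onI)
  fix t :: real and x y assume "0 < t" "t < 1"
  then show "p ((1 - t) *\<^sub>R x + t *\<^sub>R y) \<le> (1 - t) * p x + t * p y"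
    using gauge_add[of "(1 - t) *\<^sub>R x" "t *\<^sub>R y"] by (simp add: gauge_scale)
qed simp

lemma mem_K_iff: "x \<in> K \<longleftrightarrow> p x \<le> 1"
  using gauge_le_iff[of 1 x] by simp

lemma gauge_pos: "x \<noteq> 0 \<Longrightarrow> 0 < p x"
proof (rule ccontr)
  assume x: "x \<noteq> 0" "\<not> 0 < p x"
  then have p0: "p x = 0" using gauge_nonneg[of x] by simp
  obtain R where R: "0 < R" "\<And>y. y \<in> K \<Longrightarrow> norm y \<le> R" using compact_imp_bounded[OF compact_K] by (auto simp: bounded_pos)
  have "p ((2 * R / norm x) *\<^sub>R x) \<le> 1" using R p0 by (subst gauge_scale) auto
  then have "norm ((2 * R / norm x) *\<^sub>R x) \<le> R" using R mem_K_iff by blast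
  then show False using R x by simp
qed

lemma gauge_eq_0_iff [simp]: "p x = 0 \<longleftrightarrow> x = 0"
  using gauge_pos[of x] by (metis gauge_zero less_irrefl)

lemma interior_K: "interior K = {x. p x < 1}"
proof
  have "open {x. p x < 1}" by (intro open_Collect_less gauge_continuous continuous_intros)
  then show "{x. p x < 1} \<subseteq> interior K" by (intro interior_maximal) (auto simp: mem_K_iff)
  show "interior K \<subseteq> {x. p x < 1}"
  proof
    fix x assume x: "x \<in> interior K"
    show "x \<in> {x. p x < 1}"
    proof (cases "x = 0")
      case False
      obtain e where e: "0 < e" "cball x e \<subseteq> K" using x by (meson mem_interior_cball)
      define c where "c = 1 + e / norm x"
      have c: "1 < c" using e False by (simp add: c_def)
      have "c *\<^sub>R x \<in> cball x e" using e False by (simp add: c_def dist_norm algebra_simps)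
      then have "c * p x \<le> 1" using e mem_K_iff gauge_scale[of c x] c by auto
      moreover have "p x < c * p x" using c gauge_pos[OF False] by simp
      ultimately show ?thesis by simp
    qed simp
  qed
qed

lemma frontier_K: "frontier K = {x. p x = 1}"
  using compact_imp_closed[OF compact_K] by (auto simp: frontier_def interior_K mem_K_iff)

abbreviation D :: "'a set" where "D \<equiv> smooth_points p"
abbreviation G :: "'a \<Rightarrow> 'a" where "G \<equiv> grad p"

lemma D_borel [measurable]: "D \<in> sets borel" by (rule smooth_points_borel[OF gauge_continuous])
lemma G_measurable [measurable]: "G \<in> borel_measurable borel" by (rule grad_measurable[OF gauge_continuous])
lemma negligible_not_D: "negligible (- D)" by (rule negligible_nonsmooth_points[OF gauge_convex gauge_lipschitz])
lemma gauge_derivative: "x \<in> D \<Longrightarrow> (p has_derivative (\<lambda>v. G x \<bullet> v)) (at x)"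
  by (rule smooth_point_has_derivative[OF gauge_convex])

text \<open>Since \<open>p y = c * p (y / c)\<close>, the derivative is homogeneous of degree 0;
  smoothness and gradient are constant along rays.\<close>

lemma smooth_scale:
  assumes x: "x \<in> D" and c: "0 < c"
  shows "c *\<^sub>R x \<in> D" "G (c *\<^sub>R x) = G x"
proof -
  have "((\<lambda>y. c * p ((1 / c) *\<^sub>R y)) has_derivative (\<lambda>v. c * (G x \<bullet> ((1 / c) *\<^sub>R v)))) (at (c *\<^sub>R x))"
  proof (intro has_derivative_mult_right)
    show "((\<lambda>y. p ((1 / c) *\<^sub>R y)) has_derivative (\<lambda>v. G x \<bullet> ((1 / c) *\<^sub>R v))) (at (c *\<^sub>R x))"
      by (rule has_derivative_compose[of "\<lambda>y. (1 / c) *\<^sub>R y" _ "c *\<^sub>R x" UNIV p "\<lambda>v. G x \<bullet> v"])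
         (use c in \<open>auto intro!: derivative_eq_intros gauge_derivative[OF x]\<close>)
  qed
  moreover have "(\<lambda>y. c * p ((1 / c) *\<^sub>R y)) = p" using c by (auto simp: gauge_scale)
  moreover have "(\<lambda>v. c * (G x \<bullet> ((1 / c) *\<^sub>R v))) = (\<lambda>v. G x \<bullet> v)" using c by auto
  ultimately have "(p has_derivative (\<lambda>v. G x \<bullet> v)) (at (c *\<^sub>R x))" by simp
  from has_derivative_smooth_point[OF this] show "c *\<^sub>R x \<in> D" "G (c *\<^sub>R x) = G x" by auto
qed

text \<open>By convexity a deficit \<open>e\<close> at \<open>y\<close> would persist in proportion
  along the segment towards \<open>x\<close>, against differentiability at \<open>x\<close>.\<close>

lemma gauge_above_tangent:
  assumes "x \<in> D"
  shows "p x + G x \<bullet> (y - x) \<le> p y"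
proof (rule ccontr)
  assume neg: "\<not> ?thesis"
  define e where "e = p x + G x \<bullet> (y - x) - p y"
  have e: "0 < e" using neg by (simp add: e_def)
  have "y \<noteq> x" using neg by auto
  obtain d where d: "0 < d" "\<And>z. norm (z - x) < d \<Longrightarrow> norm (p z - p x - G x \<bullet> (z - x)) \<le> (e / (2 * norm (y - x))) * norm (z - x)"
    using gauge_derivative[OF assms, unfolded has_derivative_at_alt] e \<open>y \<noteq> x\<close>
    by (metis divide_pos_pos mult_pos_pos right_minus_eq zero_less_norm_iff zero_less_numeral)
  define t where "t = min 1 (d / (2 * norm (y - x)))"
  have t: "0 < t" "t \<le> 1" using d \<open>y \<noteq> x\<close> by (auto simp: t_def)
  define z where "z = x + t *\<^sub>R (y - x)"
  have zx: "norm (z - x) = t * norm (y - x)" using t by (simp add: z_def)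
  have "t * norm (y - x) \<le> d / 2"
    using \<open>y \<noteq> x\<close> mult_right_mono[of t "d / (2 * norm (y - x))" "norm (y - x)"] by (simp add: t_def)
  then have "norm (z - x) < d" using zx d by simp
  moreover have "G x \<bullet> (z - x) = t * (G x \<bullet> (y - x))" by (simp add: z_def)
  ultimately have "\<bar>p z - p x - t * (G x \<bullet> (y - x))\<bar> \<le> (e / (2 * norm (y - x))) * (t * norm (y - x))"
    using d(2)[of z] zx by simp
  also have "\<dots> = t * (e / 2)" using \<open>y \<noteq> x\<close> by simp
  finally have "\<bar>p z - p x - t * (G x \<bullet> (y - x))\<bar> \<le> t * (e / 2)" .
  then have "p x + t * (G x \<bullet> (y - x)) - t * (e / 2) \<le> p z" by linarith
  moreover have "p z \<le> (1 - t) * p x + t * p y"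
  proof -
    have "z = (1 - t) *\<^sub>R x + t *\<^sub>R y" by (simp add: z_def algebra_simps)
    then show ?thesis using convex_onD[OF gauge_convex, of t x y] t by simp
  qed
  moreover have "p y = p x + G x \<bullet> (y - x) - e" by (simp add: e_def)
  then have "(1 - t) * p x + t * p y = p x + t * (G x \<bullet> (y - x)) - t * e"
    by (simp only: distrib_left right_diff_distrib left_diff_distrib mult_1)
  ultimately have "t * e \<le> t * (e / 2)" by linarith
  then show False using t e by simp
qed

text \<open>Euler's identity, read off from the tangent inequality at the points 0 and
  \<open>x + x\<close>.\<close>

lemma G_inner_self:
  assumes "x \<in> D"
  shows "G x \<bullet> x = p x"
proof (rule antisym)
  show "p x \<le> G x \<bullet> x" using gauge_above_tangent[OF assms, of 0] by (simp add: inner_diff_right)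
  show "G x \<bullet> x \<le> p x" using gauge_above_tangent[OF assms, of "x + x"] gauge_add[of x x] by simp
qed

lemma norm_G_le:
  assumes "x \<in> D"
  shows "norm (G x) \<le> 1 / \<rho>"
proof (cases "G x = 0")
  case False
  have "p x + G x \<bullet> G x \<le> p (x + G x)" using gauge_above_tangent[OF assms, of "x + G x"] by simp
  also have "\<dots> \<le> p x + norm (G x) / \<rho>" using gauge_add[of x "G x"] gauge_le_norm[of "G x"] by simp
  finally have "norm (G x) * norm (G x) \<le> norm (G x) * (1 / \<rho>)" by (simp add: dot_square_norm power2_eq_square)
  from mult_left_le_imp_le[OF this] show ?thesis using False by simp
qed (use \<rho>_pos in simp)

text \<open>The normalized gradient is a normal by the tangent inequality. For uniqueness: every
  \<open>v\<close> with \<open>G y \<bullet> v < 0\<close> points into \<open>K\<close> to first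
  order, so any other normal is nonpositive on this half-space and hence a multiple of the
  gradient.\<close>

lemma outer_normal_eq:
  assumes "p y = 1" and y: "y \<in> D"
  shows "outer_normal K y = (1 / norm (G y)) *\<^sub>R G y"
proof -
  have Gy: "G y \<noteq> 0" using G_inner_self[OF y] assms by auto
  define n where "n = (1 / norm (G y)) *\<^sub>R G y"
  show ?thesis unfolding outer_normal_def n_def[symmetric]
  proof (rule the_equality)
    have "G y \<bullet> (z - y) \<le> 0" if "z \<in> K" for z
      using gauge_above_tangent[OF y, of z] that assms mem_K_iff[of z] by simp
    then show "norm n = 1 \<and> (\<forall>z\<in>K. n \<bullet> (z - y) \<le> 0)"
      using Gy by (auto simp: n_def divide_le_0_iff)
    fix u assume u: "norm u = 1 \<and> (\<forall>z\<in>K. u \<bullet> (z - y) \<le> 0)"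
    have half: "u \<bullet> v \<le> 0" if v: "G y \<bullet> v < 0" for v
    proof -
      \<comment> \<open>With this \<open>e\<close> the error term at most cancels the decrease of
        \<open>p\<close> along \<open>v\<close>, which leaves \<open>p \<le> 1\<close>.\<close>
      define e where "e = - (G y \<bullet> v) / (norm v)"
      have v0: "v \<noteq> 0" using v by auto
      have e: "0 < e" using v v0 by (simp add: e_def divide_neg_pos)
      obtain d where d: "0 < d" "\<And>z. norm (z - y) < d \<Longrightarrow> norm (p z - p y - G y \<bullet> (z - y)) \<le> e * norm (z - y)"
        using gauge_derivative[OF y, unfolded has_derivative_at_alt] e by blast
      define t where "t = d / (2 * norm v)"
      have t: "0 < t" using d v0 by (simp add: t_def)
      have "norm (y + t *\<^sub>R v - y) < d" using t v0 d by (simp add: t_def)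
      from d(2)[OF this] have "p (y + t *\<^sub>R v) \<le> 1 + t * (G y \<bullet> v) + e * (t * norm v)"
        using assms t by (simp add: abs_le_iff)
      also have "\<dots> = 1" using v0 by (simp add: e_def)
      finally have "y + t *\<^sub>R v \<in> K" by (simp add: mem_K_iff)
      then have "u \<bullet> (t *\<^sub>R v) \<le> 0" using u by (metis add_diff_cancel_left')
      then show ?thesis using t by (simp add: mult_le_0_iff)
    qed
    \<comment> \<open>Passage to the closed half-space by tilting \<open>v\<close> slightly against
      \<open>n\<close>.\<close>
    have half': "u \<bullet> v \<le> 0" if v: "n \<bullet> v \<le> 0" for v
    proof (rule field_le_epsilon)
      fix e :: real assume e: "0 < e"
      have "n \<bullet> n = 1" using Gy by (simp add: n_def dot_square_norm power2_eq_square)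
      then have "n \<bullet> (v - e *\<^sub>R n) < 0" using v e by (simp add: inner_diff_right)
      then have "G y \<bullet> (v - e *\<^sub>R n) < 0" using Gy by (simp add: n_def divide_less_0_iff)
      then have "u \<bullet> v \<le> e * (u \<bullet> n)" using half[of "v - e *\<^sub>R n"] by (simp add: inner_diff_right)
      also have "\<dots> \<le> e * 1"
      proof -
        have "u \<bullet> n \<le> norm u * norm n" by (rule norm_cauchy_schwarz)
        then show ?thesis using u e Gy by (intro mult_left_mono) (auto simp: n_def)
      qed
      finally show "u \<bullet> v \<le> 0 + e" by simp
    qed
    have nn: "n \<bullet> n = 1" using Gy by (simp add: n_def dot_square_norm power2_eq_square)
    \<comment> \<open>The part of \<open>u\<close> orthogonal to \<open>n\<close> lies in the closed
      half-space, which forces it to vanish.\<close>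
    define w where "w = u - (n \<bullet> u) *\<^sub>R n"
    have "n \<bullet> w = 0" using nn by (simp add: w_def inner_diff_right)
    then have "u \<bullet> w \<le> 0" using half' by simp
    moreover have "u \<bullet> w = w \<bullet> w" using \<open>n \<bullet> w = 0\<close> by (simp add: w_def inner_diff_left)
    ultimately have "w = 0" using inner_ge_zero[of w] by (metis antisym inner_eq_zero_iff)
    then have w0: "u = (n \<bullet> u) *\<^sub>R n" by (simp add: w_def)
    have "0 \<le> n \<bullet> u" using half'[of "- n"] nn by (simp add: inner_commute)
    moreover have "\<bar>n \<bullet> u\<bar> * norm n = 1" using u w0 by (metis norm_scaleR)
    moreover have "norm n = 1" using Gy by (simp add: n_def)
    ultimately have "n \<bullet> u = 1" by simp
    then show "u = n" using w0 by simp
  qed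
qed

end

section \<open>The surface measure in radial coordinates\<close>

lemma det_id_plus_rank_one:
  fixes a N :: "real^'n"
  shows "det (matrix (\<lambda>v. v + (N \<bullet> v) *\<^sub>R a)) = 1 + N \<bullet> a"
proof -
  define M where "M v = v + (N \<bullet> v) *\<^sub>R a" for v
  have linM: "linear M" unfolding M_def by (intro linearI) (auto simp: algebra_simps)
  obtain k :: 'n where True by blast
  \<comment> \<open>After a rotation taking \<open>N\<close> to the axis \<open>k\<close> only
    column \<open>k\<close> differs from the identity, and Cramer's rule gives the
    determinant.\<close>
  obtain T :: "real^'n \<Rightarrow> real^'n" where T: "orthogonal_transformation T" "T N = norm N *\<^sub>R axis k 1"
    using orthogonal_transformation_exists[of N "norm N *\<^sub>R axis k 1"] by auto
  define T' where "T' = inv T"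
  have T': "orthogonal_transformation T'" unfolding T'_def by (rule orthogonal_transformation_inv[OF T(1)])
  have TT': "T (T' w) = w" for w
    unfolding T'_def using orthogonal_transformation_surj[OF T(1)] by (simp add: surj_f_inv_f)
  have lin: "linear T" "linear T'" using T T' by (auto intro: orthogonal_transformation_linear)
  have eq: "(T \<circ> (M \<circ> T')) w = w + (norm N * w $ k) *\<^sub>R T a" for w
  proof -
    have "N \<bullet> T' w = T N \<bullet> T (T' w)" using T(1) by (simp add: orthogonal_transformation_def)
    also have "\<dots> = norm N * w $ k" by (simp add: TT' T(2) inner_axis')
    finally have "N \<bullet> T' w = norm N * w $ k" .
    then show ?thesis by (simp add: M_def linear_add[OF lin(1)] linear_scale[OF lin(1)] TT')
  qed
  have "det (matrix T) * det (matrix T') = det (matrix (T \<circ> T'))"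
    by (simp add: matrix_compose[OF lin(2,1)] det_mul)
  also have "T \<circ> T' = id" by (auto simp: TT')
  also have "det (matrix (id :: real^'n \<Rightarrow> real^'n)) = 1" by (rule matrix_id)
  finally have TT: "det (matrix T) * det (matrix T') = 1" .
  have "det (matrix (T \<circ> (M \<circ> T'))) = det (matrix T) * (det (matrix M) * det (matrix T'))"
    by (simp add: matrix_compose lin linM linear_compose det_mul)
  also have "\<dots> = det (matrix M)" using TT by (simp add: mult.left_commute mult.assoc[symmetric])
  finally have 1: "det (matrix M) = det (matrix (T \<circ> (M \<circ> T')))" ..
  define x where "x = axis k 1 + norm N *\<^sub>R T a"
  have "matrix (T \<circ> (M \<circ> T')) = (\<chi> i j. if j = k then (mat 1 *v x) $ i else (mat 1 :: real^'n^'n) $ i $ j)"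
    unfolding matrix_def eq matrix_vector_mul_lid by (auto simp: vec_eq_iff x_def axis_def mat_def)
  then have "det (matrix (T \<circ> (M \<circ> T'))) = x $ k" by (simp only: cramer_lemma) simp
  also have "\<dots> = 1 + T N \<bullet> T a" by (simp add: x_def T(2) inner_axis')
  also have "T N \<bullet> T a = N \<bullet> a" using T(1) by (simp add: orthogonal_transformation_def)
  finally have "det (matrix M) = 1 + N \<bullet> a" using 1 by (simp only:)
  then show ?thesis by (simp only: M_def[abs_def])
qed

lemma det_scaled_rank_one:
  fixes a N :: "real^'n"
  shows "det (matrix (\<lambda>v. c *\<^sub>R (v + (N \<bullet> v) *\<^sub>R a))) = c ^ CARD('n) * (1 + N \<bullet> a)"
proof -
  have "linear (\<lambda>v. v + (N \<bullet> v) *\<^sub>R a)" by (intro linearI) (auto simp: algebra_simps)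
  moreover have "linear ((*\<^sub>R) c :: real^'n \<Rightarrow> real^'n)" by (intro linearI) (auto simp: algebra_simps)
  ultimately have "matrix ((*\<^sub>R) c \<circ> (\<lambda>v. v + (N \<bullet> v) *\<^sub>R a)) = matrix ((*\<^sub>R) c :: real^'n \<Rightarrow> real^'n) ** matrix (\<lambda>v. v + (N \<bullet> v) *\<^sub>R a)"
    by (rule matrix_compose)
  then show ?thesis by (simp add: comp_def det_mul det_id_plus_rank_one)
qed

text \<open>The change of variables theorem of the library needs a well-ordered index type;
  the type below is a copy of an arbitrary finite type that carries such an order.\<close>

typedef 'a ordered_copy = "UNIV :: 'a set" ..

lemma bij_Rep_ordered_copy: "bij Rep_ordered_copy"
  by (rule bijI') (auto simp: Rep_ordered_copy_inject Abs_ordered_copy_inverse intro: exI[of _ "Abs_ordered_copy _"])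

instance ordered_copy :: (finite) finite
proof
  have "finite (range (Rep_ordered_copy :: 'a ordered_copy \<Rightarrow> 'a))" by simp
  then show "finite (UNIV :: 'a ordered_copy set)"
    by (rule finite_imageD) (rule bij_is_inj[OF bij_Rep_ordered_copy])
qed

definition copy_index :: "'a::finite ordered_copy \<Rightarrow> nat" where
  "copy_index = (SOME f. inj f)"

lemma inj_copy_index: "inj (copy_index :: 'a::finite ordered_copy \<Rightarrow> nat)"
proof -
  have "\<exists>f :: 'a ordered_copy \<Rightarrow> nat. inj f" using finite_imp_inj_to_nat_seg[OF finite[of UNIV]] by metis
  then show ?thesis unfolding copy_index_def by (rule someI_ex)
qed

instantiation ordered_copy :: (finite) linorder
begin
definition "a < b \<longleftrightarrow> copy_index a < copy_index b"
definition "a \<le> b \<longleftrightarrow> copy_index a \<le> copy_index b"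
instance
  by intro_classes (auto simp: less_ordered_copy_def less_eq_ordered_copy_def dest: injD[OF inj_copy_index])
end

instance ordered_copy :: (finite) wellorder
proof -
  have "wf {(x :: 'a ordered_copy, y). x < y}"
    by (auto simp add: trancl_def tranclp_less intro!: finite_acyclic_wf acyclicI)
  then show "OFCLASS('a ordered_copy, wellorder_class)"
    by (rule wf_wellorderI) intro_classes
qed

definition to_copy :: "real^'n \<Rightarrow> real^('n ordered_copy)" where
  "to_copy x = (\<chi> i. x $ Rep_ordered_copy i)"

definition of_copy :: "real^('n ordered_copy) \<Rightarrow> real^'n" where
  "of_copy y = (\<chi> i. y $ Abs_ordered_copy i)"

lemma of_to_copy [simp]: "of_copy (to_copy x) = x"
  by (simp add: of_copy_def to_copy_def vec_eq_iff Abs_ordered_copy_inverse)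

lemma to_of_copy [simp]: "to_copy (of_copy x) = x"
  by (simp add: of_copy_def to_copy_def vec_eq_iff Rep_ordered_copy_inverse)

lemma bounded_linear_to_copy: "bounded_linear to_copy"
  and bounded_linear_of_copy: "bounded_linear of_copy"
  unfolding linear_conv_bounded_linear[symmetric]
  by (intro linearI; simp add: to_copy_def of_copy_def vec_eq_iff)+

lemma inner_to_copy: "to_copy x \<bullet> to_copy y = x \<bullet> y"
proof -
  have "to_copy x \<bullet> to_copy y = (\<Sum>i\<in>UNIV. x $ Rep_ordered_copy i * y $ Rep_ordered_copy i)"
    by (simp add: inner_vec_def to_copy_def)
  also have "\<dots> = x \<bullet> y"
    unfolding inner_vec_def using sum.reindex_bij_betw[OF bij_Rep_ordered_copy, of "\<lambda>i. x $ i * y $ i"] by simp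
  finally show ?thesis .
qed

lemma card_ordered_copy: "CARD('n::finite ordered_copy) = CARD('n)"
  using bij_betw_same_card[OF bij_Rep_ordered_copy] by simp

lemma prod_Basis_cart: "(\<Prod>b\<in>(Basis :: (real^'n) set). f b) = (\<Prod>i\<in>UNIV. f (axis i 1))"
proof -
  have B: "(Basis :: (real^'n) set) = (\<lambda>i. axis i 1) ` UNIV" by (auto simp: Basis_vec_def)
  have I: "inj (\<lambda>i. axis i 1 :: real^'n)" by (auto simp: inj_on_def axis_eq_axis)
  show ?thesis unfolding B by (subst prod.reindex[OF I]) simp
qed

lemma distr_to_copy: "distr lborel borel to_copy = (lborel :: (real^('n::finite ordered_copy)) measure)"
proof (rule lborel_eqI[symmetric])
  fix l u :: "real^('n ordered_copy)"
  assume le: "\<And>b. b \<in> Basis \<Longrightarrow> l \<bullet> b \<le> u \<bullet> b"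
  have [measurable]: "to_copy \<in> borel_measurable borel"
    by (intro borel_measurable_continuous_onI linear_continuous_on bounded_linear_to_copy)
  have lei: "l $ i \<le> u $ i" for i using le[of "axis i 1"] by (auto simp: inner_axis Basis_vec_def)
  have "to_copy -` box l u = box (of_copy l) (of_copy u)"
    by (auto simp: mem_box_cart to_copy_def of_copy_def) (metis Abs_ordered_copy_inverse Rep_ordered_copy_inverse UNIV_I)+
  then have "emeasure (distr lborel borel to_copy) (box l u) = emeasure lborel (box (of_copy l) (of_copy u))"
    by (subst emeasure_distr) auto
  also have "\<dots> = ennreal (\<Prod>b\<in>Basis. (of_copy u - of_copy l) \<bullet> b)"
    using lei by (subst emeasure_lborel_box) (auto simp: Basis_vec_def inner_axis of_copy_def)
  also have "(\<Prod>b\<in>Basis. (of_copy u - of_copy l) \<bullet> b) = (\<Prod>i\<in>UNIV. (u - l) $ Abs_ordered_copy i)"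
    unfolding prod_Basis_cart by (simp add: inner_axis of_copy_def)
  also have "\<dots> = (\<Prod>i\<in>UNIV. (u - l) $ i)"
  proof -
    have "bij (Abs_ordered_copy :: 'n \<Rightarrow> 'n ordered_copy)"
      by (metis (no_types, lifting) Abs_ordered_copy_inverse Rep_ordered_copy_inverse UNIV_I bijI')
    from prod.reindex_bij_betw[OF this] show ?thesis .
  qed
  also have "\<dots> = (\<Prod>b\<in>Basis. (u - l) \<bullet> b)"
    unfolding prod_Basis_cart by (simp add: inner_axis)
  finally show "emeasure (distr lborel borel to_copy) (box l u) = ennreal (\<Prod>b\<in>Basis. (u - l) \<bullet> b)" .
qed simp

text \<open>The images to be measured are known only as Lebesgue sets, so invariance under
  relabelling of coordinates is carried from Borel sets to the completion.\<close>

lemma lebesgue_vimage_preserving: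
  fixes T :: "'a::euclidean_space \<Rightarrow> 'b::euclidean_space"
  assumes [measurable]: "T \<in> borel_measurable borel" and dT: "distr lborel borel T = lborel"
    and A: "A \<in> sets lebesgue"
  shows "T -` A \<in> sets lebesgue" "emeasure lebesgue (T -` A) = emeasure lebesgue A"
proof -
  obtain S N N' where S: "A = S \<union> N" "N \<subseteq> N'" "N' \<in> null_sets lborel" "S \<in> sets lborel"
    using A by (rule sets_completionE)
  have em: "emeasure lborel (T -` B) = emeasure lborel B" if [measurable]: "B \<in> sets borel" for B
    using emeasure_distr[of T lborel borel B] that unfolding dT by simp
  have [measurable]: "S \<in> sets borel" "N' \<in> sets borel" using S by auto
  have tb: "T -` B \<in> sets borel" if "B \<in> sets borel" for B
    using measurable_sets_borel[OF assms(1) that] by simp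
  have N'T: "T -` N' \<in> null_sets lborel" using S em[of N'] tb[of N'] by (auto simp: null_sets_def)
  have eq: "T -` A = T -` S \<union> T -` N" "T -` N \<subseteq> T -` N'" using S by auto
  show meas: "T -` A \<in> sets lebesgue" by (rule sets_completionI[OF eq N'T]) (use tb in auto)
  have 1: "emeasure lebesgue (S \<union> N) = emeasure lebesgue S" if "N \<subseteq> N'" "N' \<in> null_sets lborel" "S \<in> sets lborel"
    for S N N' :: "'c::euclidean_space set"
  proof (rule antisym)
    have N: "N \<in> null_sets lebesgue" using that by (meson null_sets_completionI null_sets_completion_subset)
    then show "emeasure lebesgue (S \<union> N) \<le> emeasure lebesgue S"
      using that emeasure_subadditive[of S lebesgue N] by (auto simp: null_sets_def)
    show "emeasure lebesgue S \<le> emeasure lebesgue (S \<union> N)" using that N by (intro emeasure_mono) auto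
  qed
  have "emeasure lebesgue (T -` A) = emeasure lebesgue (T -` S)" unfolding eq(1)
    by (rule 1[OF eq(2) N'T]) (use tb in simp)
  also have "\<dots> = emeasure lebesgue S" using em[of S] tb[of S] by simp
  also have "\<dots> = emeasure lebesgue A" unfolding S(1) by (rule 1[OF S(2,3,4), symmetric])
  finally show "emeasure lebesgue (T -` A) = emeasure lebesgue A" .
qed

text \<open>Change of variables on the relabelled space, transported back. The derivative is a
  multiple of a rank-one perturbation, so its determinant is explicit; \<open>j\<close> is a
  measurable function on the whole space that agrees with the absolute Jacobian on
  \<open>S\<close>.\<close>

lemma emeasure_image_rank_one_derivative:
  fixes f N a :: "real^'n \<Rightarrow> real^'n" and c :: "real^'n \<Rightarrow> real"
  assumes S: "S \<in> sets borel" and inj: "inj_on f S"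
    and der: "\<And>x. x \<in> S \<Longrightarrow> (f has_derivative (\<lambda>v. c x *\<^sub>R (v + (N x \<bullet> v) *\<^sub>R a x))) (at x)"
    and J: "\<And>x. x \<in> S \<Longrightarrow> \<bar>c x ^ CARD('n) * (1 + N x \<bullet> a x)\<bar> = j x"
    and [measurable]: "j \<in> borel_measurable borel" and jnn: "\<And>x. 0 \<le> j x"
    and fin: "(\<integral>\<^sup>+x. ennreal (j x) * indicator S x \<partial>lborel) < top"
  shows "f ` S \<in> sets lebesgue"
    and "emeasure lebesgue (f ` S) = (\<integral>\<^sup>+x. ennreal (j x) * indicator S x \<partial>lborel)"
proof -
  note [measurable] = S
  have [measurable]: "(to_copy :: real^'n \<Rightarrow> _) \<in> borel_measurable borel" "(of_copy :: _ \<Rightarrow> real^'n) \<in> borel_measurable borel"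
    by (intro borel_measurable_continuous_onI linear_continuous_on bounded_linear_to_copy bounded_linear_of_copy)+
  define S' where "S' = of_copy -` S"
  define f' where "f' = (\<lambda>y. to_copy (f (of_copy y)))"
  have S'[measurable]: "S' \<in> sets borel" unfolding S'_def using measurable_sets_borel[of of_copy borel S] S by simp
  have inj': "inj_on f' S'" using inj by (auto simp: inj_on_def f'_def S'_def) (metis of_to_copy to_of_copy)
  have der': "(f' has_derivative (\<lambda>w. c (of_copy y) *\<^sub>R (w + (to_copy (N (of_copy y)) \<bullet> w) *\<^sub>R to_copy (a (of_copy y))))) (at y within S')"
    if "y \<in> S'" for y
  proof -
    have y: "of_copy y \<in> S" using that by (simp add: S'_def)
    have 1: "((\<lambda>y. f (of_copy y)) has_derivative (\<lambda>w. c (of_copy y) *\<^sub>R (of_copy w + (N (of_copy y) \<bullet> of_copy w) *\<^sub>R a (of_copy y)))) (at y)"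
      by (rule has_derivative_compose[OF bounded_linear.has_derivative[OF bounded_linear_of_copy has_derivative_ident] der[OF y]])
    have "(f' has_derivative (\<lambda>w. to_copy (c (of_copy y) *\<^sub>R (of_copy w + (N (of_copy y) \<bullet> of_copy w) *\<^sub>R a (of_copy y))))) (at y)"
      unfolding f'_def by (rule bounded_linear.has_derivative[OF bounded_linear_to_copy 1])
    moreover have "to_copy (c (of_copy y) *\<^sub>R (of_copy w + (N (of_copy y) \<bullet> of_copy w) *\<^sub>R a (of_copy y)))
        = c (of_copy y) *\<^sub>R (w + (to_copy (N (of_copy y)) \<bullet> w) *\<^sub>R to_copy (a (of_copy y)))" for w
    proof -
      have "N (of_copy y) \<bullet> of_copy w = to_copy (N (of_copy y)) \<bullet> w" using inner_to_copy[of "N (of_copy y)" "of_copy w"] by simp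
      then show ?thesis
        by (simp add: linear_add[OF bounded_linear.linear[OF bounded_linear_to_copy]]
            linear_scale[OF bounded_linear.linear[OF bounded_linear_to_copy]])
    qed
    ultimately show ?thesis by (simp add: has_derivative_at_withinI)
  qed
  define h where "h y = indicator S' y * j (of_copy y)" for y :: "real^('n ordered_copy)"
  have [measurable]: "h \<in> borel_measurable borel" unfolding h_def by measurable
  have nn: "(\<integral>\<^sup>+y. ennreal (h y) \<partial>lborel) = (\<integral>\<^sup>+x. ennreal (j x) * indicator S x \<partial>lborel)"
  proof -
    have "(\<integral>\<^sup>+y. ennreal (h y) \<partial>lborel) = (\<integral>\<^sup>+y. ennreal (h y) \<partial>distr lborel borel to_copy)" by (simp add: distr_to_copy)
    also have "\<dots> = (\<integral>\<^sup>+x. ennreal (h (to_copy x)) \<partial>lborel)"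
      by (rule nn_integral_distr) (auto simp: h_def)
    also have "\<dots> = (\<integral>\<^sup>+x. ennreal (j x) * indicator S x \<partial>lborel)"
      by (intro nn_integral_cong) (auto simp: h_def S'_def indicator_def)
    finally show ?thesis .
  qed
  have int: "integrable lborel h"
  proof (rule integrableI_nonneg)
    show "AE y in lborel. 0 \<le> h y" using jnn by (simp add: h_def)
    show "(\<integral>\<^sup>+y. ennreal (h y) \<partial>lborel) < \<infinity>" using nn fin by simp
  qed simp
  define m where "m = integral\<^sup>L lborel h"
  have "(h has_integral m) UNIV" unfolding m_def by (rule has_integral_integral_lborel[OF int])
  moreover have "h = (\<lambda>y. if y \<in> S' then j (of_copy y) else 0)" by (auto simp: h_def)
  ultimately have "((\<lambda>y. j (of_copy y)) has_integral m) S'" by (simp add: has_integral_restrict_UNIV)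
  moreover have "\<bar>det (matrix (\<lambda>w. c (of_copy y) *\<^sub>R (w + (to_copy (N (of_copy y)) \<bullet> w) *\<^sub>R to_copy (a (of_copy y)))))\<bar> = j (of_copy y)"
    if "y \<in> S'" for y
    using J[of "of_copy y"] that unfolding det_scaled_rank_one inner_to_copy card_ordered_copy by (simp add: S'_def)
  ultimately have "((\<lambda>y. \<bar>det (matrix (\<lambda>w. c (of_copy y) *\<^sub>R (w + (to_copy (N (of_copy y)) \<bullet> w) *\<^sub>R to_copy (a (of_copy y)))))\<bar>) has_integral m) S'"
    by (simp cong: has_integral_cong)
  then have im: "f' ` S' \<in> lmeasurable" "measure lebesgue (f' ` S') = m"
    using has_measure_differentiable_image[OF _ der' inj', of m] by auto
  have fS: "f ` S = to_copy -` (f' ` S')"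
  proof -
    have "S' = to_copy ` S" unfolding S'_def by (auto simp: image_iff) (metis to_of_copy)
    then have "f' ` S' = to_copy ` f ` S" by (simp add: f'_def image_image)
    then show ?thesis by (auto simp: image_iff) (metis of_to_copy)
  qed
  note pres = lebesgue_vimage_preserving[OF _ distr_to_copy fmeasurableD[OF im(1)]]
  show "f ` S \<in> sets lebesgue" unfolding fS by (rule pres(1)) measurable
  have "emeasure lebesgue (f ` S) = emeasure lebesgue (f' ` S')" unfolding fS by (rule pres(2)) measurable
  also have "\<dots> = ennreal m" using im emeasure_eq_measure2[OF im(1)] by simp
  also have "\<dots> = (\<integral>\<^sup>+y. ennreal (h y) \<partial>lborel)"
    unfolding m_def by (rule nn_integral_eq_integral[OF int, symmetric]) (use jnn in \<open>auto simp: h_def\<close>)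
  finally show "emeasure lebesgue (f ` S) = (\<integral>\<^sup>+x. ennreal (j x) * indicator S x \<partial>lborel)" using nn by simp
qed

section \<open>Radial projection and sheets over boundary sets\<close>

context centered_body
begin

text \<open>Division by zero gives \<open>radial 0 = 0\<close>. Since \<open>p 0 = 0\<close>, the
  origin lies in no cone over a set of boundary points.\<close>

definition radial :: "'a \<Rightarrow> 'a" where "radial x = (1 / p x) *\<^sub>R x"

lemma radial_measurable [measurable]: "radial \<in> borel_measurable borel"
  unfolding radial_def by measurable

lemma gauge_radial: "x \<noteq> 0 \<Longrightarrow> p (radial x) = 1"
  using gauge_pos[of x] by (simp add: radial_def gauge_scale)

lemma scale_radial: "p x *\<^sub>R radial x = x"
  by (cases "x = 0") (auto simp: radial_def)

lemma radial_scale: "p b = 1 \<Longrightarrow> 0 < t \<Longrightarrow> radial (t *\<^sub>R b) = b"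
  by (simp add: radial_def gauge_scale)

lemma smooth_radial:
  assumes "x \<noteq> 0" "radial x \<in> D"
  shows "x \<in> D" "G (radial x) = G x"
proof -
  have "p x *\<^sub>R radial x \<in> D \<and> G (p x *\<^sub>R radial x) = G (radial x)"
    using smooth_scale[OF assms(2) gauge_pos[OF assms(1)]] by simp
  then show "x \<in> D" "G (radial x) = G x" by (simp_all add: scale_radial)
qed

lemma K_borel [measurable]: "K \<in> sets borel"
  by (intro borel_compact compact_K)

lemma cone_measurable:
  assumes [measurable]: "E \<in> sets borel"
  shows "{x\<in>K. radial x \<in> E} \<in> sets borel"
  by measurable

end

locale centered_body_cart = centered_body K \<rho> for K :: "(real^'n) set" and \<rho>
begin

text \<open>The boundary point \<open>b\<close> and the height \<open>t\<close> correspond to the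
  point of the ray through \<open>b\<close> at the level \<open>root (n + 1) t\<close>. A line in
  direction \<open>u\<close> meets \<open>E\<close> at most once, which gives injectivity, and
  Euler's identity simplifies the Jacobian.\<close>

lemma sheet_emeasure:
  assumes [measurable]: "E \<in> sets borel" and E: "\<And>b. b \<in> E \<Longrightarrow> p b = 1 \<and> b \<in> D \<and> 0 < G b \<bullet> u"
  defines "W \<equiv> {b + t *\<^sub>R u | b t. b \<in> E \<and> 0 < t \<and> t \<le> 1}"
  shows "W \<in> sets lebesgue"
    and "emeasure lebesgue W = (\<integral>\<^sup>+x. ennreal ((real CARD('n) + 1) * p x * max 0 (G x \<bullet> u)) * indicator {x\<in>K. radial x \<in> E} x \<partial>lborel)"
proof -
  define n where "n = CARD('n)"
  define S where "S = {x\<in>K. radial x \<in> E}"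
  have S_borel: "S \<in> sets borel" unfolding S_def by (rule cone_measurable) simp
  \<comment> \<open>Any positive power would sweep out the heights in (0, 1]; the exponent
    \<open>n + 1\<close> makes the Jacobian homogeneous of degree 1 like \<open>p\<close>, the
    weight produced by the variation of the volume.\<close>
  define f where "f x = radial x + (p x ^ Suc n) *\<^sub>R u" for x
  have S0: "x \<noteq> 0" "0 < p x" "p x \<le> 1" "x \<in> D" "G (radial x) = G x" "radial x \<in> E" "0 < G x \<bullet> u" if "x \<in> S" for x
  proof -
    show r: "radial x \<in> E" using that by (simp add: S_def)
    show x0: "x \<noteq> 0"
    proof
      assume "x = 0"
      then show False using E[OF r] by (simp add: radial_def)
    qed
    show "0 < p x" by (rule gauge_pos[OF x0])
    show "p x \<le> 1" using that by (simp add: S_def mem_K_iff)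
    show "x \<in> D" "G (radial x) = G x" using smooth_radial[OF x0] E[OF r] by auto
    then show "0 < G x \<bullet> u" using E[OF r] by simp
  qed
  have WfS: "W = f ` S"
  proof
    show "f ` S \<subseteq> W"
    proof
      fix y assume "y \<in> f ` S"
      then obtain x where x: "x \<in> S" "y = radial x + (p x ^ Suc n) *\<^sub>R u" by (auto simp: f_def)
      have "0 < p x ^ Suc n" "p x ^ Suc n \<le> 1" using S0[OF x(1)] by (auto simp: power_le_one simp del: power_Suc)
      then show "y \<in> W" using x S0(6)[OF x(1)] unfolding W_def by blast
    qed
    show "W \<subseteq> f ` S"
    proof
      fix y assume "y \<in> W"
      then obtain b t where b: "b \<in> E" "0 < t" "t \<le> 1" "y = b + t *\<^sub>R u" by (auto simp: W_def)
      define s where "s = root (Suc n) t"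
      have s: "0 < s" "s ^ Suc n = t" "s \<le> 1"
        using b by (auto simp: s_def real_root_pow_pos simp del: power_Suc) 
      have pb: "p b = 1" using E b by blast
      have ps: "p (s *\<^sub>R b) = s" using s pb by (simp add: gauge_scale)
      have "s *\<^sub>R b \<in> S" using s pb b ps by (simp add: S_def mem_K_iff radial_scale)
      moreover have "f (s *\<^sub>R b) = y" using b s ps radial_scale[OF pb s(1)] by (simp add: f_def del: power_Suc)
      ultimately show "y \<in> f ` S" by blast
    qed
  qed
  have inj: "inj_on f S"
  proof (rule inj_onI)
    fix x y assume x: "x \<in> S" and y: "y \<in> S" and eq: "f x = f y"
    \<comment> \<open>The tangent inequality at \<open>w\<close> has equal values of
      \<open>p\<close> on both sides, which excludes a second boundary point in direction
      \<open>u\<close>.\<close>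
    have no: "\<not> \<tau> > 0" if "z \<in> E" "w \<in> E" "z = w + \<tau> *\<^sub>R u" for z w \<tau>
    proof
      assume "\<tau> > 0"
      have "p w + G w \<bullet> (z - w) \<le> p z" using E that by (intro gauge_above_tangent) auto
      then have "\<tau> * (G w \<bullet> u) \<le> 0" using E[OF that(1)] E[OF that(2)] that(3) by simp
      then show False using \<open>\<tau> > 0\<close> E[OF that(2)] by (simp add: mult_le_0_iff)
    qed
    have "radial x = radial y + (p y ^ Suc n - p x ^ Suc n) *\<^sub>R u" "radial y = radial x + (p x ^ Suc n - p y ^ Suc n) *\<^sub>R u"
      using eq by (simp_all add: f_def algebra_simps del: power_Suc)
    with no[OF S0(6)[OF x] S0(6)[OF y]] no[OF S0(6)[OF y] S0(6)[OF x]]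
    have pe: "p x ^ Suc n = p y ^ Suc n" by (metis diff_gt_0_iff_gt linorder_neqE_linordered_idom)
    then have "p x = p y" using S0(2)[OF x] S0(2)[OF y] by (meson less_imp_le power_inject_base)
    moreover have "radial x = radial y" using eq pe by (simp add: f_def)
    ultimately show "x = y" by (metis scale_radial)
  qed
  have der: "(f has_derivative (\<lambda>v. (1 / p x) *\<^sub>R (v + (G x \<bullet> v) *\<^sub>R (((real n + 1) * p x ^ Suc n) *\<^sub>R u - (1 / p x) *\<^sub>R x)))) (at x)"
    if x: "x \<in> S" for x
  proof -
    note pd = gauge_derivative[OF S0(4)[OF x]]
    have P: "0 < p x" by (rule S0(2)[OF x])
    have h1: "((\<lambda>x. inverse (p x)) has_derivative (\<lambda>v. - (inverse (p x) * (G x \<bullet> v) * inverse (p x)))) (at x)"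
      by (rule Deriv.has_derivative_inverse[OF _ pd]) (use S0(1)[OF x] in simp)
    have h2: "((\<lambda>x. inverse (p x) *\<^sub>R x) has_derivative
        (\<lambda>v. inverse (p x) *\<^sub>R v + (- (inverse (p x) * (G x \<bullet> v) * inverse (p x))) *\<^sub>R x)) (at x)"
      by (rule has_derivative_scaleR[OF h1 has_derivative_ident])
    have h3: "((\<lambda>x. p x ^ Suc n) has_derivative (\<lambda>v. of_nat (Suc n) * (G x \<bullet> v) * p x ^ (Suc n - 1))) (at x)"
      by (rule has_derivative_power[OF pd])
    have h4: "((\<lambda>x. (p x ^ Suc n) *\<^sub>R u) has_derivative (\<lambda>v. (of_nat (Suc n) * (G x \<bullet> v) * p x ^ (Suc n - 1)) *\<^sub>R u)) (at x)"
      by (rule has_derivative_scaleR_left[OF h3])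
    have f: "f = (\<lambda>x. inverse (p x) *\<^sub>R x + (p x ^ Suc n) *\<^sub>R u)"
      by (simp add: fun_eq_iff f_def radial_def inverse_eq_divide)
    show ?thesis unfolding f
    proof (rule has_derivative_eq_rhs[OF has_derivative_add[OF h2 h4]], rule ext)
      fix v
      define w where "w = G x \<bullet> v"
      define q where "q = p x"
      have q: "q \<noteq> 0" using S0(1)[OF x] by (simp add: q_def)
      have c1: "(1 / q) * (w * (1 / q)) = inverse q * w * inverse q" by (simp add: inverse_eq_divide)
      have c2: "(1 / q) * (w * ((real n + 1) * q ^ Suc n)) = real (Suc n) * w * q ^ n" using q by simp
      have "(1 / q) *\<^sub>R (v + w *\<^sub>R (((real n + 1) * q ^ Suc n) *\<^sub>R u - (1 / q) *\<^sub>R x))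
          = (1 / q) *\<^sub>R v + ((1 / q) * (w * ((real n + 1) * q ^ Suc n))) *\<^sub>R u - ((1 / q) * (w * (1 / q))) *\<^sub>R x"
        by (simp only: scaleR_right_distrib scaleR_diff_right scaleR_scaleR add_diff_eq)
      also have "\<dots> = inverse q *\<^sub>R v + (- (inverse q * w * inverse q)) *\<^sub>R x + (of_nat (Suc n) * w * q ^ (Suc n - 1)) *\<^sub>R u"
        unfolding c1 c2 by (simp add: inverse_eq_divide)
      finally show "inverse (p x) *\<^sub>R v + (- (inverse (p x) * (G x \<bullet> v) * inverse (p x))) *\<^sub>R x
          + (of_nat (Suc n) * (G x \<bullet> v) * p x ^ (Suc n - 1)) *\<^sub>R u
        = (1 / p x) *\<^sub>R (v + (G x \<bullet> v) *\<^sub>R (((real n + 1) * p x ^ Suc n) *\<^sub>R u - (1 / p x) *\<^sub>R x))"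
        unfolding q_def w_def by (rule sym)
    qed
  qed
  \<comment> \<open>The cut-off at 0 makes \<open>j\<close> nonnegative everywhere; on
    \<open>S\<close> it is inactive.\<close>
  define j where "j x = (real n + 1) * p x * max 0 (G x \<bullet> u)" for x
  have J: "\<bar>(1 / p x) ^ CARD('n) * (1 + G x \<bullet> (((real n + 1) * p x ^ Suc n) *\<^sub>R u - (1 / p x) *\<^sub>R x))\<bar> = j x" if x: "x \<in> S" for x
  proof -
    have P: "0 < p x" by (rule S0(2)[OF x])
    \<comment> \<open>The identity \<open>G x \<bullet> x = p x\<close> cancels the 1.\<close>
    have "1 + G x \<bullet> (((real n + 1) * p x ^ Suc n) *\<^sub>R u - (1 / p x) *\<^sub>R x) = (real n + 1) * p x ^ Suc n * (G x \<bullet> u)"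
      using P S0(1)[OF x] G_inner_self[OF S0(4)[OF x]] by (simp add: inner_diff_right)
    then have "(1 / p x) ^ CARD('n) * (1 + G x \<bullet> (((real n + 1) * p x ^ Suc n) *\<^sub>R u - (1 / p x) *\<^sub>R x)) = (real n + 1) * p x * (G x \<bullet> u)"
      using P by (simp add: n_def[symmetric] power_divide)
    then show ?thesis using S0(7)[OF x] P by (simp add: j_def)
  qed
  have jm: "j \<in> borel_measurable borel" unfolding j_def by measurable
  have jnn: "0 \<le> j x" for x using gauge_nonneg[of x] by (simp add: j_def)
  have fin: "(\<integral>\<^sup>+x. ennreal (j x) * indicator S x \<partial>lborel) < top"
  proof -
    define c where "c = (real n + 1) * (norm u / \<rho>)"
    have "(\<integral>\<^sup>+x. ennreal (j x) * indicator S x \<partial>lborel) \<le> (\<integral>\<^sup>+x. ennreal c * indicator K x \<partial>lborel)"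
    proof (rule nn_integral_mono)
      fix x
      have "j x \<le> c" if x: "x \<in> S"
      proof -
        have "G x \<bullet> u \<le> norm (G x) * norm u" by (rule norm_cauchy_schwarz)
        also have "\<dots> \<le> (1 / \<rho>) * norm u" by (intro mult_right_mono norm_G_le S0[OF x]) simp
        finally have "max 0 (G x \<bullet> u) \<le> norm u / \<rho>" using \<rho>_pos by simp
        then have "p x * max 0 (G x \<bullet> u) \<le> 1 * (norm u / \<rho>)" using S0[OF x] by (intro mult_mono) auto
        then show ?thesis unfolding j_def c_def mult.assoc by (intro mult_left_mono) auto
      qed
      then show "ennreal (j x) * indicator S x \<le> ennreal c * indicator K x"
        by (auto simp: indicator_def S_def intro: ennreal_leI)
    qed
    also have "\<dots> = ennreal c * emeasure lborel K" by (subst nn_integral_cmult_indicator) auto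
    also have "\<dots> < top"
      using emeasure_compact_finite[OF compact_K] by (simp add: ennreal_mult_less_top)
    finally show ?thesis .
  qed
  note res = emeasure_image_rank_one_derivative[where S = S and f = f and c = "\<lambda>x. 1 / p x" and N = G and j = j
      and a = "\<lambda>x. ((real n + 1) * p x ^ Suc n) *\<^sub>R u - (1 / p x) *\<^sub>R x", OF S_borel inj der J jm jnn fin]
  show "W \<in> sets lebesgue" unfolding WfS by (rule res(1))
  show "emeasure lebesgue W = (\<integral>\<^sup>+x. ennreal ((real CARD('n) + 1) * p x * max 0 (G x \<bullet> u)) * indicator {x\<in>K. radial x \<in> E} x \<partial>lborel)"
    unfolding WfS using res(2) unfolding j_def S_def n_def .
qed

end

section \<open>The first variation of the volume\<close>

lemma nn_integral_power_unit_interval: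
  "(\<integral>\<^sup>+s. ennreal (s ^ n) * indicator {0..1} s \<partial>lborel) = ennreal (1 / (real n + 1))"
proof -
  have "(\<integral>\<^sup>+s. ennreal (s ^ n) * indicator {0..1} s \<partial>lborel) = ennreal (1 ^ Suc n / (real n + 1) - 0 ^ Suc n / (real n + 1))"
  proof (rule nn_integral_FTC_Icc)
    fix x :: real
    show "((\<lambda>x. x ^ Suc n / (real n + 1)) has_real_derivative x ^ n) (at x)"
    proof -
      have "((\<lambda>x. x ^ Suc n / (real n + 1)) has_real_derivative real (Suc n) * x ^ (Suc n - Suc 0) / (real n + 1)) (at x)"
        by (intro DERIV_cdivide DERIV_pow)
      moreover have "real (Suc n) * x ^ (Suc n - Suc 0) / (real n + 1) = x ^ n" by (simp add: add.commute[of 1 "real n"])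
      ultimately show ?thesis by (simp only:)
    qed
  qed auto
  then show ?thesis by simp
qed

context centered_body
begin

text \<open>The layer cake formula: the sublevel sets of \<open>p\<close> are the dilates of \<open>K\<close>.\<close>

lemma nn_integral_gauge_tent:
  "(\<integral>\<^sup>+x. ennreal (max 0 (1 - p x)) \<partial>lborel) = ennreal (1 / (real DIM('a) + 1)) * emeasure lborel K"
proof -
  have "(\<integral>\<^sup>+x. ennreal (max 0 (1 - p x)) \<partial>lborel) = (\<integral>\<^sup>+x. (\<integral>\<^sup>+s. indicator {p x..1} s \<partial>lborel) \<partial>lborel)"
    by (intro nn_integral_cong) (auto simp: max_def)
  also have "\<dots> = (\<integral>\<^sup>+x. (\<integral>\<^sup>+s. indicator {0<..1} s * indicator {x. p x \<le> s} x \<partial>lborel) \<partial>lborel)"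
  \<comment> \<open>The level \<open>s = 0\<close> is dropped, since sublevel sets are dilates of
    \<open>K\<close> for \<open>s > 0\<close> only.\<close>
  proof (rule nn_integral_cong, rule nn_integral_cong_AE)
    fix x
    show "AE s in lborel. indicator {p x..1} s = (indicator {0<..1} s * indicator {x. p x \<le> s} x :: ennreal)"
      using AE_lborel_singleton[of 0] by eventually_elim (use gauge_nonneg[of x] in \<open>auto simp: indicator_def\<close>)
  qed
  also have "\<dots> = (\<integral>\<^sup>+s. (\<integral>\<^sup>+x. indicator {0<..1} s * indicator {x. p x \<le> s} x \<partial>lborel) \<partial>lborel)"
    by (rule lborel_pair.Fubini') measurable
  also have "\<dots> = (\<integral>\<^sup>+s. ennreal (s ^ DIM('a)) * indicator {0..1} s * emeasure lborel K \<partial>lborel)"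
  proof (rule nn_integral_cong_AE)
    show "AE s in lborel. (\<integral>\<^sup>+x. indicator {0<..1} s * indicator {x. p x \<le> s} x \<partial>lborel)
        = ennreal (s ^ DIM('a)) * indicator {0..1} s * emeasure lborel K"
      using AE_lborel_singleton[of 0]
    proof eventually_elim
      case (elim s)
      show ?case
      proof (cases "s \<in> {0<..1}")
        case True
        then have s: "0 < s" by simp
        have "{x. s *\<^sub>R x \<in> {x. p x \<le> s}} = K" using s by (auto simp: gauge_scale mem_K_iff)
        then have "emeasure lborel {x. p x \<le> s} = ennreal (s ^ DIM('a)) * emeasure lborel K"
          using emeasure_lborel_scale[of s "{x. p x \<le> s}"] s by simp
        then show ?thesis using True by (simp add: nn_integral_cmult)
      next
        case False
        then show ?thesis using elim by (auto simp: indicator_def)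
      qed
    qed
  qed
  also have "\<dots> = ennreal (1 / (real DIM('a) + 1)) * emeasure lborel K"
    by (subst nn_integral_multc) (simp_all add: nn_integral_power_unit_interval)
  finally show ?thesis .
qed

lemma tent_integrable: "integrable lborel (\<lambda>x. max 0 (1 - p x))"
  and tent_integral: "(\<integral>x. max 0 (1 - p x) \<partial>lborel) = measure lebesgue K / (real DIM('a) + 1)"
proof -
  have K: "emeasure lborel K = ennreal (measure lborel K)"
    using emeasure_compact_finite[OF compact_K] by (intro emeasure_eq_ennreal_measure) (simp add: less_top)
  have nn: "(\<integral>\<^sup>+x. ennreal (max 0 (1 - p x)) \<partial>lborel) = ennreal (measure lborel K / (real DIM('a) + 1))"
    unfolding nn_integral_gauge_tent K by (subst ennreal_mult[symmetric]) auto
  show int: "integrable lborel (\<lambda>x. max 0 (1 - p x))"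
    by (rule integrableI_nonneg) (auto simp: nn)
  have "ennreal (\<integral>x. max 0 (1 - p x) \<partial>lborel) = ennreal (measure lborel K / (real DIM('a) + 1))"
    using nn_integral_eq_integral[OF int] nn by simp
  then show "(\<integral>x. max 0 (1 - p x) \<partial>lborel) = measure lebesgue K / (real DIM('a) + 1)"
    by (subst (asm) ennreal_inj) (auto intro!: integral_nonneg_AE)
qed

end

section \<open>Gauge of the intersection body and its derivative\<close>

locale body_with_directions = centered_body K \<rho> for K :: "'a::euclidean_space set" and \<rho> +
  fixes \<theta> :: "'m::finite \<Rightarrow> 'a"
begin

text \<open>Bounds the growth of \<open>p\<close> under a unit shift against any of the
  \<open>\<theta> i\<close>; the summand 1 makes it positive even if all of them vanish.\<close>

definition C :: real where "C = 1 + (\<Sum>i\<in>UNIV. p (- \<theta> i))"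

lemma C_pos: "1 \<le> C"
  unfolding C_def by (simp add: sum_nonneg gauge_nonneg)

lemma gauge_theta_le: "p (- \<theta> i) \<le> C"
proof -
  have "p (- \<theta> i) \<le> (\<Sum>i\<in>UNIV. p (- \<theta> i))" by (rule member_le_sum) (auto simp: gauge_nonneg)
  then show ?thesis by (simp add: C_def)
qed

definition inner_body :: "real \<Rightarrow> 'a set" where
  "inner_body r = {y\<in>K. \<forall>i. y - r *\<^sub>R \<theta> i \<in> K}"

lemma gauge_shift_le: "0 \<le> t \<Longrightarrow> p (x - t *\<^sub>R \<theta> i) \<le> p x + t * C"
proof -
  assume t: "0 \<le> t"
  have "p (x - t *\<^sub>R \<theta> i) \<le> p x + p (t *\<^sub>R (- \<theta> i))" using gauge_add[of x "t *\<^sub>R (- \<theta> i)"] by simp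
  also have "\<dots> \<le> p x + t * C" unfolding gauge_scale[OF t] using t gauge_theta_le by (simp add: mult_left_mono)
  finally show ?thesis .
qed

text \<open>On the ball of radius \<open>\<rho> / 2\<close> one has \<open>p \<le> 1/2\<close>, and
  the shifts raise \<open>p\<close> by at most \<open>r * C\<close>.\<close>

lemma centered_inner_body:
  assumes r: "0 \<le> r" "r * C \<le> 1 / 2"
  shows "centered_body (inner_body r) (\<rho> / 2)"
proof
  have eq: "inner_body r = K \<inter> (\<Inter>i. (\<lambda>y. r *\<^sub>R \<theta> i + y) ` K)"
    by (auto simp: inner_body_def image_iff) (metis add_diff_cancel_left' diff_add_cancel add.commute)+
  show "compact (inner_body r)" unfolding eq
    by (intro compact_Int_closed compact_K closed_INT ballI compact_imp_closed compact_translation)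
  show "convex (inner_body r)" unfolding eq
    by (intro convex_Int convex_K convex_INT convex_translation)
  show "0 < \<rho> / 2" using \<rho>_pos by simp
  show "cball 0 (\<rho> / 2) \<subseteq> inner_body r"
  proof
    fix y :: 'a assume "y \<in> cball 0 (\<rho> / 2)"
    then have "norm y / \<rho> \<le> 1 / 2" unfolding pos_divide_le_eq[OF \<rho>_pos] by simp
    then have y: "p y \<le> 1 / 2" using gauge_le_norm[of y] by linarith
    have "p (y - r *\<^sub>R \<theta> i) \<le> 1" for i using gauge_shift_le[OF r(1), of y i] y r(2) by linarith
    then show "y \<in> inner_body r" using y by (simp add: inner_body_def mem_K_iff)
  qed
qed

text \<open>Given for every real \<open>r\<close> so that it can stand in limits; it is identified
  with the gauge of a \<open>centered_body\<close> while \<open>0 \<le> r\<close> and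
  \<open>r * C \<le> 1 / 2\<close>.\<close>

definition pr :: "real \<Rightarrow> 'a \<Rightarrow> real" where "pr r = minkowski_gauge (inner_body r)"

context
  fixes r :: real
  assumes r: "0 \<le> r" "r * C \<le> 1 / 2"
begin

interpretation R: centered_body "inner_body r" "\<rho> / 2" by (rule centered_inner_body[OF r])

lemma pr_eq: "pr r = R.p" by (simp add: pr_def R.p_def)

text \<open>Dilating the body to the level \<open>s\<close> dilates the shifts as well. This
  \<open>s\<close> is the source of the factor \<open>p x\<close> in the derivative
  \<open>p x * M x\<close>.\<close>

lemma pr_le_iff:
  assumes "0 < s"
  shows "pr r x \<le> s \<longleftrightarrow> p x \<le> s \<and> (\<forall>i. p (x - (s * r) *\<^sub>R \<theta> i) \<le> s)"
proof -
  have 1: "(1 / s) *\<^sub>R x - r *\<^sub>R \<theta> i = (1 / s) *\<^sub>R (x - (s * r) *\<^sub>R \<theta> i)" for i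
    using assms by (simp add: scaleR_diff_right)
  have "pr r x \<le> s \<longleftrightarrow> (1 / s) *\<^sub>R x \<in> inner_body r" unfolding pr_eq by (rule R.gauge_le_iff[OF assms])
  also have "\<dots> \<longleftrightarrow> p x \<le> s \<and> (\<forall>i. p (x - (s * r) *\<^sub>R \<theta> i) \<le> s)"
    unfolding inner_body_def mem_Collect_eq 1 gauge_le_iff[OF assms, symmetric] by (rule refl)
  finally show ?thesis .
qed

lemma gauge_le_pr: "p x \<le> pr r x"
proof (rule field_le_epsilon)
  fix e :: real assume "0 < e"
  then have "0 < pr r x + e" using R.gauge_nonneg[of x] by (simp add: pr_eq add_nonneg_pos)
  then show "p x \<le> pr r x + e" using pr_le_iff[of "pr r x + e" x] \<open>0 < e\<close> by simp
qed

text \<open>Supplies the integrable bound for the difference quotients.\<close>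

lemma pr_le: "pr r x \<le> (1 + 2 * (r * C)) * p x"
proof (cases "x = 0")
  case True
  then show ?thesis by (simp add: pr_eq)
next
  case False
  \<comment> \<open>Solution of \<open>s = p x + s * r * C\<close>, the level at which the crude
    shift bound just passes the test.\<close>
  define s where "s = p x / (1 - r * C)"
  have P: "0 < p x" by (rule gauge_pos[OF False])
  have rC: "0 < 1 - r * C" using r(2) by linarith
  have s: "0 < s" "s * (1 - r * C) = p x" using P rC by (auto simp: s_def)
  have rc0: "0 \<le> r * C" using r C_pos by simp
  have "p x \<le> s" using s mult_nonneg_nonneg[OF less_imp_le[OF s(1)] rc0] by (simp add: algebra_simps)
  moreover have "p (x - (s * r) *\<^sub>R \<theta> i) \<le> s" for i
  proof -
    have "p (x - (s * r) *\<^sub>R \<theta> i) \<le> p x + (s * r) * C" using s r by (intro gauge_shift_le) simp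
    also have "\<dots> = s" using s(2) by (simp add: algebra_simps)
    finally show ?thesis .
  qed
  ultimately have "pr r x \<le> s" using pr_le_iff[OF s(1)] by blast
  \<comment> \<open>Uses \<open>1 / (1 - q) \<le> 1 + 2 * q\<close> for
    \<open>0 \<le> q \<le> 1/2\<close>.\<close>
  also have "s \<le> (1 + 2 * (r * C)) * p x"
  proof -
    have "1 \<le> (1 + 2 * (r * C)) * (1 - r * C)"
      using rc0 r(2) mult_nonneg_nonneg[of "r * C" "1 - 2 * (r * C)"] by (simp add: algebra_simps)
    then have "1 / (1 - r * C) \<le> 1 + 2 * (r * C)" using rC by (simp add: divide_le_eq)
    then have "p x * (1 / (1 - r * C)) \<le> p x * (1 + 2 * (r * C))" using P by (intro mult_left_mono) auto
    then show ?thesis by (simp add: s_def mult.commute)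
  qed
  finally show ?thesis .
qed

lemma pr_measurable: "pr r \<in> borel_measurable borel" unfolding pr_eq by (rule R.gauge_measurable)

lemma pr_tent_integrable: "integrable lborel (\<lambda>x. max 0 (1 - pr r x))"
  and pr_tent_integral: "(\<integral>x. max 0 (1 - pr r x) \<partial>lborel) = measure lebesgue (inner_body r) / (real DIM('a) + 1)"
  unfolding pr_eq by (rule R.tent_integrable R.tent_integral)+

end

definition M :: "'a \<Rightarrow> real" where "M x = Max (range (\<lambda>i. max 0 (- (\<theta> i \<bullet> G x))))"

lemma M_ge: "0 \<le> M x" "- (\<theta> i \<bullet> G x) \<le> M x"
proof -
  have *: "max 0 (- (\<theta> i \<bullet> G x)) \<le> M x" for i unfolding M_def by (rule Max_ge) auto
  from *[of i] show "0 \<le> M x" "- (\<theta> i \<bullet> G x) \<le> M x" by auto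
qed

lemma M_attained: "0 < M x \<Longrightarrow> \<exists>i. M x = - (\<theta> i \<bullet> G x)"
proof -
  assume "0 < M x"
  have "M x \<in> range (\<lambda>i. max 0 (- (\<theta> i \<bullet> G x)))" unfolding M_def by (rule Max_in) auto
  then show ?thesis using \<open>0 < M x\<close> by (auto simp: max_def split: if_splits)
qed

lemma M_measurable [measurable]: "M \<in> borel_measurable borel"
proof -
  have "(\<lambda>x. Max ((\<lambda>i. max 0 (- (\<theta> i \<bullet> G x))) ` UNIV)) \<in> borel_measurable borel"
    by (rule borel_measurable_Max) measurable
  then show ?thesis unfolding M_def[abs_def] .
qed

text \<open>By \<open>pr_le_iff\<close>, \<open>pr r x\<close> is the least level \<open>s\<close>
  with \<open>p x \<le> s\<close> that passes the tests for all shifts. To first order the test for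
  \<open>i\<close> reads \<open>p x - s * r * (\<theta> i \<bullet> G x) \<le> s\<close>, and in the
  term with \<open>r\<close> the level may be replaced by \<open>p x\<close>; the strictest
  \<open>i\<close> produces \<open>M x\<close>.\<close>

lemma tendsto_pr_derivative:
  assumes x: "x \<in> D" "x \<noteq> 0"
  shows "((\<lambda>r. (pr r x - p x) / r) \<longlongrightarrow> p x * M x) (at_right 0)"
proof (rule tendstoI)
  fix e0 :: real assume e0: "0 < e0"
  define e where "e = e0 / 2"
  have e: "0 < e" using e0 by (simp add: e_def)
  define P where "P = p x"
  have P: "0 < P" using gauge_pos x by (simp add: P_def)
  define T where "T = 1 + (\<Sum>i\<in>UNIV. norm (\<theta> i))"
  have T1: "1 \<le> T" by (simp add: T_def sum_nonneg)
  have T: "norm (\<theta> i) \<le> T" for i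
  proof -
    have "norm (\<theta> i) \<le> (\<Sum>i\<in>UNIV. norm (\<theta> i))" by (rule member_le_sum) auto
    then show ?thesis by (simp add: T_def)
  qed
  \<comment> \<open>Shifts have length at most \<open>2 * P * r * T\<close>; this slope turns the
    linearization error into \<open>r * e / 2\<close>.\<close>
  define \<kappa> where "\<kappa> = e / (4 * P * T)"
  have \<kappa>: "0 < \<kappa>" using e P T1 by (simp add: \<kappa>_def)
  have \<kappa>PT: "\<kappa> * (2 * P) * T = e / 2" using P T1 by (simp add: \<kappa>_def)
  obtain d where d: "0 < d" "\<And>y. norm (y - x) < d \<Longrightarrow> norm (p y - p x - G x \<bullet> (y - x)) \<le> \<kappa> * norm (y - x)"
    using gauge_derivative[OF x(1), unfolded has_derivative_at_alt] \<kappa> by blast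
  define m where "m = M x"
  have m: "0 \<le> m" by (simp add: m_def M_ge)
  define B where "B = P * m + e"
  have B: "0 < B" using P m e by (simp add: B_def add_nonneg_pos)
  \<comment> \<open>In order: validity of \<open>pr_le_iff\<close>, shifts within the radius
    \<open>d\<close>, candidate levels below \<open>2 * P\<close>, and the second-order term
    \<open>r * B * m\<close> below \<open>e / 2\<close>.\<close>
  define r0 where "r0 = min (1 / (2 * C)) (min (d / (4 * P * T)) (min (P / B) (e / (2 * B * (m + 1)))))"
  have r0: "0 < r0" using C_pos d P T1 B e m by (simp add: r0_def)
  have main: "dist ((pr r x - p x) / r) (p x * M x) < e0" if r: "0 < r" "r < r0" for r
  proof -
    have C0: "0 < C" using C_pos by simp
    have rC: "r * C \<le> 1 / 2" using r C0 by (simp add: r0_def field_simps)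
    have rd: "r * (4 * P * T) < d" using r P T1 by (simp add: r0_def pos_less_divide_eq)
    have rB: "r * B < P" using r B by (simp add: r0_def pos_less_divide_eq)
    have "r * (2 * B * (m + 1)) < e" using r B m by (simp add: r0_def pos_less_divide_eq)
    moreover have "r * B * m \<le> r * B * (m + 1)" using r B by (intro mult_left_mono) auto
    ultimately have rm: "r * B * m < e / 2" by (simp add: algebra_simps)
    note prl = pr_le_iff[OF less_imp_le[OF r(1)] rC]
    have est: "\<bar>p (x - (s * r) *\<^sub>R \<theta> i) - P + s * r * (\<theta> i \<bullet> G x)\<bar> \<le> r * (e / 2)"
      if s: "0 < s" "s \<le> 2 * P" for s i
    proof -
      have n1: "norm ((s * r) *\<^sub>R \<theta> i) \<le> (2 * P * r) * T"
      proof -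
        have "norm ((s * r) *\<^sub>R \<theta> i) = (s * r) * norm (\<theta> i)" using s r by simp
        also have "\<dots> \<le> (2 * P * r) * T" using s r T[of i] P by (intro mult_mono mult_right_mono) auto
        finally show ?thesis .
      qed
      also have "\<dots> < d"
      proof -
        have "2 * ((2 * P * r) * T) = r * (4 * P * T)" by simp
        then show ?thesis using rd d(1) by linarith
      qed
      finally have "norm ((x - (s * r) *\<^sub>R \<theta> i) - x) < d" by simp
      from d(2)[OF this] have "\<bar>p (x - (s * r) *\<^sub>R \<theta> i) - P + s * r * (\<theta> i \<bullet> G x)\<bar> \<le> \<kappa> * norm ((s * r) *\<^sub>R \<theta> i)"
        by (simp add: P_def inner_commute)
      also have "\<dots> \<le> \<kappa> * ((2 * P * r) * T)" using n1 \<kappa> by (intro mult_left_mono) auto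
      also have "\<dots> = r * (e / 2)" using \<kappa>PT by (simp add: algebra_simps)
      finally show ?thesis .
    qed
    have up: "pr r x \<le> P + r * B"
    proof -
      define s where "s = P + r * B"
      have s: "0 < s" "s \<le> 2 * P" using P r B rB by (auto simp: s_def add_pos_pos)
      have "p (x - (s * r) *\<^sub>R \<theta> i) \<le> s" for i
      proof -
        have "- (\<theta> i \<bullet> G x) \<le> m" unfolding m_def by (rule M_ge)
        then have "(s * r) * (- (\<theta> i \<bullet> G x)) \<le> (s * r) * m" using s r by (intro mult_left_mono) auto
        then have "- (s * r * (\<theta> i \<bullet> G x)) \<le> s * r * m" by simp
        then have "p (x - (s * r) *\<^sub>R \<theta> i) \<le> P + (s * r) * m + r * (e / 2)"
          using est[OF s, of i] by linarith
        also have "\<dots> = P + r * (P * m + r * B * m + e / 2)" by (simp add: s_def algebra_simps)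
        also have "\<dots> \<le> P + r * B" using r rm by (intro add_left_mono mult_left_mono) (auto simp: B_def)
        finally show ?thesis by (simp add: s_def)
      qed
      moreover have "p x \<le> s" using r B by (simp add: P_def s_def)
      ultimately have "pr r x \<le> s" using prl[OF s(1)] by blast
      then show ?thesis by (simp add: s_def)
    qed
    \<comment> \<open>If \<open>P * m \<le> e\<close>, then \<open>p \<le> pr\<close> suffices.
      Otherwise the maximum is positive and attained at some \<open>i\<close>, and the test for this
      \<open>i\<close> excludes any lower level.\<close>
    have low: "P + r * (P * m - e) \<le> pr r x"
    proof (cases "P * m \<le> e")
      case True
      then have "r * (P * m - e) \<le> 0" using r by (simp add: mult_le_0_iff)
      then show ?thesis using gauge_le_pr[OF less_imp_le[OF r(1)] rC, of x] by (simp add: P_def)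
    next
      case False
      then have "0 < m" using P e m by (metis less_imp_le mult_zero_right not_le order_le_less)
      then obtain i where i: "m = - (\<theta> i \<bullet> G x)" using M_attained[of x] by (auto simp: m_def)
      let ?s = "P + r * (P * m - e)"
      have re: "0 < r * (P * m - e)" using r False by simp
      have "r * (P * m - e) \<le> r * B" using r e by (intro mult_left_mono) (auto simp: B_def)
      then have s: "0 < ?s" "?s \<le> 2 * P" using P re rB by auto
      show ?thesis
      proof (rule ccontr)
        assume "\<not> ?thesis"
        then have "pr r x \<le> ?s" by simp
        then have le: "p (x - (?s * r) *\<^sub>R \<theta> i) \<le> ?s" using prl[OF s(1)] by blast
        have "P * r * m \<le> ?s * r * m" using re r m by (intro mult_right_mono) auto
        moreover have "P + ?s * r * m - r * (e / 2) \<le> p (x - (?s * r) *\<^sub>R \<theta> i)"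
        proof -
          have "?s * r * m = - (?s * r * (\<theta> i \<bullet> G x))" unfolding i by simp
          then show ?thesis using est[OF s, of i] by linarith
        qed
        ultimately have "P + P * r * m - r * (e / 2) \<le> P + r * (P * m - e)" using le by linarith
        then have "r * e \<le> r * (e / 2)" by (simp add: algebra_simps)
        then show False using r e by simp
      qed
    qed
    have "\<bar>(pr r x - P) / r - P * m\<bar> \<le> e"
    proof -
      have "(pr r x - P) / r \<le> B" "P * m - e \<le> (pr r x - P) / r" using up low r by (auto simp: field_simps)
      then show ?thesis by (simp add: B_def abs_le_iff)
    qed
    then show ?thesis using e0 by (simp add: dist_real_def P_def m_def e_def)
  qed
  show "\<forall>\<^sub>F r in at_right 0. dist ((pr r x - p x) / r) (p x * M x) < e0"
    unfolding eventually_at_right_field using r0 main by blast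
qed

lemma inner_body_0: "inner_body 0 = K" by (auto simp: inner_body_def)

lemma inner_body_derivative:
  "((\<lambda>r. (measure lebesgue K - measure lebesgue (inner_body r)) / r) \<longlongrightarrow>
     (real DIM('a) + 1) * (\<integral>x. indicator K x * (p x * M x) \<partial>lborel)) (at_right 0)"
  unfolding tendsto_at_iff_sequentially
proof (intro allI impI)
  fix X :: "nat \<Rightarrow> real"
  assume X: "\<forall>i. X i \<in> {0<..} - {0}" "X \<longlonglongrightarrow> 0"
  have Xpos: "0 < X i" for i using X by auto
  define N where "N = real DIM('a) + 1"
  have N: "0 < N" by (simp add: N_def)
  have C0: "0 < C" using C_pos by simp
  have ev: "\<forall>\<^sub>F k in sequentially. X k * C \<le> 1 / 2"
  proof -
    have "\<forall>\<^sub>F k in sequentially. X k < 1 / (2 * C)" using X(2) C0 by (intro order_tendstoD(2)[of X 0]) auto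
    then show ?thesis by eventually_elim (use C0 in \<open>simp add: field_simps\<close>)
  qed
  then obtain k0 where k0: "\<And>k. k0 \<le> k \<Longrightarrow> X k * C \<le> 1 / 2" by (auto simp: eventually_sequentially)
  \<comment> \<open>Discards the finitely many terms for which \<open>pr\<close> is not
    controlled.\<close>
  define Y where "Y k = X (k + k0)" for k
  have Y: "0 < Y k" "0 \<le> Y k" "Y k * C \<le> 1 / 2" for k using Xpos k0 by (auto simp: Y_def less_imp_le)
  have Y0: "Y \<longlonglongrightarrow> 0" unfolding Y_def using X(2) by (rule LIMSEQ_ignore_initial_segment)
  define F where "F k x = (max 0 (1 - p x) - max 0 (1 - pr (Y k) x)) / Y k" for k x
  have quot: "(measure lebesgue K - measure lebesgue (inner_body (Y k))) / Y k = N * (\<integral>x. F k x \<partial>lborel)" for k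
  proof -
    have "(\<integral>x. F k x \<partial>lborel) = ((\<integral>x. max 0 (1 - p x) \<partial>lborel) - (\<integral>x. max 0 (1 - pr (Y k) x) \<partial>lborel)) / Y k"
      unfolding F_def using tent_integrable pr_tent_integrable[OF Y(2,3)[of k]] by simp
    then have "(\<integral>x. F k x \<partial>lborel) = (measure lebesgue K / N - measure lebesgue (inner_body (Y k)) / N) / Y k"
      unfolding tent_integral pr_tent_integral[OF Y(2,3)] N_def .
    moreover have "(a - b) / y = N * ((a / N - b / N) / y)" for a b y using N by (simp add: diff_divide_distrib[symmetric])
    ultimately show ?thesis by metis
  qed
  have lim: "(\<lambda>k. \<integral>x. F k x \<partial>lborel) \<longlonglongrightarrow> (\<integral>x. indicator K x * (p x * M x) \<partial>lborel)"
  proof (rule integral_dominated_convergence[where w = "\<lambda>x. 2 * C * indicator K x"])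
    show "(\<lambda>x. indicator K x * (p x * M x)) \<in> borel_measurable lborel" by measurable
    show "F k \<in> borel_measurable lborel" for k
      unfolding F_def using pr_measurable[OF Y(2,3)[of k]] by measurable
    have "integrable lborel (indicator K :: 'a \<Rightarrow> real)"
      using emeasure_compact_finite[OF compact_K] by (intro integrable_real_indicator) auto
    then show "integrable lborel (\<lambda>x. 2 * C * indicator K x)" by simp
    \<comment> \<open>Outside \<open>K\<close> both tents vanish because \<open>p \<le> pr\<close>;
      inside, the tent is 1-Lipschitz in the gauge and \<open>pr_le\<close> applies.\<close>
    have bd: "\<bar>F k x\<bar> \<le> 2 * C * indicator K x" for k x
    proof (cases "x \<in> K")
      case True
      then have px: "p x \<le> 1" by (simp add: mem_K_iff)
      have g: "p x \<le> pr (Y k) x" by (rule gauge_le_pr[OF Y(2,3)])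
      have "pr (Y k) x - p x \<le> 2 * (Y k * C) * p x" using pr_le[OF Y(2,3)[of k], of x] by (simp add: algebra_simps)
      also have "\<dots> \<le> 2 * (Y k * C) * 1" using px Y(2)[of k] C0 by (intro mult_left_mono) auto
      finally have "pr (Y k) x - p x \<le> Y k * (2 * C)" by simp
      moreover have "\<bar>max 0 (1 - p x) - max 0 (1 - pr (Y k) x)\<bar> \<le> pr (Y k) x - p x" using g by (auto simp: max_def)
      ultimately have "\<bar>max 0 (1 - p x) - max 0 (1 - pr (Y k) x)\<bar> \<le> Y k * (2 * C)" by linarith
      then have "\<bar>max 0 (1 - p x) - max 0 (1 - pr (Y k) x)\<bar> / Y k \<le> 2 * C"
        unfolding pos_divide_le_eq[OF Y(1)] by (simp only: mult.commute)
      then have "\<bar>F k x\<bar> \<le> 2 * C" unfolding F_def abs_divide abs_of_pos[OF Y(1)] .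
      then show ?thesis using True by simp
    next
      case False
      then have "1 < p x" by (simp add: mem_K_iff)
      moreover have "p x \<le> pr (Y k) x" by (rule gauge_le_pr[OF Y(2,3)])
      ultimately show ?thesis using False by (simp add: F_def)
    qed
    then show "AE x in lborel. norm (F k x) \<le> 2 * C * indicator K x" for k by simp
    \<comment> \<open>Excluded are the kinks of \<open>p\<close>, the origin, and the boundary of
      \<open>K\<close>, where the tent itself has a kink.\<close>
    have "negligible (- D)" by (rule negligible_not_D)
    moreover have "negligible (frontier K)" by (rule negligible_convex_frontier[OF convex_K])
    ultimately have "negligible (- D \<union> frontier K \<union> {0})" by auto
    moreover have "- D \<union> frontier K \<union> {0} \<in> sets borel" by (auto simp: frontier_closed borel_closed)
    ultimately have "- D \<union> frontier K \<union> {0} \<in> null_sets lborel"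
      by (rule negligible_borel_null_sets)
    then have "AE x in lborel. x \<notin> - D \<union> frontier K \<union> {0}" by (rule AE_not_in)
    then show "AE x in lborel. (\<lambda>k. F k x) \<longlonglongrightarrow> indicator K x * (p x * M x)"
    proof eventually_elim
      case (elim x)
      then have x: "x \<in> D" "x \<noteq> 0" "p x \<noteq> 1" by (auto simp: frontier_K)
      have "filterlim Y (at_right 0) sequentially" using Y0 by (simp add: filterlim_at Y(1) order_less_imp_not_eq2[OF Y(1)])
      then have L: "(\<lambda>k. (pr (Y k) x - p x) / Y k) \<longlonglongrightarrow> p x * M x"
        by (rule filterlim_compose[OF tendsto_pr_derivative[OF x(1,2)]])
      show ?case
      proof (cases "p x < 1")
        case True
        \<comment> \<open>At interior points both tents are eventually positive, so their difference
          is that of the gauges.\<close>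
        have "(\<lambda>k. (1 + 2 * (Y k * C)) * p x) \<longlonglongrightarrow> (1 + 2 * (0 * C)) * p x" by (intro tendsto_intros Y0)
        then have "\<forall>\<^sub>F k in sequentially. (1 + 2 * (Y k * C)) * p x < 1" using True by (intro order_tendstoD(2)) auto
        then have "\<forall>\<^sub>F k in sequentially. (pr (Y k) x - p x) / Y k = F k x"
        proof eventually_elim
          case (elim k)
          then have "pr (Y k) x < 1" using pr_le[OF Y(2,3)[of k], of x] by linarith
          then show ?case using True by (simp add: F_def)
        qed
        then have "(\<lambda>k. F k x) \<longlonglongrightarrow> p x * M x" using L by (rule Lim_transform_eventually[rotated])
        then show ?thesis using True by (simp add: mem_K_iff)
      next
        case False
        then have "1 < p x" using x by simp
        then have "F k x = 0" for k using gauge_le_pr[OF Y(2,3)[of k], of x] by (simp add: F_def)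
        then show ?thesis using \<open>1 < p x\<close> by (simp add: mem_K_iff)
      qed
    qed
  qed
  have "(\<lambda>k. (measure lebesgue K - measure lebesgue (inner_body (Y k))) / Y k) \<longlonglongrightarrow> N * (\<integral>x. indicator K x * (p x * M x) \<partial>lborel)"
    unfolding quot by (intro tendsto_intros lim)
  then have "(\<lambda>k. (measure lebesgue K - measure lebesgue (inner_body (X k))) / X k) \<longlonglongrightarrow> N * (\<integral>x. indicator K x * (p x * M x) \<partial>lborel)"
    unfolding Y_def by (rule LIMSEQ_offset)
  then show "((\<lambda>r. (measure lebesgue K - measure lebesgue (inner_body r)) / r) \<circ> X) \<longlonglongrightarrow>
      (real DIM('a) + 1) * (\<integral>x. indicator K x * (p x * M x) \<partial>lborel)"
    by (simp add: comp_def N_def)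
qed

end

section \<open>Comparison with the Hausdorff measure\<close>

lemma mem_translation_iff: "y \<in> (+) a ` S \<longleftrightarrow> y - a \<in> S" for a y :: "'a::ab_group_add"
  by (auto intro: image_eqI[of _ _ "y - a"])

lemma hausdorff_outer_translate:
  fixes A :: "'a::real_normed_vector set"
  shows "hausdorff_outer s ((+) a ` A) = hausdorff_outer s A"
proof -
  have le: "hausdorff_outer s ((+) a ` A) \<le> hausdorff_outer s A" for a and A :: "'a set"
    using hausdorff_outer_lipschitz_image[of 1 A "(+) a" s] by simp
  have "A = (+) (- a) ` ((+) a ` A)" by (auto simp: image_image)
  with le[of a A] le[of "- a" "(+) a ` A"] show ?thesis by (metis antisym)
qed

lemma distr_hausdorff_measure_translate:
  "distr (hausdorff_measure s) borel (\<lambda>y. y - a) = (hausdorff_measure s :: 'a::real_normed_vector measure)"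
proof (rule measure_eqI)
  fix A assume "A \<in> sets (distr (hausdorff_measure s) borel (\<lambda>y. y - a))"
  then have [measurable]: "A \<in> sets borel" by simp
  have eq: "(\<lambda>y. y - a) -` A = (+) a ` A" by (simp add: set_eq_iff mem_translation_iff)
  have m [measurable]: "(\<lambda>y::'a. y - a) \<in> borel_measurable borel"
    by (intro borel_measurable_continuous_onI continuous_intros)
  have "(\<lambda>y. y - a) -` A \<in> sets borel" using measurable_sets_borel[OF m, of A] by simp
  then have [measurable]: "(+) a ` A \<in> sets borel" by (simp only: eq)
  have "emeasure (distr (hausdorff_measure s) borel (\<lambda>y. y - a)) A = emeasure (hausdorff_measure s) ((+) a ` A)"
    by (subst emeasure_distr) (auto simp: eq)
  also have "\<dots> = emeasure (hausdorff_measure s) A" by (simp add: emeasure_hausdorff_measure hausdorff_outer_translate)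
  finally show "emeasure (distr (hausdorff_measure s) borel (\<lambda>y. y - a)) A = emeasure (hausdorff_measure s) A" .
qed simp

text \<open>The pieces are made disjoint first, which is why the local inequality is asked for all
  measurable subsets of a piece.\<close>

lemma emeasure_le_by_pieces:
  fixes P :: "nat \<Rightarrow> 'a set"
  assumes sets: "sets N = sets M" and P: "\<And>i. P i \<in> sets M" and E: "E \<in> sets M" "E \<subseteq> (\<Union>i. P i)"
    and le: "\<And>i F. F \<in> sets M \<Longrightarrow> F \<subseteq> P i \<inter> E \<Longrightarrow> emeasure M F \<le> c * emeasure N F"
  shows "emeasure M E \<le> c * emeasure N E"
proof -
  define Q where "Q i = disjointed P i \<inter> E" for i
  have Q: "Q i \<in> sets M" for i unfolding Q_def using sets.range_disjointed_sets[of P M] P E by auto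
  have disj: "disjoint_family Q" using disjoint_family_disjointed[of P] by (auto simp: Q_def disjoint_family_on_def)
  have UQ: "(\<Union>i. Q i) = E" using E(2) UN_disjointed_eq[of P] by (auto simp: Q_def)
  have "emeasure M E = (\<Sum>i. emeasure M (Q i))"
    using suminf_emeasure[of Q M] Q disj UQ by (auto simp: image_subset_iff)
  also have "\<dots> \<le> (\<Sum>i. c * emeasure N (Q i))"
    using disjointed_subset[of P] by (intro suminf_le le Q) (auto simp: Q_def)
  also have "\<dots> = c * (\<Sum>i. emeasure N (Q i))" by simp
  also have "(\<Sum>i. emeasure N (Q i)) = emeasure N E"
    using suminf_emeasure[of Q N] Q disj UQ sets by (auto simp: image_subset_iff)
  finally show ?thesis .
qed

section \<open>The surface measure and its comparison with Hausdorff measure\<close>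

context centered_body_cart
begin

definition surface :: "(real^'n) measure" where
  "surface = distr (density lborel (\<lambda>x. ennreal ((real CARD('n) + 1) * p x * norm (G x)) * indicator K x)) borel radial"

lemma sets_surface [simp, measurable_cong]: "sets surface = sets borel"
  by (simp add: surface_def)

lemma nn_integral_surface:
  assumes [measurable]: "f \<in> borel_measurable borel"
  shows "(\<integral>\<^sup>+y. f y \<partial>surface) = (\<integral>\<^sup>+x. ennreal ((real CARD('n) + 1) * p x * norm (G x)) * indicator K x * f (radial x) \<partial>lborel)"
  unfolding surface_def by (subst nn_integral_distr, simp, simp, subst nn_integral_density) auto

lemma emeasure_surface:
  assumes [measurable]: "E \<in> sets borel"
  shows "emeasure surface E = (\<integral>\<^sup>+x. ennreal ((real CARD('n) + 1) * p x * norm (G x)) * indicator {x\<in>K. radial x \<in> E} x \<partial>lborel)"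
proof -
  have "emeasure surface E = (\<integral>\<^sup>+y. indicator E y \<partial>surface)" by simp
  also have "\<dots> = (\<integral>\<^sup>+x. ennreal ((real CARD('n) + 1) * p x * norm (G x)) * indicator {x\<in>K. radial x \<in> E} x \<partial>lborel)"
    by (subst nn_integral_surface) (auto intro!: nn_integral_cong simp: indicator_def)
  finally show ?thesis .
qed

lemma AE_smooth: "AE x in lborel. x \<in> D \<and> x \<noteq> 0"
proof -
  have "AE x in lborel. x \<notin> - D \<union> {0}"
    by (rule AE_not_in, rule negligible_borel_null_sets) (auto simp: negligible_not_D)
  then show ?thesis by eventually_elim auto
qed

text \<open>Lets the limit in \<open>\<epsilon>\<close> be taken in the reals and makes the sheets
  admissible for \<open>hausdorff_hyperplane_le\<close>.\<close>

lemma emeasure_surface_finite: "emeasure surface E < top"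
proof -
  have "emeasure surface E \<le> emeasure surface UNIV" by (intro emeasure_mono) auto
  also have "emeasure surface UNIV = (\<integral>\<^sup>+x. ennreal ((real CARD('n) + 1) * p x * norm (G x)) * indicator K x \<partial>lborel)"
    using emeasure_surface[of UNIV] by simp
  also have "\<dots> \<le> (\<integral>\<^sup>+x. ennreal ((real CARD('n) + 1) * (1 / \<rho>)) * indicator K x \<partial>lborel)"
  proof (rule nn_integral_mono_AE)
    show "AE x in lborel. ennreal ((real CARD('n) + 1) * p x * norm (G x)) * indicator K x
        \<le> ennreal ((real CARD('n) + 1) * (1 / \<rho>)) * indicator K x"
      using AE_smooth
    proof eventually_elim
      case (elim x)
      have "p x * norm (G x) \<le> 1 * (1 / \<rho>)" if "x \<in> K"
        using that elim norm_G_le[of x] gauge_nonneg[of x] by (intro mult_mono) (auto simp: mem_K_iff)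
      then have "(real CARD('n) + 1) * p x * norm (G x) \<le> (real CARD('n) + 1) * (1 / \<rho>)" if "x \<in> K"
        unfolding mult.assoc using that by (intro mult_left_mono) auto
      then show ?case by (auto simp: indicator_def intro: ennreal_leI)
    qed
  qed
  also have "\<dots> = ennreal ((real CARD('n) + 1) * (1 / \<rho>)) * emeasure lborel K"
    by (subst nn_integral_cmult_indicator) auto
  also have "\<dots> < top" using emeasure_compact_finite[OF compact_K] by (simp add: ennreal_mult_less_top)
  finally show ?thesis .
qed

text \<open>On \<open>flat_piece \<epsilon> u k q\<close> the normals are close to \<open>u\<close> and all chords are almost orthogonal to \<open>u\<close>.\<close>

definition flat_piece :: "real \<Rightarrow> real^'n \<Rightarrow> nat \<Rightarrow> real^'n \<Rightarrow> (real^'n) set" where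
  "flat_piece \<epsilon> u k q = {b. p b = 1 \<and> b \<in> D \<and> (1 - \<epsilon>) * norm (G b) \<le> G b \<bullet> u} \<inter>
     ball q (min (1 / (2 * real (Suc k))) (\<epsilon> / 2)) \<inter>
     (\<Inter>z\<in>{z. p z = 1}. {b. 1 / real (Suc k) \<le> norm (z - b)} \<union> {b. \<bar>u \<bullet> (z - b)\<bar> \<le> 2 * \<epsilon> * norm (z - b)})"

text \<open>The intersection over all boundary points \<open>z\<close> is uncountable, but its
  members are closed.\<close>

lemma flat_piece_borel: "flat_piece \<epsilon> u k q \<in> sets borel"
proof -
  have "closed (\<Inter>z\<in>{z. p z = 1}. {b. 1 / real (Suc k) \<le> norm (z - b)} \<union> {b. \<bar>u \<bullet> (z - b)\<bar> \<le> 2 * \<epsilon> * norm (z - b)})"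
    by (intro closed_INT ballI closed_Un closed_Collect_le continuous_intros)
  moreover have "{b. p b = 1 \<and> b \<in> D \<and> (1 - \<epsilon>) * norm (G b) \<le> G b \<bullet> u} \<in> sets borel" by measurable
  ultimately show ?thesis unfolding flat_piece_def
    by (intro sets.Int) (auto intro: borel_open borel_closed)
qed

lemma G_nonzero: "b \<in> D \<Longrightarrow> p b = 1 \<Longrightarrow> G b \<noteq> 0"
  using G_inner_self[of b] by auto

text \<open>The unit normal is approximated by some \<open>u\<close> of the dense set, and
  differentiability at \<open>b\<close> makes chords shorter than some \<open>1 / (k + 1)\<close>
  nearly orthogonal to the gradient. With countable \<open>U\<close> and \<open>Q\<close> the pieces
  are countably many.\<close>

lemma flat_piece_cover:
  assumes b: "b \<in> D" "p b = 1" and \<epsilon>: "0 < \<epsilon>"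
    and U: "sphere 0 1 \<subseteq> closure U" and Q: "closure Q = UNIV"
  shows "\<exists>u\<in>U. \<exists>k. \<exists>q\<in>Q. b \<in> flat_piece \<epsilon> u k q"
proof -
  have Gb: "G b \<noteq> 0" by (rule G_nonzero[OF b])
  define v where "v = (1 / norm (G b)) *\<^sub>R G b"
  have nv: "norm v = 1" using Gb by (simp add: v_def)
  then obtain u where u: "u \<in> U" "dist u v < \<epsilon>" using U \<epsilon> closure_approachable[of v U] by (auto simp: subset_eq)
  have uv: "norm (u - v) \<le> \<epsilon>" using u by (simp add: dist_norm)
  have Gv: "G b = norm (G b) *\<^sub>R v" using Gb by (simp add: v_def)
  have "1 - \<epsilon> \<le> v \<bullet> u"
  proof -
    have "v \<bullet> u = v \<bullet> v + v \<bullet> (u - v)" by (simp add: inner_diff_right)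
    moreover have "v \<bullet> v = 1" using nv by (simp add: dot_square_norm)
    moreover have "\<bar>v \<bullet> (u - v)\<bar> \<le> \<epsilon>" using Cauchy_Schwarz_ineq2[of v "u - v"] nv uv by simp
    ultimately show ?thesis by linarith
  qed
  then have "(1 - \<epsilon>) * norm (G b) \<le> (v \<bullet> u) * norm (G b)" by (rule mult_right_mono) simp
  then have near: "(1 - \<epsilon>) * norm (G b) \<le> G b \<bullet> u"
    by (subst (2) Gv) (simp add: mult.commute)
  \<comment> \<open>Of the bound \<open>2 * \<epsilon>\<close> one half comes from the
    linearization, relative to \<open>norm (G b)\<close>, the other from
    \<open>norm (u - v)\<close>.\<close>
  define e where "e = \<epsilon> * norm (G b)"
  have e: "0 < e" using \<epsilon> Gb by (simp add: e_def)
  obtain d where d: "0 < d" "\<And>z. norm (z - b) < d \<Longrightarrow> norm (p z - p b - G b \<bullet> (z - b)) \<le> e * norm (z - b)"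
    using gauge_derivative[OF b(1), unfolded has_derivative_at_alt] e by blast
  obtain k :: nat where k: "1 / real (Suc k) < d" using nat_approx_posE[OF d(1)] by blast
  have flat: "\<bar>u \<bullet> (z - b)\<bar> \<le> 2 * \<epsilon> * norm (z - b)" if z: "p z = 1" "norm (z - b) < 1 / real (Suc k)" for z
  proof -
    have "\<bar>G b \<bullet> (z - b)\<bar> \<le> e * norm (z - b)" using d(2)[of z] z k b by simp
    then have "norm (G b) * \<bar>v \<bullet> (z - b)\<bar> \<le> norm (G b) * (\<epsilon> * norm (z - b))"
      by (subst (asm) Gv) (simp add: abs_mult e_def mult_ac)
    then have "\<bar>v \<bullet> (z - b)\<bar> \<le> \<epsilon> * norm (z - b)" using Gb by (simp add: mult_le_cancel_left)
    moreover have "\<bar>(u - v) \<bullet> (z - b)\<bar> \<le> \<epsilon> * norm (z - b)"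
      using Cauchy_Schwarz_ineq2[of "u - v" "z - b"] uv mult_right_mono[OF uv, of "norm (z - b)"] by simp
    moreover have "u \<bullet> (z - b) = v \<bullet> (z - b) + (u - v) \<bullet> (z - b)" by (simp add: inner_diff_left)
    ultimately show ?thesis by linarith
  qed
  define \<delta> where "\<delta> = min (1 / (2 * real (Suc k))) (\<epsilon> / 2)"
  have "0 < \<delta>" using \<epsilon> by (simp add: \<delta>_def)
  then obtain q where q: "q \<in> Q" "dist q b < \<delta>" using Q closure_approachable[of b Q] by auto
  have "b \<in> flat_piece \<epsilon> u k q"
    unfolding flat_piece_def \<delta>_def[symmetric]
  proof (intro IntI INT_I)
    fix z assume "z \<in> {z. p z = 1}"
    then show "b \<in> {b. 1 / real (Suc k) \<le> norm (z - b)} \<union> {b. \<bar>u \<bullet> (z - b)\<bar> \<le> 2 * \<epsilon> * norm (z - b)}"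
      using flat[of z] by (cases "norm (z - b) < 1 / real (Suc k)") (auto simp del: of_nat_Suc)
  qed (use b near q(2) in auto)
  then show ?thesis using u q by blast
qed

text \<open>Both measures are compared with the volume of the sheet of height 1 over
  \<open>E\<close>. The factor \<open>1 - \<epsilon>\<close> bounds the tilt of the normals against
  \<open>u\<close>, the square root the distortion of the projection along \<open>u\<close>, and
  \<open>1 - 2 * \<epsilon>\<close> is the height of a straight slab contained in the sheet.\<close>

lemma flat_piece_compare:
  assumes \<epsilon>: "0 < \<epsilon>" "\<epsilon> < 1/4" and u: "norm u = 1"
    and [measurable]: "E \<in> sets borel" and E: "E \<subseteq> flat_piece \<epsilon> u k q"
  shows "ennreal (1 - \<epsilon>) * emeasure surface E \<le> hausdorff_outer (CARD('n) - 1) E"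
    and "hausdorff_outer (CARD('n) - 1) E \<le> ennreal ((1 / sqrt (1 - 4 * \<epsilon>\<^sup>2)) ^ (CARD('n) - 1) / (1 - 2 * \<epsilon>)) * emeasure surface E"
proof -
  define s where "s = CARD('n) - 1"
  have dim: "DIM(real^'n) - 1 = s" by (simp add: s_def)
  have uu: "u \<bullet> u = 1" using u by (simp add: dot_square_norm)
  define N where "N = real CARD('n) + 1"
  have N: "0 < N" by (simp add: N_def)
  have Eb: "p b = 1" "b \<in> D" "(1 - \<epsilon>) * norm (G b) \<le> G b \<bullet> u" "0 < G b \<bullet> u" if "b \<in> E" for b
  proof -
    show 1: "p b = 1" "b \<in> D" "(1 - \<epsilon>) * norm (G b) \<le> G b \<bullet> u" using that E by (auto simp: flat_piece_def)
    have "0 < (1 - \<epsilon>) * norm (G b)" using \<epsilon> G_nonzero[OF 1(2,1)] by simp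
    then show "0 < G b \<bullet> u" using 1 by linarith
  qed
  define W where "W = {b + t *\<^sub>R u | b t. b \<in> E \<and> 0 < t \<and> t \<le> 1}"
  have W: "W \<in> sets lebesgue"
    and eW: "emeasure lebesgue W = (\<integral>\<^sup>+x. ennreal (N * p x * max 0 (G x \<bullet> u)) * indicator {x\<in>K. radial x \<in> E} x \<partial>lborel)"
    using sheet_emeasure[of E u] Eb by (auto simp: W_def N_def)
  have Gx: "G (radial x) = G x" if "radial x \<in> E" for x
  proof -
    have "x \<noteq> 0" using Eb(1)[OF that] by (auto simp: radial_def)
    then show ?thesis using smooth_radial(2)[of x] Eb(2)[OF that] by simp
  qed
  have eS: "emeasure surface E = (\<integral>\<^sup>+x. ennreal (N * p x * norm (G x)) * indicator {x\<in>K. radial x \<in> E} x \<partial>lborel)"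
    by (simp add: emeasure_surface N_def)
  have cone [measurable]: "{x\<in>K. radial x \<in> E} \<in> sets borel" by (rule cone_measurable) simp
  have WS: "emeasure lebesgue W \<le> emeasure surface E"
    unfolding eW eS
  proof (rule nn_integral_mono)
    fix x
    have "G x \<bullet> u \<le> norm (G x)" using norm_cauchy_schwarz[of "G x" u] u by simp
    then have "N * p x * max 0 (G x \<bullet> u) \<le> N * p x * norm (G x)" using N gauge_nonneg[of x] by (intro mult_left_mono) auto
    then show "ennreal (N * p x * max 0 (G x \<bullet> u)) * indicator {x\<in>K. radial x \<in> E} x
        \<le> ennreal (N * p x * norm (G x)) * indicator {x\<in>K. radial x \<in> E} x"
      by (intro mult_right_mono ennreal_leI) auto
  qed
  have SW: "ennreal (1 - \<epsilon>) * emeasure surface E \<le> emeasure lebesgue W"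
  proof -
    have "ennreal (1 - \<epsilon>) * emeasure surface E = (\<integral>\<^sup>+x. ennreal (1 - \<epsilon>) * (ennreal (N * p x * norm (G x)) * indicator {x\<in>K. radial x \<in> E} x) \<partial>lborel)"
      unfolding eS by (rule nn_integral_cmult[symmetric]) measurable
    also have "\<dots> \<le> emeasure lebesgue W" unfolding eW
    proof (rule nn_integral_mono)
      fix x
      show "ennreal (1 - \<epsilon>) * (ennreal (N * p x * norm (G x)) * indicator {x\<in>K. radial x \<in> E} x)
          \<le> ennreal (N * p x * max 0 (G x \<bullet> u)) * indicator {x\<in>K. radial x \<in> E} x"
      proof (cases "radial x \<in> E")
        case True
        have "(1 - \<epsilon>) * norm (G x) \<le> G x \<bullet> u" using Eb(3)[OF True] Gx[OF True] by simp
        then have "(1 - \<epsilon>) * norm (G x) \<le> max 0 (G x \<bullet> u)" by simp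
        then have "(N * p x) * ((1 - \<epsilon>) * norm (G x)) \<le> (N * p x) * max 0 (G x \<bullet> u)"
          using N gauge_nonneg[of x] by (intro mult_left_mono) auto
        then have "(1 - \<epsilon>) * (N * p x * norm (G x)) \<le> N * p x * max 0 (G x \<bullet> u)" by (simp only: mult_ac)
        then have "ennreal (1 - \<epsilon>) * ennreal (N * p x * norm (G x)) \<le> ennreal (N * p x * max 0 (G x \<bullet> u))"
          using \<epsilon> N gauge_nonneg[of x] by (subst ennreal_mult[symmetric]) (auto intro: ennreal_leI)
        then show ?thesis by (auto simp: indicator_def)
      qed simp
    qed
    finally show ?thesis .
  qed
  have "emeasure lebesgue W \<le> hausdorff_outer s E"
    using emeasure_sheet_le_hausdorff[OF uu W, of E] unfolding dim by (simp add: W_def)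
  with SW show "ennreal (1 - \<epsilon>) * emeasure surface E \<le> hausdorff_outer (CARD('n) - 1) E" by (simp add: s_def)
  define L where "L = 1 / sqrt (1 - 4 * \<epsilon>\<^sup>2)"
  have e4: "0 < 1 - 4 * \<epsilon>\<^sup>2"
  proof -
    have "\<epsilon>\<^sup>2 < (1/4)\<^sup>2" using \<epsilon> by (intro power_strict_mono) auto
    then show ?thesis by (simp add: power2_eq_square)
  qed
  have L: "0 < L" using e4 by (simp add: L_def)
  define pj where "pj x = x - (u \<bullet> x) *\<^sub>R u" for x
  show "hausdorff_outer (CARD('n) - 1) E \<le> ennreal ((1 / sqrt (1 - 4 * \<epsilon>\<^sup>2)) ^ (CARD('n) - 1) / (1 - 2 * \<epsilon>)) * emeasure surface E"
  proof (cases "E = {}")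
    case False
    then obtain y0 where y0: "y0 \<in> E" by blast
    define c where "c = u \<bullet> y0"
    \<comment> \<open>The ball in \<open>flat_piece\<close> has half these radii, so chords within
      \<open>E\<close> are short enough for the flatness condition.\<close>
    have close: "norm (y - z) < \<epsilon>" "norm (y - z) < 1 / real (Suc k)" if "y \<in> E" "z \<in> E" for y z
    proof -
      define \<kappa> where "\<kappa> = 1 / real (Suc k)"
      have \<kappa>2: "1 / (2 * real (Suc k)) = \<kappa> / 2" by (simp add: \<kappa>_def)
      have "y \<in> ball q (min (1 / (2 * real (Suc k))) (\<epsilon> / 2))" "z \<in> ball q (min (1 / (2 * real (Suc k))) (\<epsilon> / 2))"
        using that E unfolding flat_piece_def by blast+
      then have "dist q y < min (\<kappa> / 2) (\<epsilon> / 2)" "dist q z < min (\<kappa> / 2) (\<epsilon> / 2)"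
        unfolding \<kappa>2 mem_ball by blast+
      then have "dist y z < \<kappa>" "dist y z < \<epsilon>"
        using dist_triangle3[of y z q] by linarith+
      then show "norm (y - z) < \<epsilon>" "norm (y - z) < 1 / real (Suc k)" unfolding dist_norm \<kappa>_def by blast+
    qed
    have flat: "\<bar>u \<bullet> (y - z)\<bar> \<le> 2 * \<epsilon> * norm (y - z)" if "y \<in> E" "z \<in> E" for y z
    proof -
      have "z \<in> {b. 1 / real (Suc k) \<le> norm (y - b)} \<union> {b. \<bar>u \<bullet> (y - b)\<bar> \<le> 2 * \<epsilon> * norm (y - b)}"
        using that E Eb(1)[OF that(1)] unfolding flat_piece_def by blast
      then show ?thesis using close(2)[OF that] by auto
    qed
    \<comment> \<open>The component along \<open>u\<close> is at most the fraction
      \<open>2 * \<epsilon>\<close> of the chord; Pythagoras bounds the projection from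
      below.\<close>
    have lip: "norm (y - z) \<le> L * norm (pj y - pj z)" if yz: "y \<in> E" "z \<in> E" for y z
    proof -
      have pd: "pj y - pj z = (y - z) - (u \<bullet> (y - z)) *\<^sub>R u" by (simp add: pj_def algebra_simps)
      have dec: "norm (y - z)^2 = norm (pj y - pj z)^2 + (u \<bullet> (y - z))^2"
        unfolding pd using norm_orth_decomp[OF uu, of "y - z" "u \<bullet> (y - z)"] by simp
      have "(u \<bullet> (y - z))^2 \<le> (2 * \<epsilon> * norm (y - z))^2"
        using flat[OF yz] by (metis abs_ge_zero power2_abs power_mono)
      also have "\<dots> = 4 * \<epsilon>\<^sup>2 * norm (y - z)^2" by (simp add: power_mult_distrib)
      finally have "(1 - 4 * \<epsilon>\<^sup>2) * norm (y - z)^2 \<le> norm (pj y - pj z)^2" using dec by (simp add: algebra_simps)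
      then have "(sqrt (1 - 4 * \<epsilon>\<^sup>2) * norm (y - z))^2 \<le> norm (pj y - pj z)^2" using e4 by (simp add: power_mult_distrib)
      then have "sqrt (1 - 4 * \<epsilon>\<^sup>2) * norm (y - z) \<le> norm (pj y - pj z)" by (rule power2_le_imp_le) simp
      then show ?thesis using e4 by (simp add: L_def field_simps)
    qed
    have inj: "inj_on pj E" by (rule inj_onI) (use lip in fastforce)
    define g where "g = inv_into E pj"
    have gE: "g ` pj ` E = E" using inj by (simp add: g_def image_image)
    have "hausdorff_outer s (g ` pj ` E) \<le> ennreal (L ^ s) * hausdorff_outer s (pj ` E)"
      by (rule hausdorff_outer_lipschitz_image[OF L]) (use lip inj in \<open>auto simp: g_def dist_norm\<close>)
    then have HE: "hausdorff_outer s E \<le> ennreal (L ^ s) * hausdorff_outer s (pj ` E)" by (simp only: gE)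
    \<comment> \<open>The \<open>u\<close>-coordinates of points of \<open>E\<close> differ from
      \<open>c\<close> by less than \<open>\<epsilon>\<close>, so every fibre of the sheet contains
      the heights from \<open>c + \<epsilon>\<close> to \<open>c + 1 - \<epsilon>\<close>.\<close>
    have HF: "ennreal ((c + 1 - \<epsilon>) - (c + \<epsilon>)) * hausdorff_outer (DIM(real^'n) - 1) (pj ` E) \<le> emeasure lebesgue W"
    proof (rule hausdorff_hyperplane_le[OF uu])
      show "u \<bullet> x = 0" if "x \<in> pj ` E" for x using that uu by (auto simp: pj_def inner_diff_right)
      show "c + \<epsilon> < c + 1 - \<epsilon>" using \<epsilon> by simp
      show "W \<in> sets lebesgue" by (rule W)
      show "emeasure lebesgue W < top" by (rule le_less_trans[OF WS emeasure_surface_finite])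
      show "x + \<tau> *\<^sub>R u \<in> W" if x: "x \<in> pj ` E" and \<tau>: "c + \<epsilon> < \<tau>" "\<tau> < c + 1 - \<epsilon>" for x \<tau>
      proof -
        obtain y where y: "y \<in> E" "x = pj y" using x by blast
        have "\<bar>u \<bullet> (y - y0)\<bar> \<le> norm (y - y0)" using Cauchy_Schwarz_ineq2[of u "y - y0"] u by simp
        then have "\<bar>u \<bullet> y - c\<bar> < \<epsilon>" using close(1)[OF y(1) y0] by (simp add: c_def inner_diff_right)
        then have "0 < \<tau> - u \<bullet> y" "\<tau> - u \<bullet> y \<le> 1" using \<tau> by linarith+
        moreover have "x + \<tau> *\<^sub>R u = y + (\<tau> - u \<bullet> y) *\<^sub>R u" by (simp add: y pj_def algebra_simps)
        ultimately show ?thesis using y unfolding W_def by blast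
      qed
    qed
    have t: "(c + 1 - \<epsilon>) - (c + \<epsilon>) = 1 - 2 * \<epsilon>" by simp
    have pos: "0 < 1 - 2 * \<epsilon>" using \<epsilon> by simp
    have "hausdorff_outer s (pj ` E) = ennreal (1 / (1 - 2 * \<epsilon>)) * (ennreal (1 - 2 * \<epsilon>) * hausdorff_outer s (pj ` E))"
      using pos by (simp add: mult.assoc[symmetric] ennreal_mult[symmetric])
    also have "\<dots> \<le> ennreal (1 / (1 - 2 * \<epsilon>)) * emeasure surface E"
      using HF WS unfolding t dim by (intro mult_left_mono) auto
    finally have "hausdorff_outer s E \<le> ennreal (L ^ s) * (ennreal (1 / (1 - 2 * \<epsilon>)) * emeasure surface E)"
      using HE by (meson mult_left_mono order_trans zero_le)
    also have "\<dots> = ennreal (L ^ s * (1 / (1 - 2 * \<epsilon>))) * emeasure surface E"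
      using L pos by (subst mult.assoc[symmetric], subst ennreal_mult[symmetric]) auto
    finally show ?thesis by (simp add: L_def s_def)
  qed simp
qed

text \<open>For every \<open>\<epsilon>\<close> countably many flat pieces cover the smooth
  boundary, with constants that do not depend on the piece and tend to 1 with
  \<open>\<epsilon>\<close> tending to 0.\<close>

lemma hausdorff_eq_surface:
  assumes E: "E \<in> sets borel" "E \<subseteq> {b. p b = 1} \<inter> D"
  shows "hausdorff_outer (CARD('n) - 1) E = emeasure surface E"
proof -
  let ?H = "hausdorff_measure (CARD('n) - 1) :: (real^'n) measure"
  define c where "c \<epsilon> = (1 / sqrt (1 - 4 * \<epsilon>\<^sup>2)) ^ (CARD('n) - 1) / (1 - 2 * \<epsilon>)" for \<epsilon> :: real
  obtain U :: "(real^'n) set" where U: "countable U" "U \<subseteq> sphere 0 1" "sphere 0 1 \<subseteq> closure U"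
    by (rule separable[of "sphere (0::real^'n) 1"]) (rule that; assumption)
  obtain Q :: "(real^'n) set" where Q: "countable Q" "UNIV \<subseteq> closure Q"
    by (rule separable[of "UNIV :: (real^'n) set"]) (rule that; assumption)
  have Une: "U \<noteq> {}"
  proof
    assume "U = {}"
    then have "sphere (0::real^'n) 1 \<subseteq> {}" using U(3) by (simp only: closure_empty)
    moreover have "axis undefined 1 \<in> sphere (0::real^'n) 1" by simp
    ultimately show False by blast
  qed
  have Qne: "Q \<noteq> {}"
  proof
    assume "Q = {}"
    then show False using Q(2) by (simp only: closure_empty) blast
  qed
  let ?I = "U \<times> (UNIV :: nat set) \<times> Q"
  have I: "countable ?I" "?I \<noteq> {}" using U Q Une Qne by auto
  define i where "i = from_nat_into ?I"
  have i: "range i = ?I" unfolding i_def by (rule range_from_nat_into[OF I(2,1)])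
  have two: "ennreal (1 - \<epsilon>) * emeasure surface E \<le> emeasure ?H E \<and> emeasure ?H E \<le> ennreal (c \<epsilon>) * emeasure surface E"
    if \<epsilon>: "0 < \<epsilon>" "\<epsilon> < 1/4" for \<epsilon>
  proof -
    define P where "P j = flat_piece \<epsilon> (fst (i j)) (fst (snd (i j))) (snd (snd (i j)))" for j
    have P: "P j \<in> sets borel" for j unfolding P_def by (rule flat_piece_borel)
    have u1: "norm (fst (i j)) = 1" for j
    proof -
      have "i j \<in> ?I" using i by blast
      then show ?thesis using U(2) by (auto simp: subset_eq)
    qed
    have cov: "E \<subseteq> (\<Union>j. P j)"
    proof
      fix b assume "b \<in> E"
      then have b: "b \<in> D" "p b = 1" using E by auto
      obtain u k q where uk: "u \<in> U" "q \<in> Q" "b \<in> flat_piece \<epsilon> u k q"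
        using flat_piece_cover[OF b \<epsilon>(1) U(3), of Q] Q(2) by blast
      then have "(u, k, q) \<in> range i" using i by auto
      then obtain j where "i j = (u, k, q)" by (metis rangeE)
      then have "b \<in> P j" using uk by (simp add: P_def)
      then show "b \<in> (\<Union>j. P j)" by blast
    qed
    have low: "emeasure surface E \<le> ennreal (1 / (1 - \<epsilon>)) * emeasure ?H E"
    proof (rule emeasure_le_by_pieces[where P = P])
      fix j F assume F: "F \<in> sets surface" "F \<subseteq> P j \<inter> E"
      then have Fb: "F \<in> sets borel" by simp
      have Fp: "F \<subseteq> flat_piece \<epsilon> (fst (i j)) (fst (snd (i j))) (snd (snd (i j)))" using F(2) by (simp add: P_def)
      have "ennreal (1 - \<epsilon>) * emeasure surface F \<le> emeasure ?H F"
        using flat_piece_compare(1)[OF \<epsilon> u1[of j] Fb Fp] Fb by (simp add: emeasure_hausdorff_measure)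
      then have "ennreal (1 / (1 - \<epsilon>)) * (ennreal (1 - \<epsilon>) * emeasure surface F) \<le> ennreal (1 / (1 - \<epsilon>)) * emeasure ?H F"
        by (rule mult_left_mono) simp
      then show "emeasure surface F \<le> ennreal (1 / (1 - \<epsilon>)) * emeasure ?H F"
        using \<epsilon> by (simp add: mult.assoc[symmetric] ennreal_mult[symmetric])
    qed (use P E cov in auto)
    then have "ennreal (1 - \<epsilon>) * emeasure surface E \<le> ennreal (1 - \<epsilon>) * (ennreal (1 / (1 - \<epsilon>)) * emeasure ?H E)"
      by (rule mult_left_mono) simp
    then have "ennreal (1 - \<epsilon>) * emeasure surface E \<le> emeasure ?H E"
      using \<epsilon> by (simp add: mult.assoc[symmetric] ennreal_mult[symmetric])
    moreover have "emeasure ?H E \<le> ennreal (c \<epsilon>) * emeasure surface E"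
    proof (rule emeasure_le_by_pieces[where P = P])
      fix j F assume F: "F \<in> sets ?H" "F \<subseteq> P j \<inter> E"
      then have Fb: "F \<in> sets borel" by simp
      have Fp: "F \<subseteq> flat_piece \<epsilon> (fst (i j)) (fst (snd (i j))) (snd (snd (i j)))" using F(2) by (simp add: P_def)
      show "emeasure ?H F \<le> ennreal (c \<epsilon>) * emeasure surface F"
        using flat_piece_compare(2)[OF \<epsilon> u1[of j] Fb Fp] Fb by (simp add: c_def emeasure_hausdorff_measure)
    qed (use P E cov in auto)
    ultimately show ?thesis by blast
  qed
  obtain v where v: "emeasure surface E = ennreal v" "0 \<le> v"
    using emeasure_surface_finite[of E] by (cases "emeasure surface E") auto
  have "emeasure ?H E < top"
    by (rule le_less_trans[OF conjunct2[OF two[of "1/8"]]]) (auto simp: v ennreal_mult_less_top)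
  then obtain h where h: "emeasure ?H E = ennreal h" "0 \<le> h" by (cases "emeasure ?H E") auto
  have ev: "\<forall>\<^sub>F \<epsilon>::real in at_right 0. 0 < \<epsilon> \<and> \<epsilon> < 1/4"
    by (rule eventually_at_rightI[of _ "1/4"]) auto
  have cpos: "0 < c \<epsilon>" if "0 < \<epsilon>" "\<epsilon> < 1/4" for \<epsilon>
  proof -
    have "\<epsilon>\<^sup>2 < (1/4)\<^sup>2" using that by (intro power_strict_mono) auto
    then have "0 < 1 - 4 * \<epsilon>\<^sup>2" by (simp add: power2_eq_square)
    then show ?thesis using that by (simp add: c_def)
  qed
  have real_two: "(1 - \<epsilon>) * v \<le> h \<and> h \<le> c \<epsilon> * v" if \<epsilon>: "0 < \<epsilon>" "\<epsilon> < 1/4" for \<epsilon>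
  proof -
    have "ennreal ((1 - \<epsilon>) * v) \<le> ennreal h" using two[OF \<epsilon>] \<epsilon> v h by (simp add: ennreal_mult)
    moreover have "ennreal h \<le> ennreal (c \<epsilon> * v)" using two[OF \<epsilon>] cpos[OF \<epsilon>] v h by (simp add: ennreal_mult)
    ultimately show ?thesis using v h cpos[OF \<epsilon>] by (simp add: ennreal_le_iff)
  qed
  have "((\<lambda>\<epsilon>. (1 - \<epsilon>) * v) \<longlongrightarrow> (1 - 0) * v) (at_right 0)" by (intro tendsto_intros)
  then have "(1 - 0) * v \<le> h"
    by (rule tendsto_upperbound) (use ev real_two in \<open>auto elim: eventually_mono\<close>)
  moreover have "((\<lambda>\<epsilon>. c \<epsilon> * v) \<longlongrightarrow> ((1 / sqrt (1 - 4 * 0\<^sup>2)) ^ (CARD('n) - 1) / (1 - 2 * 0)) * v) (at_right 0)"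
    unfolding c_def by (intro tendsto_intros) auto
  then have "h \<le> ((1 / sqrt (1 - 4 * 0\<^sup>2)) ^ (CARD('n) - 1) / (1 - 2 * 0)) * v"
    by (rule tendsto_lowerbound) (use ev real_two in \<open>auto elim: eventually_mono\<close>)
  ultimately have "h = v" by simp
  then show ?thesis using v h E by (simp add: emeasure_hausdorff_measure)
qed

text \<open>Smoothness is invariant under dilation, so the cone over the singular boundary points
  misses \<open>D\<close>, whose complement is null.\<close>

lemma hausdorff_singular_null: "hausdorff_outer (CARD('n) - 1) ({b. p b = 1} - D) = 0"
proof -
  have "hausdorff_outer (DIM(real^'n) - 1) ({b. p b = 1} - D) = 0"
  proof (rule hausdorff_outer_cone_null[of "1 / \<rho>" p])
    have "{\<tau> *\<^sub>R x |\<tau> x. x \<in> {b. p b = 1} - D \<and> 0 < \<tau> \<and> \<tau> \<le> 1} \<subseteq> - D"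
    proof clarify
      fix \<tau> :: real and x assume x: "p x = 1" "x \<notin> D" "0 < \<tau>" "\<tau> *\<^sub>R x \<in> D"
      then show False using smooth_scale(1)[of "\<tau> *\<^sub>R x" "1 / \<tau>"] by simp
    qed
    then show "negligible {\<tau> *\<^sub>R x |\<tau> x. x \<in> {b. p b = 1} - D \<and> 0 < \<tau> \<and> \<tau> \<le> 1}"
      by (rule negligible_subset[OF negligible_not_D])
  qed (use \<rho>_pos gauge_lipschitz gauge_scale in auto)
  then show ?thesis by simp
qed

end

context centered_body_cart
begin

lemma emeasure_surface_smooth:
  assumes [measurable]: "E \<in> sets borel"
  shows "emeasure surface (({b. p b = 1} \<inter> D) \<inter> E) = emeasure surface E"
proof -
  have [measurable]: "{b. p b = 1} \<inter> D \<in> sets borel" by measurable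
  have "AE x in lborel. ennreal ((real CARD('n) + 1) * p x * norm (G x)) * indicator {x\<in>K. radial x \<in> ({b. p b = 1} \<inter> D) \<inter> E} x
      = ennreal ((real CARD('n) + 1) * p x * norm (G x)) * indicator {x\<in>K. radial x \<in> E} x"
    using AE_smooth
  proof eventually_elim
    case (elim x)
    have "radial x \<in> D" unfolding radial_def using elim gauge_pos[of x] by (intro smooth_scale) auto
    moreover have "p (radial x) = 1" using elim by (intro gauge_radial) simp
    ultimately show ?case by (simp add: indicator_def)
  qed
  then show ?thesis by (subst (1 2) emeasure_surface) (auto intro: nn_integral_cong_AE)
qed

text \<open>Raises the equality on Borel sets of smooth points to one of measures, ready for
  integration. Almost every ray meets the boundary in a smooth point, so the restriction does not
  change \<open>surface\<close>.\<close>

lemma density_hausdorff_eq_surface: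
  "density (hausdorff_measure (CARD('n) - 1)) (indicator ({b. p b = 1} \<inter> D)) = surface"
proof (rule measure_eqI)
  let ?H = "hausdorff_measure (CARD('n) - 1) :: (real^'n) measure"
  have [measurable]: "{b. p b = 1} \<inter> D \<in> sets borel" by measurable
  fix E assume "E \<in> sets (density ?H (indicator ({b. p b = 1} \<inter> D)))"
  then have [measurable]: "E \<in> sets borel" by simp
  have "emeasure (density ?H (indicator ({b. p b = 1} \<inter> D))) E = (\<integral>\<^sup>+y. indicator ({b. p b = 1} \<inter> D) y * indicator E y \<partial>?H)"
    by (rule emeasure_density) measurable
  also have "\<dots> = (\<integral>\<^sup>+y. indicator (({b. p b = 1} \<inter> D) \<inter> E) y \<partial>?H)"
    by (intro nn_integral_cong) (simp add: indicator_def)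
  also have "\<dots> = emeasure ?H (({b. p b = 1} \<inter> D) \<inter> E)" by (rule nn_integral_indicator) measurable
  also have "\<dots> = hausdorff_outer (CARD('n) - 1) (({b. p b = 1} \<inter> D) \<inter> E)"
    by (rule emeasure_hausdorff_measure) measurable
  also have "\<dots> = emeasure surface (({b. p b = 1} \<inter> D) \<inter> E)"
    by (rule hausdorff_eq_surface) (measurable, blast)
  also have "\<dots> = emeasure surface E" by (rule emeasure_surface_smooth) simp
  finally show "emeasure (density ?H (indicator ({b. p b = 1} \<inter> D))) E = emeasure surface E" .
qed simp

end

section \<open>The boundary integral and the covariogram\<close>

locale cart_body_with_directions = centered_body_cart K \<rho> + body_with_directions K \<rho> \<theta>
  for K :: "(real^'n) set" and \<rho> and \<theta> :: "'m::finite \<Rightarrow> real^'n"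
begin

text \<open>Normalizing the gradient divides every term by the same positive length, which commutes
  with the maximum. That length later cancels against the density of \<open>surface\<close>.\<close>

lemma Max_negpart_normal:
  assumes y: "p y = 1" "y \<in> D"
  shows "Max (range (\<lambda>i. negpart (\<theta> i \<bullet> outer_normal K y))) = M y / norm (G y)"
proof -
  define g where "g = norm (G y)"
  have g: "0 < g" using G_nonzero[OF y(2,1)] by (simp add: g_def)
  have "negpart (\<theta> i \<bullet> outer_normal K y) = max 0 (- (\<theta> i \<bullet> G y)) / g" for i
    unfolding outer_normal_eq[OF y] using g by (simp add: negpart_def g_def[symmetric] max_def divide_le_0_iff zero_le_divide_iff)
  then have "range (\<lambda>i. negpart (\<theta> i \<bullet> outer_normal K y)) = (\<lambda>t. t / g) ` range (\<lambda>i. max 0 (- (\<theta> i \<bullet> G y)))"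
    by (simp add: image_image)
  moreover have mono: "mono (\<lambda>t. t / g)" using g by (auto intro!: monoI divide_right_mono)
  ultimately show ?thesis unfolding M_def g_def[symmetric]
    using mono_Max_commute[OF mono, of "range (\<lambda>i. max 0 (- (\<theta> i \<bullet> G y)))"] by simp
qed

lemma integrable_pM: "integrable lborel (\<lambda>x. indicator K x * (p x * M x))"
proof -
  define T where "T = (\<Sum>i\<in>UNIV. norm (\<theta> i))"
  have T: "0 \<le> T" by (simp add: T_def sum_nonneg)
  have "integrable lborel (indicator K :: real^'n \<Rightarrow> real)"
    using emeasure_compact_finite[OF compact_K] by (intro integrable_real_indicator) auto
  then have "integrable lborel (\<lambda>x. (T / \<rho>) * indicator K x)" by simp
  then show ?thesis
  proof (rule Bochner_Integration.integrable_bound)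
    show "AE x in lborel. norm (indicator K x * (p x * M x)) \<le> norm ((T / \<rho>) * indicator K x)"
      using AE_smooth
    proof eventually_elim
      case (elim x)
      have "M x \<le> T / \<rho>" unfolding M_def
      proof (rule Max.boundedI)
        fix a assume "a \<in> range (\<lambda>i. max 0 (- (\<theta> i \<bullet> G x)))"
        then obtain i where a: "a = max 0 (- (\<theta> i \<bullet> G x))" by blast
        have "- (\<theta> i \<bullet> G x) \<le> norm (\<theta> i) * norm (G x)" using Cauchy_Schwarz_ineq2[of "\<theta> i" "G x"] by simp
        also have "\<dots> \<le> T * (1 / \<rho>)"
          using elim norm_G_le[of x] T member_le_sum[of i UNIV "\<lambda>i. norm (\<theta> i)"] unfolding T_def by (intro mult_mono) auto
        finally show "a \<le> T / \<rho>" unfolding a using T \<rho>_pos by simp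
      qed auto
      then have "p x * M x \<le> 1 * (T / \<rho>)" if "x \<in> K"
        using that M_ge(1)[of x] gauge_nonneg[of x] by (intro mult_mono) (auto simp: mem_K_iff)
      then show ?case using M_ge(1)[of x] gauge_nonneg[of x] T \<rho>_pos by (auto simp: indicator_def)
    qed
  qed measurable
qed

text \<open>\<open>G\<close> and \<open>M\<close> are constant along rays; pulled back to
  \<open>K\<close>, the factor \<open>norm (G x)\<close> cancels and the integral from
  \<open>inner_body_derivative\<close> remains.\<close>

lemma surface_integral_M:
  "(\<integral>\<^sup>+y. ennreal (M y / norm (G y)) * indicator ({b. p b = 1} \<inter> D) y \<partial>hausdorff_measure (CARD('n) - 1))
    = ennreal ((real CARD('n) + 1) * (\<integral>x. indicator K x * (p x * M x) \<partial>lborel))"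
proof -
  let ?H = "hausdorff_measure (CARD('n) - 1) :: (real^'n) measure"
  define N where "N = real CARD('n) + 1"
  have N: "0 < N" by (simp add: N_def)
  have [measurable]: "{b. p b = 1} \<inter> D \<in> sets borel" by measurable
  have "(\<integral>\<^sup>+y. ennreal (M y / norm (G y)) * indicator ({b. p b = 1} \<inter> D) y \<partial>?H)
      = (\<integral>\<^sup>+y. indicator ({b. p b = 1} \<inter> D) y * ennreal (M y / norm (G y)) \<partial>?H)" by (simp only: mult.commute)
  also have "\<dots> = (\<integral>\<^sup>+y. ennreal (M y / norm (G y)) \<partial>density ?H (indicator ({b. p b = 1} \<inter> D)))"
    by (rule nn_integral_density[symmetric]) measurable
  also have "\<dots> = (\<integral>\<^sup>+y. ennreal (M y / norm (G y)) \<partial>surface)" by (simp only: density_hausdorff_eq_surface)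
  also have "\<dots> = (\<integral>\<^sup>+x. ennreal (N * p x * norm (G x)) * indicator K x * ennreal (M (radial x) / norm (G (radial x))) \<partial>lborel)"
    unfolding N_def by (rule nn_integral_surface) measurable
  also have "\<dots> = (\<integral>\<^sup>+x. ennreal (N * (indicator K x * (p x * M x))) \<partial>lborel)"
  proof (rule nn_integral_cong_AE)
    show "AE x in lborel. ennreal (N * p x * norm (G x)) * indicator K x * ennreal (M (radial x) / norm (G (radial x)))
        = ennreal (N * (indicator K x * (p x * M x)))"
      using AE_smooth
    proof eventually_elim
      case (elim x)
      have "G (radial x) = G x" unfolding radial_def using elim gauge_pos[of x] by (intro smooth_scale) auto
      moreover from this have "M (radial x) = M x" by (simp add: M_def)
      moreover have "G x \<noteq> 0" using elim G_inner_self[of x] by auto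
      moreover have "0 \<le> p x" "0 \<le> M x" by (auto simp: gauge_nonneg M_ge)
      ultimately show ?case using N by (auto simp: indicator_def ennreal_mult[symmetric])
    qed
  qed
  also have "\<dots> = ennreal (\<integral>x. N * (indicator K x * (p x * M x)) \<partial>lborel)"
    using N M_ge(1) gauge_nonneg by (intro nn_integral_eq_integral integrable_mult_right integrable_pM) (auto intro!: AE_I2)
  also have "(\<integral>x. N * (indicator K x * (p x * M x)) \<partial>lborel) = N * (\<integral>x. indicator K x * (p x * M x) \<partial>lborel)"
    using integrable_pM by simp
  finally show ?thesis by (simp add: N_def)
qed

end

lemma outer_normal_translate: "outer_normal ((+) a ` K) (a + y) = outer_normal K y"
  unfolding outer_normal_def by simp

theorem theorem1p1:
  fixes K :: "(real^'n) set" and \<theta> :: "real^'n^'m"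
  assumes "convex_body K" and "norm \<theta> = 1"
  defines "I \<equiv> (\<integral>\<^sup>+ y \<in> frontier K.
              ennreal (Max (range (\<lambda>i. negpart (inner (\<theta> $ i) (outer_normal K y)))))
            \<partial>hausdorff_measure (CARD('n) - 1))"
  shows "I < \<infinity> \<and>
         ((\<lambda>r. covariogram K (r *\<^sub>R \<theta>)) has_real_derivative (- enn2real I)) (at_right 0)"
proof -
  let ?H = "hausdorff_measure (CARD('n) - 1) :: (real^'n) measure"
  have K: "compact K" "convex K" "interior K \<noteq> {}" using assms(1) by (auto simp: convex_body_def)
  obtain a where "a \<in> interior K" using K by blast
  then obtain \<rho> where \<rho>: "0 < \<rho>" "cball a \<rho> \<subseteq> K" by (meson mem_interior_cball)
  define K0 where "K0 = (+) (- a) ` K"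
  have KK0: "K = (+) a ` K0" by (simp add: K0_def image_image)
  interpret cart_body_with_directions K0 \<rho> "\<lambda>i. \<theta> $ i"
  proof unfold_locales
    show "compact K0" unfolding K0_def by (rule compact_translation[OF K(1)])
    show "convex K0" unfolding K0_def by (rule convex_translation[OF K(2)])
    show "0 < \<rho>" by (rule \<rho>)
    show "cball 0 \<rho> \<subseteq> K0"
    proof
      fix x :: "real^'n" assume "x \<in> cball 0 \<rho>"
      then have "a + x \<in> cball a \<rho>" by (simp add: dist_norm)
      then have "a + x \<in> K" using \<rho> by blast
      then show "x \<in> K0" unfolding K0_def by (intro image_eqI[of _ _ "a + x"]) auto
    qed
  qed
  define V where "V = (real CARD('n) + 1) * (\<integral>x. indicator K0 x * (p x * M x) \<partial>lborel)"
  have "0 \<le> (\<integral>x. indicator K0 x * (p x * M x) \<partial>lborel)"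
    by (intro integral_nonneg_AE AE_I2) (auto simp: gauge_nonneg M_ge)
  then have V0: "0 \<le> V" by (simp add: V_def)
  have fK: "frontier K = (+) a ` {b. p b = 1}" unfolding KK0 frontier_translation frontier_K ..
  define m0 where "m0 y = ennreal (M y / norm (G y)) * indicator ({b. p b = 1} \<inter> D) y" for y
  have [measurable]: "{b. p b = 1} \<inter> D \<in> sets borel" by measurable
  have m0 [measurable]: "m0 \<in> borel_measurable borel" unfolding m0_def by measurable
  \<comment> \<open>At singular boundary points \<open>outer_normal\<close> is an unspecified value;
    they form a null set, so the integrand may be changed there.\<close>
  have Z: "{b. p b = 1} - D \<in> null_sets ?H"
    using hausdorff_singular_null by (auto simp: null_sets_def emeasure_hausdorff_measure)
  have minus: "(\<lambda>y::real^'n. y - a) \<in> borel_measurable borel" by simp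
  have AEZ: "AE y in ?H. y - a \<notin> {b. p b = 1} - D"
  proof -
    have "AE y in distr ?H borel (\<lambda>y. y - a). y \<notin> {b. p b = 1} - D"
      unfolding distr_hausdorff_measure_translate by (rule AE_not_in[OF Z])
    then show ?thesis by (subst (asm) AE_distr_iff) auto
  qed
  \<comment> \<open>Integral and outer normals are both moved to the translated body.\<close>
  have "I = (\<integral>\<^sup>+y. m0 (y - a) \<partial>?H)"
    unfolding I_def
  proof (rule nn_integral_cong_AE)
    show "AE y in ?H. ennreal (Max (range (\<lambda>i. negpart (\<theta> $ i \<bullet> outer_normal K y)))) * indicator (frontier K) y = m0 (y - a)"
      using AEZ
    proof eventually_elim
      case (elim y)
      have fr: "y \<in> frontier K \<longleftrightarrow> p (y - a) = 1" unfolding fK mem_translation_iff by simp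
      show ?case
      proof (cases "p (y - a) = 1")
        case True
        then have "y - a \<in> D" using elim by auto
        moreover have "outer_normal K y = outer_normal K0 (y - a)" using outer_normal_translate[of a K0 "y - a"] by (simp add: KK0)
        ultimately show ?thesis using True Max_negpart_normal[of "y - a"] by (simp add: m0_def fr)
      qed (simp add: m0_def fr)
    qed
  qed
  also have "\<dots> = (\<integral>\<^sup>+y. m0 y \<partial>distr ?H borel (\<lambda>y. y - a))" by (rule nn_integral_distr[symmetric]) auto
  also have "\<dots> = (\<integral>\<^sup>+y. m0 y \<partial>?H)" by (simp only: distr_hausdorff_measure_translate)
  also have "\<dots> = ennreal V" unfolding m0_def V_def by (rule surface_integral_M)
  finally have I: "I = ennreal V" .
  have cov: "covariogram K (r *\<^sub>R \<theta>) = measure lebesgue (inner_body r)" for r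
  proof -
    have "K \<inter> (\<Inter>i. (\<lambda>y. (r *\<^sub>R \<theta>) $ i + y) ` K) = (+) a ` inner_body r"
    proof -
      have 1: "y \<in> (\<lambda>y. (r *\<^sub>R \<theta>) $ i + y) ` K \<longleftrightarrow> y - r *\<^sub>R \<theta> $ i \<in> K" for y i
        using mem_translation_iff[of y "(r *\<^sub>R \<theta>) $ i" K] by simp
      have 2: "y \<in> K \<longleftrightarrow> y - a \<in> K0" for y
        unfolding KK0 by (rule mem_translation_iff)
      show ?thesis unfolding set_eq_iff Int_iff INT_iff 1 2 mem_translation_iff inner_body_def by (auto simp: diff_diff_eq add.commute)
    qed
    then show ?thesis unfolding covariogram_def by (simp only: measure_translation)
  qed
  \<comment> \<open>At \<open>r = 0\<close> the intersection is the body itself, so this is the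
    volume quotient with the sign reversed.\<close>
  have "((\<lambda>r. (covariogram K (r *\<^sub>R \<theta>) - covariogram K (0 *\<^sub>R \<theta>)) / (r - 0)) \<longlongrightarrow> - V) (at_right 0)"
  proof -
    have "((\<lambda>r. - ((measure lebesgue K0 - measure lebesgue (inner_body r)) / r)) \<longlongrightarrow> - V) (at_right 0)"
      unfolding V_def using inner_body_derivative by (intro tendsto_minus) simp
    then show ?thesis unfolding cov inner_body_0 by (simp add: minus_divide_left)
  qed
  then have "((\<lambda>r. covariogram K (r *\<^sub>R \<theta>)) has_real_derivative - V) (at_right 0)"
    by (simp only: has_field_derivative_iff)
  then show ?thesis unfolding I using V0 by simp
qed

end
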